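(* Let $\sigma>0$ and let $u_0\in L^2_+(\mathbb T)\cap G_{\sigma}(W)$. Let $u\in C(\mathbb R, H^{1/2}_+(\mathbb T))$ be the unique global solution of the cubic Szeg\H{o} equation $$i\partial_t u=\Pi(|u|^2u),\qquad (t,\theta)\in\mathbb R\times\mathbb T,\qquad u(0)=u_0.$$ Then there exist constants $\lambda>0$ and $C_0>0$, depending on $u_0$ (and $\sigma$), such that, setting $\tau(t)=\sigma e^{-\lambda|t|}$, one has $u(t)\in G_{\tau(t)}(W)$ for all $t\in\mathbb R$, and more precisely $$\|u(t)\|_{G_{\tau(t)}(W)}\le C_0\quad\text{for all } t\in\mathbb R.$$
   Context: $\mathbb T=\mathbb R/2\pi\mathbb Z$. For $u\in L^1(\mathbb T)$ write $u=\sum_{k\in\mathbb Z}\hat u(k)e^{ik\theta}$. The Hardy space is $L^2_+(\mathbb T)=\{u\in L^2(\mathbb T):\hat u(k)=0 \text{ for all } k<0\}$, and $H^s_+(\mathbb T)=H^s(\mathbb T)\cap L^2_+(\mathbb T)$. The Szeg\H{o} projector $\Pi:L^2(\mathbb T)\to L^2_+(\mathbb T)$ is $\Pi(\sum_{k\in\mathbb Z}v_ke^{ik\theta})=\sum_{k\ge0}v_ke^{ik\theta}$. For $\sigma\ge0$, the Gevrey norm is $\|u\|_{G_\sigma(W)}=\sum_{k\in\mathbb Z}e^{\sigma|k|}|\hat u(k)|$, and $G_\sigma(W)$ is the set of $u\in L^1(\mathbb T)$ with $\|u\|_{G_\sigma(W)}<\infty$ ($W=G_0(W)$ is the Wiener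 algebra). It is known (prior work) that for $u_0\in H^s_+(\mathbb T)$, $s\ge 1/2$, the cubic Szeg\H{o} equation has a unique solution $u\in C(\mathbb R,H^s_+(\mathbb T))$. *)

theory Defs
  imports "HOL-Analysis.Analysis"
begin

text \<open>Functions on the torus T = R/2piZ are represented as 2pi-periodic
  functions real => complex.\<close>

definition periodic_2pi :: "(real \<Rightarrow> complex) \<Rightarrow> bool" where
  "periodic_2pi f \<longleftrightarrow> (\<forall>\<theta>. f (\<theta> + 2 * pi) = f \<theta>)"

definition fourier_coeff :: "(real \<Rightarrow> complex) \<Rightarrow> int \<Rightarrow> complex" where
  "fourier_coeff f k =
     (LINT \<theta>:{0..2*pi}|lborel. f \<theta> * cis (- (real_of_int k * \<theta>))) / complex_of_real (2 * pi)"

definition in_L1_T :: "(real \<Rightarrow> complex) \<Rightarrow> bool" where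
  "in_L1_T f \<longleftrightarrow> periodic_2pi f \<and> f \<in> borel_measurable lborel \<and>
     set_integrable lborel {0..2*pi} f"

definition in_L2_T :: "(real \<Rightarrow> complex) \<Rightarrow> bool" where
  "in_L2_T f \<longleftrightarrow> periodic_2pi f \<and> f \<in> borel_measurable lborel \<and>
     set_integrable lborel {0..2*pi} (\<lambda>\<theta>. (cmod (f \<theta>))\<^sup>2)"

definition in_L2_plus :: "(real \<Rightarrow> complex) \<Rightarrow> bool" where
  "in_L2_plus f \<longleftrightarrow> in_L2_T f \<and> (\<forall>k::int. k < 0 \<longrightarrow> fourier_coeff f k = 0)"

definition in_H :: "real \<Rightarrow> (real \<Rightarrow> complex) \<Rightarrow> bool" where
  "in_H s f \<longleftrightarrow> in_L2_T f \<and>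
     (\<lambda>k::int. (1 + (real_of_int k)\<^sup>2) powr s * (cmod (fourier_coeff f k))\<^sup>2) summable_on UNIV"

definition H_norm :: "real \<Rightarrow> (real \<Rightarrow> complex) \<Rightarrow> real" where
  "H_norm s f = sqrt (\<Sum>\<^sub>\<infinity>k::int. (1 + (real_of_int k)\<^sup>2) powr s * (cmod (fourier_coeff f k))\<^sup>2)"

definition in_H_plus :: "real \<Rightarrow> (real \<Rightarrow> complex) \<Rightarrow> bool" where
  "in_H_plus s f \<longleftrightarrow> in_H s f \<and> in_L2_plus f"

definition gevrey_norm :: "real \<Rightarrow> (real \<Rightarrow> complex) \<Rightarrow> real" where
  "gevrey_norm \<sigma> f = (\<Sum>\<^sub>\<infinity>k::int. exp (\<sigma> * \<bar>real_of_int k\<bar>) * cmod (fourier_coeff f k))"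

definition in_gevrey :: "real \<Rightarrow> (real \<Rightarrow> complex) \<Rightarrow> bool" where
  "in_gevrey \<sigma> f \<longleftrightarrow> in_L1_T f \<and>
     (\<lambda>k::int. exp (\<sigma> * \<bar>real_of_int k\<bar>) * cmod (fourier_coeff f k)) summable_on UNIV"

text \<open>Solution u in C(R, H^{1/2}_+(T)) of  i d/dt u = Pi(|u|^2 u), u(0) = u0,
  with the equation understood Fourier-mode-wise (equivalently, Duhamel form):
  for every k >= 0, d/dt hat u(t,k) = -i * hat(|u|^2 u)(t,k).  (Modes k < 0 vanish.)\<close>
definition szego_solution :: "(real \<Rightarrow> real \<Rightarrow> complex) \<Rightarrow> (real \<Rightarrow> complex) \<Rightarrow> bool" where
  "szego_solution u u0 \<longleftrightarrow>
     (\<forall>t. in_H_plus (1/2) (u t)) \<and>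
     (\<forall>t0. ((\<lambda>t. H_norm (1/2) (\<lambda>\<theta>. u t \<theta> - u t0 \<theta>)) \<longlongrightarrow> 0) (at t0)) \<and>
     (\<forall>k::int. k \<ge> 0 \<longrightarrow> (\<forall>t::real.
        ((\<lambda>s. fourier_coeff (u s) k) has_vector_derivative
           (- \<i> * fourier_coeff (\<lambda>\<theta>. complex_of_real ((cmod (u t \<theta>))\<^sup>2) * u t \<theta>) k)) (at t))) \<and>
     u 0 = u0"

end

theory Submission
  imports Defs
begin

text \<open>
  Let \<open>H\<^sub>u g = \<Pi>(u cnj g)\<close> be the Hankel operator and \<open>B\<^sub>u = (i/2) H\<^sub>u\<^sup>2 - i T\<^bsub>|u|\<^sup>2\<^esub>\<close>. By the Lax pair,
  \<open>\<langle>u, g h\<rangle>\<close> and \<open>\<langle>g, h\<rangle>\<close> are conserved when \<open>g\<close>, \<open>h\<close> solve \<open>g' = B\<^sub>u g\<close>. Let \<open>g\<^sub>n\<close> be the solution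
  that equals \<open>e\<^sup>i\<^sup>n\<^sup>\<theta>\<close> at time \<open>T\<close>. The coefficient of \<open>u(T)\<close> at \<open>n + m\<close> is then \<open>\<langle>u(0), g\<^sub>n(0) g\<^sub>m(0)\<rangle>\<close> with
  \<open>(g\<^sub>n(0))\<close> orthonormal, and Bessel's inequality bounds the Wiener norm of \<open>u(T)\<close> by
  \<open>M = 2 \<Sum> (m + 1) |u\<^sub>0\<^sub>,\<^sub>m|\<close>, uniformly in \<open>T\<close>. This replaces conservation of the trace norm of \<open>H\<^sub>u\<close>.

  Let \<open>y\<close> be the norm of \<open>u(t)\<close> in \<open>G\<^bsub>\<tau>(t)\<^esub>\<close> and \<open>Z\<close> the same sum with an additional weight \<open>|k|\<close>. Since
  \<open>\<tau>' = -\<lambda> \<tau>\<close> and \<open>y \<le> M + \<tau> Z\<close>, one has \<open>y' \<le> -\<lambda> \<tau> Z + M y\<^sup>2 \<le> -\<lambda> (y - M) + M y\<^sup>2\<close>, so that for large \<open>\<lambda>\<close> the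
  norm \<open>y\<close> cannot cross a level \<open>C > M\<close>.

  Both arguments need a solution in the Wiener algebra, which is constructed directly. The given
  solution is only in \<open>H\<^sup>1\<^sup>/\<^sup>2\<close>; it coincides with the constructed one because the \<open>L\<^sup>2\<close> norm of the difference \<open>w\<close>
  satisfies a linear Gronwall inequality: the only term of higher order, \<open>\<integral> |w|\<^sup>2 w cnj v\<close>, is
  controlled by \<open>\<parallel>v\<parallel> \<parallel>w\<parallel>\<^bsub>H\<^sup>1\<^sup>/\<^sup>2\<^esub> \<parallel>w\<parallel>\<^sup>2\<close>, with the Wiener norm of \<open>v\<close> and the \<open>L\<^sup>2\<close> norm of \<open>w\<close>.
\<close>

text \<open>The bound \<open>M\<close> has to be independent of \<open>T\<close>: otherwise
  \<open>lam\<close> would depend on \<open>T\<close>, and the radius would shrink faster than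
  exponentially. Neither the H^1/2 norm nor any Sobolev energy controls the Wiener norm, hence the
  recourse to the Lax pair. Orthonormality of finitely many flow vectors is all that is taken from
  it; no compactness or spectral theory of Hankel operators enters. Positivity of the initial radius
  is what makes \<open>M\<close> finite. In \<open>u u cnj u\<close> an output frequency is
  \<open>i + j - b\<close> with \<open>b >= 0\<close>, so it is at most \<open>i + j\<close>. The
  exponential weight therefore distributes over the two analytic factors, and the conjugate factor
  is measured in the Wiener norm alone: this is the origin of \<open>M y^2\<close>. The given
  solution satisfies the equation mode by mode only. Its nonlinearity must first be expressed
  through Fourier coefficients, which needs \<open>u u\<close> in L2, and its energy identity holds
  at first for finitely many modes. Negative times follow from a symmetry that preserves the moduli
  of the initial coefficients, so that the same constants serve both directions.\<close>

section \<open>The analytic part of the Wiener algebra\<close>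

text \<open>Elements are represented by their Fourier coefficients of nonnegative index.\<close>

typedef ell1 = "{x :: nat \<Rightarrow> complex. summable (\<lambda>n. cmod (x n))}"
  morphisms coef Ell1
  by (rule exI[of _ "\<lambda>_. 0"]) simp

setup_lifting type_definition_ell1

lemma summable_coef [simp]: "summable (\<lambda>n. cmod (coef x n))"
  using coef[of x] by simp

lemma ell1_eqI: "(\<And>n. coef x n = coef y n) \<Longrightarrow> x = y"
  by (metis coef_inject ext)

instantiation ell1 :: real_normed_vector
begin

lift_definition zero_ell1 :: ell1 is "\<lambda>_. 0"
  by simp

lift_definition plus_ell1 :: "ell1 \<Rightarrow> ell1 \<Rightarrow> ell1" is "\<lambda>x y n. x n + y n"
  subgoal for x y
    by (rule summable_comparison_test[OF _ summable_add[of "\<lambda>n. cmod (x n)" "\<lambda>n. cmod (y n)"]])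
       (auto intro: norm_triangle_ineq)
  done

lift_definition uminus_ell1 :: "ell1 \<Rightarrow> ell1" is "\<lambda>x n. - x n"
  by simp

lift_definition minus_ell1 :: "ell1 \<Rightarrow> ell1 \<Rightarrow> ell1" is "\<lambda>x y n. x n - y n"
  subgoal for x y
    by (rule summable_comparison_test[OF _ summable_add[of "\<lambda>n. cmod (x n)" "\<lambda>n. cmod (y n)"]])
       (auto intro: norm_triangle_ineq4)
  done

lift_definition scaleR_ell1 :: "real \<Rightarrow> ell1 \<Rightarrow> ell1" is "\<lambda>r x n. r *\<^sub>R x n"
  by (simp add: summable_mult)

definition norm_ell1 :: "ell1 \<Rightarrow> real" where
  "norm_ell1 x = (\<Sum>n. cmod (coef x n))"

definition dist_ell1 :: "ell1 \<Rightarrow> ell1 \<Rightarrow> real" where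
  "dist_ell1 x y = norm (x - y)"

definition sgn_ell1 :: "ell1 \<Rightarrow> ell1" where
  "sgn_ell1 x = scaleR (inverse (norm x)) x"

definition uniformity_ell1 :: "(ell1 \<times> ell1) filter" where
  "uniformity_ell1 = (INF e\<in>{0<..}. principal {(x, y). dist x y < e})"

definition open_ell1 :: "ell1 set \<Rightarrow> bool" where
  "open_ell1 U = (\<forall>x\<in>U. \<forall>\<^sub>F (x', y) in uniformity. x' = x \<longrightarrow> y \<in> U)"

instance
proof
  fix x y :: ell1 and a :: real
  show "(norm x = 0) = (x = 0)"
  proof
    assume "norm x = 0"
    then have "\<forall>n. cmod (coef x n) = 0"
      by (subst (asm) norm_ell1_def, subst (asm) suminf_eq_zero_iff) auto
    then show "x = 0"
      by (intro ell1_eqI) (simp add: zero_ell1.rep_eq)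
  qed (simp add: norm_ell1_def zero_ell1.rep_eq)
  show "norm (x + y) \<le> norm x + norm y"
    unfolding norm_ell1_def plus_ell1.rep_eq
    by (subst suminf_add[OF summable_coef summable_coef])
       (intro suminf_le norm_triangle_ineq summable_add summable_coef
          summable_comparison_test[OF _ summable_add[OF summable_coef[of x] summable_coef[of y]]],
        auto intro: norm_triangle_ineq)
  show "norm (a *\<^sub>R x) = \<bar>a\<bar> * norm x"
    unfolding norm_ell1_def scaleR_ell1.rep_eq by (simp add: suminf_mult)
qed (rule dist_ell1_def sgn_ell1_def uniformity_ell1_def open_ell1_def
      | transfer; simp add: algebra_simps fun_eq_iff)+

end

lemma coef_simps [simp]:
  "coef 0 n = 0" "coef (x + y) n = coef x n + coef y n" "coef (- x) n = - coef x n"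
  "coef (x - y) n = coef x n - coef y n" "coef (r *\<^sub>R x) n = r *\<^sub>R coef x n"
  by (simp_all add: zero_ell1.rep_eq plus_ell1.rep_eq uminus_ell1.rep_eq minus_ell1.rep_eq scaleR_ell1.rep_eq)

lemma sum_coef_le: "finite A \<Longrightarrow> (\<Sum>n\<in>A. cmod (coef x n)) \<le> norm x"
  unfolding norm_ell1_def by (rule sum_le_suminf) auto

lemma coef_le_norm: "cmod (coef x n) \<le> norm x"
  using sum_coef_le[of "{n}" x] by simp

text \<open>A uniform bound on finite partial sums is all that has to be checked for a raw sequence.
  It also inverts \<open>Ell1\<close>, which lets \<open>ell1_mult\<close> and \<open>corr\<close>
  be defined by bare formulas.\<close>

lemma ell1_leI:
  assumes "\<And>N. (\<Sum>n<N. cmod (f n)) \<le> C"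
  shows "summable (\<lambda>n. cmod (f n))" "norm (Ell1 f) \<le> C" "coef (Ell1 f) = f"
proof -
  show s: "summable (\<lambda>n. cmod (f n))"
    by (rule summableI_nonneg_bounded[OF _ assms]) auto
  show e: "coef (Ell1 f) = f"
    by (rule Ell1_inverse) (use s in simp)
  show "norm (Ell1 f) \<le> C"
    unfolding norm_ell1_def e using s assms by (rule suminf_le_const)
qed

lemma norm_ell1_leI: "(\<And>N. (\<Sum>n<N. cmod (coef x n)) \<le> C) \<Longrightarrow> norm x \<le> C"
  unfolding norm_ell1_def by (rule suminf_le_const) auto

lemma bounded_linear_coef: "bounded_linear (\<lambda>x. coef x n)"
  by (rule bounded_linear_intro[where K = 1]) (auto simp: coef_le_norm)

instance ell1 :: banach
proof
  fix X :: "nat \<Rightarrow> ell1"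
  assume X: "Cauchy X"
  have "Cauchy (\<lambda>i. coef (X i) n)" for n
    by (rule bounded_linear.Cauchy[OF bounded_linear_coef X])
  then have "\<forall>n. \<exists>l. (\<lambda>i. coef (X i) n) \<longlonglongrightarrow> l"
    by (simp add: Cauchy_convergent_iff convergent_def)
  then obtain l where l: "\<And>n. (\<lambda>i. coef (X i) n) \<longlonglongrightarrow> l n"
    by metis
  \<comment> \<open>The index \<open>j\<close> is sent to infinity inside finite sums, so the Cauchy
    estimate survives uniformly in \<open>N\<close>; this upgrades coefficientwise convergence to
    norm convergence.\<close>
  have est: "\<exists>i0. \<forall>i\<ge>i0. \<forall>N. (\<Sum>n<N. cmod (coef (X i) n - l n)) \<le> e" if e: "e > 0" for e
  proof -
    obtain i0 where i0: "\<And>i j. i \<ge> i0 \<Longrightarrow> j \<ge> i0 \<Longrightarrow> norm (X i - X j) < e"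
      using X e unfolding Cauchy_iff by blast
    have "(\<Sum>n<N. cmod (coef (X i) n - l n)) \<le> e" if i: "i \<ge> i0" for i N
    proof (rule LIMSEQ_le_const2)
      show "(\<lambda>j. \<Sum>n<N. cmod (coef (X i) n - coef (X j) n)) \<longlonglongrightarrow> (\<Sum>n<N. cmod (coef (X i) n - l n))"
        by (intro tendsto_intros l)
      show "\<exists>j0. \<forall>j\<ge>j0. (\<Sum>n<N. cmod (coef (X i) n - coef (X j) n)) \<le> e"
        using sum_coef_le[of "{..<N}" "X i - X _"] i0[OF i]
        by (metis (no_types, lifting) coef_simps(4) finite_lessThan less_imp_le order_trans sum.cong)
    qed
    then show ?thesis by blast
  qed
  obtain i1 where i1: "\<And>N. (\<Sum>n<N. cmod (coef (X i1) n - l n)) \<le> 1"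
    using est[of 1] by auto
  have "(\<Sum>n<N. cmod (l n)) \<le> norm (X i1) + 1" for N
  proof -
    have "(\<Sum>n<N. cmod (l n)) \<le> (\<Sum>n<N. cmod (coef (X i1) n) + cmod (coef (X i1) n - l n))"
      by (intro sum_mono) (metis add.commute norm_minus_commute norm_triangle_sub)
    also have "\<dots> \<le> norm (X i1) + 1"
      unfolding sum.distrib by (intro add_mono sum_coef_le i1) auto
    finally show ?thesis .
  qed
  note L = ell1_leI[OF this]
  have "X \<longlonglongrightarrow> Ell1 l"
  proof (rule LIMSEQ_I)
    fix r :: real assume "r > 0"
    then obtain i0 where "\<forall>i\<ge>i0. \<forall>N. (\<Sum>n<N. cmod (coef (X i) n - l n)) \<le> r / 2"
      using est[of "r / 2"] by auto
    then have e: "\<And>i N. i \<ge> i0 \<Longrightarrow> (\<Sum>n<N. cmod (coef (X i) n - l n)) \<le> r / 2"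
      by blast
    have "norm (X i - Ell1 l) \<le> r / 2" if "i \<ge> i0" for i
    proof (rule norm_ell1_leI)
      show "(\<Sum>n<N. cmod (coef (X i - Ell1 l) n)) \<le> r / 2" for N
        using e[OF that, of N] by (simp only: L(3) coef_simps)
    qed
    with \<open>r > 0\<close> have "norm (X i - Ell1 l) < r" if "i \<ge> i0" for i
      using that by (rule_tac le_less_trans[of _ "r / 2"]) auto
    then show "\<exists>no. \<forall>n\<ge>no. norm (X n - Ell1 l) < r"
      by blast
  qed
  then show "convergent X"
    by (auto simp: convergent_def)
qed

section \<open>Monomials, and the reduction of algebraic identities to them\<close>

lift_definition single :: "nat \<Rightarrow> complex \<Rightarrow> ell1" is "\<lambda>n c k. if k = n then c else 0"
  by (rule summable_finite[of "{_}"]) auto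

lemma coef_single: "coef (single n c) k = (if k = n then c else 0)"
  by (simp add: single.rep_eq)

lemma single_0 [simp]: "single n 0 = 0"
  by (rule ell1_eqI) (simp add: coef_single)

lemma norm_single [simp]: "norm (single n c) = cmod c"
proof -
  have "(\<lambda>k. cmod (coef (single n c) k)) = (\<lambda>k. if k = n then cmod c else 0)"
    by (auto simp: coef_single)
  then show ?thesis
    unfolding norm_ell1_def using sums_single[of n "\<lambda>_. cmod c"] by (simp add: sums_iff)
qed

lemma coef_sum: "coef (sum f A) n = (\<Sum>i\<in>A. coef (f i) n)"
  by (induction A rule: infinite_finite_induct) auto

lemma sums_single_coef: "(\<lambda>n. single n (coef x n)) sums x"
proof -
  have tail: "norm (x - (\<Sum>n<N. single n (coef x n))) = (\<Sum>n. cmod (coef x (n + N)))" for N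
  proof -
    have c: "coef (x - (\<Sum>n<N. single n (coef x n))) k = (if k < N then 0 else coef x k)" for k
      by (simp add: coef_sum coef_single sum.If_cases)
    have "norm (x - (\<Sum>n<N. single n (coef x n)))
      = (\<Sum>k. cmod (coef (x - (\<Sum>n<N. single n (coef x n))) (k + N)))
        + (\<Sum>k<N. cmod (coef (x - (\<Sum>n<N. single n (coef x n))) k))"
      unfolding norm_ell1_def by (rule suminf_split_initial_segment) (rule summable_coef)
    then show ?thesis by (simp only: c) simp
  qed
  have "(\<lambda>N. norm (x - (\<Sum>n<N. single n (coef x n)))) \<longlonglongrightarrow> 0"
    unfolding tail by (rule suminf_exist_split2) (rule summable_coef)
  from tendsto_diff[OF tendsto_const[of x] tendsto_norm_zero_cancel[OF this]]
  show ?thesis by (simp add: sums_def)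
qed

text \<open>Every element is the norm convergent sum of its monomials. Only real linearity is asked
  for, with \<open>c\<close> ranging over all complex numbers; hence conjugate linear maps are
  covered too.\<close>

lemma bounded_linear_ell1_eqI:
  assumes f: "bounded_linear f" and g: "bounded_linear g"
    and "\<And>n c. f (single n c) = g (single n c)"
  shows "f x = (g x :: 'a :: real_normed_vector)"
  using bounded_linear.sums[OF f sums_single_coef[of x]] bounded_linear.sums[OF g sums_single_coef[of x]]
  by (simp add: assms(3) sums_unique2)

definition ell1_mult :: "ell1 \<Rightarrow> ell1 \<Rightarrow> ell1" where
  "ell1_mult x y = Ell1 (\<lambda>n. \<Sum>i\<le>n. coef x i * coef y (n - i))"

lemma coef_ell1_mult: "coef (ell1_mult x y) n = (\<Sum>i\<le>n. coef x i * coef y (n - i))"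
  and norm_ell1_mult: "norm (ell1_mult x y) \<le> norm x * norm y"
proof -
  have "(\<lambda>n. \<Sum>i\<le>n. cmod (coef x i) * cmod (coef y (n - i))) sums (norm x * norm y)"
    unfolding norm_ell1_def by (rule Cauchy_product_sums) simp_all
  then have s: "summable (\<lambda>n. \<Sum>i\<le>n. cmod (coef x i) * cmod (coef y (n - i)))"
    and e: "(\<Sum>n. \<Sum>i\<le>n. cmod (coef x i) * cmod (coef y (n - i))) = norm x * norm y"
    by (simp_all add: sums_iff)
  have "(\<Sum>n<N. cmod (\<Sum>i\<le>n. coef x i * coef y (n - i))) \<le> norm x * norm y" for N
  proof -
    have "(\<Sum>n<N. cmod (\<Sum>i\<le>n. coef x i * coef y (n - i)))
        \<le> (\<Sum>n<N. \<Sum>i\<le>n. cmod (coef x i) * cmod (coef y (n - i)))"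
      by (intro sum_mono sum_norm_le) (simp add: norm_mult)
    also have "\<dots> \<le> norm x * norm y"
      unfolding e[symmetric] by (rule sum_le_suminf[OF s]) (auto intro: sum_nonneg)
    finally show ?thesis .
  qed
  from ell1_leI[OF this]
  show "coef (ell1_mult x y) n = (\<Sum>i\<le>n. coef x i * coef y (n - i))"
    and "norm (ell1_mult x y) \<le> norm x * norm y"
    by (simp_all add: ell1_mult_def)
qed

lemma bounded_bilinear_ell1_mult: "bounded_bilinear ell1_mult"
  by (rule bounded_bilinear.intro)
     (auto intro!: ell1_eqI exI[of _ 1] simp: coef_ell1_mult norm_ell1_mult
        algebra_simps sum.distrib scaleR_sum_right)

lemma ell1_mult_single: "ell1_mult (single n c) (single m d) = single (n + m) (c * d)"
proof (rule ell1_eqI)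
  fix k
  have "coef (ell1_mult (single n c) (single m d)) k
      = (\<Sum>i\<le>k. if i = n then (if k = n + m then c * d else 0) else 0)"
    unfolding coef_ell1_mult by (intro sum.cong) (auto simp: coef_single)
  then show "coef (ell1_mult (single n c) (single m d)) k = coef (single (n + m) (c * d)) k"
    by (auto simp: coef_single)
qed

text \<open>Turns associativity and the identities between products and projections into case
  distinctions on three exponents.\<close>

lemma ell1_trilinear_eqI:
  fixes f g :: "ell1 \<Rightarrow> ell1 \<Rightarrow> ell1 \<Rightarrow> 'a :: real_normed_vector"
  assumes "\<And>y z. bounded_linear (\<lambda>x. f x y z)" "\<And>x z. bounded_linear (\<lambda>y. f x y z)"
    "\<And>x y. bounded_linear (f x y)"
    and "\<And>y z. bounded_linear (\<lambda>x. g x y z)" "\<And>x z. bounded_linear (\<lambda>y. g x y z)"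
    "\<And>x y. bounded_linear (g x y)"
    and e: "\<And>l a m b n c. f (single l a) (single m b) (single n c) = g (single l a) (single m b) (single n c)"
  shows "f x y z = g x y z"
proof -
  have 1: "f (single l a) (single m b) z = g (single l a) (single m b) z" for l a m b z
    by (rule bounded_linear_ell1_eqI[OF assms(3,6)]) (rule e)
  have 2: "f (single l a) y z = g (single l a) y z" for l a y z
    by (rule bounded_linear_ell1_eqI[OF assms(2,5)]) (rule 1)
  show ?thesis
    by (rule bounded_linear_ell1_eqI[OF assms(1,4)]) (rule 2)
qed

instantiation ell1 :: "{comm_ring_1, real_normed_algebra_1}"
begin

definition one_ell1 :: ell1 where "one_ell1 = single 0 1"

definition times_ell1 :: "ell1 \<Rightarrow> ell1 \<Rightarrow> ell1" where "times_ell1 = ell1_mult"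

instance
proof
  interpret bounded_bilinear ell1_mult by (rule bounded_bilinear_ell1_mult)
  fix a b c :: ell1 and r :: real
  note bl = bounded_linear_left bounded_linear_right
  show "a * b * c = a * (b * c)"
    unfolding times_ell1_def
  proof (rule ell1_trilinear_eqI[of "\<lambda>a b c. ell1_mult (ell1_mult a b) c" "\<lambda>a b c. ell1_mult a (ell1_mult b c)"])
    show "ell1_mult (ell1_mult (single l a) (single m b)) (single n c)
        = ell1_mult (single l a) (ell1_mult (single m b) (single n c))" for l a m b n c
      by (simp add: ell1_mult_single algebra_simps)
  qed (rule bl bounded_linear_compose[OF bounded_linear_left bounded_linear_left]
      bounded_linear_compose[OF bounded_linear_left bounded_linear_right]
      bounded_linear_compose[OF bounded_linear_right bounded_linear_left]
      bounded_linear_compose[OF bounded_linear_right bounded_linear_right])+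
  show comm: "a * b = b * a"
    unfolding times_ell1_def
  proof (rule bounded_linear_ell1_eqI[OF bounded_linear_left bounded_linear_right])
    show "ell1_mult (single n c) b = ell1_mult b (single n c)" for n c
      by (rule bounded_linear_ell1_eqI[OF bounded_linear_right bounded_linear_left])
         (simp add: ell1_mult_single algebra_simps)
  qed
  show "1 * a = a"
    unfolding times_ell1_def one_ell1_def
    by (rule bounded_linear_ell1_eqI[of "ell1_mult (single 0 1)" "\<lambda>x. x"])
       (simp_all add: bl bounded_linear_ident ell1_mult_single)
  show "(a + b) * c = a * c + b * c" "a * (b + c) = a * b + a * c"
    by (simp_all add: times_ell1_def add_left add_right)
  show "a * 1 = a"
    unfolding times_ell1_def one_ell1_def
    by (rule bounded_linear_ell1_eqI[of "\<lambda>a. ell1_mult a (single 0 1)" "\<lambda>x. x"])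
       (simp_all add: bl bounded_linear_ident ell1_mult_single)
  show "norm (a * b) \<le> norm a * norm b"
    unfolding times_ell1_def by (rule norm_ell1_mult)
  show "(0 :: ell1) \<noteq> 1"
    by (metis coef_simps(1) coef_single one_ell1_def zero_neq_one)
  show "norm (1 :: ell1) = 1"
    by (simp add: one_ell1_def)
qed (simp_all add: times_ell1_def bounded_bilinear.scaleR_left[OF bounded_bilinear_ell1_mult]
      bounded_bilinear.scaleR_right[OF bounded_bilinear_ell1_mult])

end

lemma coef_mult: "coef (x * y) n = (\<Sum>i\<le>n. coef x i * coef y (n - i))"
  by (simp add: times_ell1_def coef_ell1_mult)

lemma mult_single: "single n c * single m d = single (n + m) (c * d)"
  by (simp add: times_ell1_def ell1_mult_single)

section \<open>The Szego projection of a product with a conjugate\<close>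

text \<open>The frequencies \<open>n + b\<close> of \<open>x\<close> and \<open>- b\<close> of
  \<open>cnj w\<close> combine to \<open>n >= 0\<close>. Hankel and Toeplitz operators are both
  instances, so a single norm bound serves for all of them.\<close>

definition corr :: "ell1 \<Rightarrow> ell1 \<Rightarrow> ell1" where
  "corr x w = Ell1 (\<lambda>n. \<Sum>b. coef x (n + b) * cnj (coef w b))"

lemma summable_corr: "summable (\<lambda>b. cmod (coef x (n + b)) * cmod (coef w b))"
  by (rule summable_comparison_test[OF _ summable_mult[OF summable_coef, of "norm x" w]])
     (auto intro!: mult_right_mono coef_le_norm)

lemma summable_corr': "summable (\<lambda>b. coef x (n + b) * cnj (coef w b))"
  by (rule summable_norm_cancel) (simp add: norm_mult summable_corr)

lemma coef_corr: "coef (corr x w) n = (\<Sum>b. coef x (n + b) * cnj (coef w b))"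
  and norm_corr: "norm (corr x w) \<le> norm x * norm w"
proof -
  have "(\<Sum>n<N. cmod (\<Sum>b. coef x (n + b) * cnj (coef w b))) \<le> norm x * norm w" for N
  proof -
    have "(\<Sum>n<N. cmod (\<Sum>b. coef x (n + b) * cnj (coef w b)))
        \<le> (\<Sum>n<N. \<Sum>b. cmod (coef x (n + b)) * cmod (coef w b))"
      by (intro sum_mono order_trans[OF summable_norm])
         (simp_all add: norm_mult summable_corr)
    also have "\<dots> = (\<Sum>b. \<Sum>n<N. cmod (coef x (n + b)) * cmod (coef w b))"
      by (rule suminf_sum[symmetric]) (rule summable_corr)
    also have "\<dots> \<le> (\<Sum>b. norm x * cmod (coef w b))"
    proof (rule suminf_le)
      fix b
      have "(\<Sum>n<N. cmod (coef x (n + b))) = (\<Sum>n\<in>(\<lambda>n. n + b) ` {..<N}. cmod (coef x n))"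
        by (subst sum.reindex) auto
      then show "(\<Sum>n<N. cmod (coef x (n + b)) * cmod (coef w b)) \<le> norm x * cmod (coef w b)"
        unfolding sum_distrib_right[symmetric] by (intro mult_right_mono) (auto intro: sum_coef_le)
    qed (intro summable_sum summable_corr summable_mult summable_coef)+
    also have "\<dots> = norm x * norm w"
      by (simp add: norm_ell1_def[of w] suminf_mult)
    finally show ?thesis .
  qed
  from ell1_leI[OF this]
  show "coef (corr x w) n = (\<Sum>b. coef x (n + b) * cnj (coef w b))"
    and "norm (corr x w) \<le> norm x * norm w"
    by (simp_all add: corr_def)
qed

lemma bounded_bilinear_corr: "bounded_bilinear corr"
proof
  fix x y z w :: ell1 and r :: real
  show "corr (x + y) w = corr x w + corr y w" "corr x (y + w) = corr x y + corr x w"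
    by (rule ell1_eqI; simp add: coef_corr distrib_left distrib_right suminf_add[OF summable_corr' summable_corr'])+
  show "corr (r *\<^sub>R x) w = r *\<^sub>R corr x w" "corr x (r *\<^sub>R w) = r *\<^sub>R corr x w"
    by (rule ell1_eqI; simp add: coef_corr suminf_scaleR_right summable_corr')+
  show "\<exists>K. \<forall>x w. norm (corr x w) \<le> norm x * norm w * K"
    by (rule exI[of _ 1]) (simp add: norm_corr)
qed

interpretation corr: bounded_bilinear corr
  by (rule bounded_bilinear_corr)

lemma corr_single: "corr (single n c) (single m d) = (if m \<le> n then single (n - m) (c * cnj d) else 0)"
proof (rule ell1_eqI)
  fix k
  have "(\<lambda>b. coef (single n c) (k + b) * cnj (coef (single m d) b))
      = (\<lambda>b. if b = m then (if k + m = n then c * cnj d else 0) else 0)"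
    by (auto simp: coef_single)
  then have "coef (corr (single n c) (single m d)) k = (if k + m = n then c * cnj d else 0)"
    unfolding coef_corr using sums_single[of m "\<lambda>_. if k + m = n then c * cnj d else 0"] by (simp add: sums_iff)
  then show "coef (corr (single n c) (single m d)) k = coef (if m \<le> n then single (n - m) (c * cnj d) else 0) k"
    by (auto simp: coef_single)
qed

lemmas ell1_bounded_linear =
  bounded_linear_add bounded_linear_sub bounded_linear_ident
  bounded_linear_compose[OF bounded_linear_mult_left] bounded_linear_compose[OF bounded_linear_mult_right]
  bounded_linear_compose[OF corr.bounded_linear_left] bounded_linear_compose[OF corr.bounded_linear_right]

text \<open>Multiplication by the antianalytic \<open>cnj z\<close> only lowers frequencies, so the
  negative ones removed by the inner projection could not have contributed.\<close>

lemma corr_corr: "corr (corr x w) z = corr x (w * z)"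
proof (rule ell1_trilinear_eqI[of "\<lambda>x w z. corr (corr x w) z" "\<lambda>x w z. corr x (w * z)"])
  fix l m n a b c
  show "corr (corr (single l a) (single m b)) (single n c) = corr (single l a) (single m b * single n c)"
    by (auto simp: corr_single mult_single mult.assoc corr.zero_left)
qed (intro ell1_bounded_linear)+

text \<open>Since \<open>ell1\<close> is a real vector space only, complex scalars act through
  multiplication by constant functions.\<close>

definition cst :: "complex \<Rightarrow> ell1" where
  "cst = single 0"

lemma bounded_linear_cst: "bounded_linear cst"
  by (rule bounded_linear_intro[where K = 1]) (auto intro!: ell1_eqI simp: cst_def coef_single)

lemma coef_cst_mult [simp]: "coef (cst c * x) n = c * coef x n"
proof (rule bounded_linear_ell1_eqI[of "\<lambda>x. coef (cst c * x) n" "\<lambda>x. c * coef x n"])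
  show "bounded_linear (\<lambda>x. coef (cst c * x) n)" "bounded_linear (\<lambda>x. c * coef x n)"
    by (rule bounded_linear_compose[OF bounded_linear_coef bounded_linear_mult_right]
          bounded_linear_compose[OF bounded_linear_mult_right bounded_linear_coef])+
qed (simp add: cst_def mult_single coef_single)

lemma corr_cst_left: "corr (cst c * x) y = cst c * corr x y"
  by (rule ell1_eqI) (simp add: coef_corr mult.assoc suminf_mult summable_corr')

lemma corr_cst_right: "corr x (cst c * y) = cst (cnj c) * corr x y"
  by (rule ell1_eqI) (simp add: coef_corr mult.left_commute suminf_mult summable_corr')

lemma coef_corr_0_cnj: "cnj (coef (corr x y) 0) = coef (corr y x) 0"
  using bounded_linear.suminf[OF bounded_linear_cnj summable_corr'[of x 0 y]]
  by (simp add: coef_corr mult.commute)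

text \<open>With \<open>corr x w\<close> standing for the Szego projection of \<open>x w\<^sup>*\<close>, this splits \<open>g w\<^sup>*\<close> into its
  analytic part \<open>corr g w\<close>, the conjugate of its antianalytic part \<open>corr w g\<close>, and the mean
  value, which both of these contain.\<close>

lemma corr_mult_left:
  "corr (u * g) w = u * corr g w + corr u (corr w g) - u * cst (coef (corr g w) 0)"
proof (rule ell1_trilinear_eqI[of "\<lambda>u g w. corr (u * g) w"
      "\<lambda>u g w. u * corr g w + corr u (corr w g) - u * cst (coef (corr g w) 0)"])
  fix l m n a b c
  show "corr (single l a * single m b) (single n c)
     = single l a * corr (single m b) (single n c) + corr (single l a) (corr (single n c) (single m b))
       - single l a * cst (coef (corr (single m b) (single n c)) 0)"
    by (cases "n < m"; cases "n = m"; cases "n \<le> l + m"; cases "n - m \<le> l")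
       (simp_all add: corr_single mult_single cst_def coef_single mult_ac corr.zero_left corr.zero_right)
qed (intro ell1_bounded_linear bounded_linear_compose[OF bounded_linear_cst]
        bounded_linear_compose[OF bounded_linear_coef])+

section \<open>Lipschitz differential equations in Banach spaces\<close>

text \<open>Picard iteration for \<open>y t = exp (- 2 L t) x t\<close>. With this weight in the
  supremum norm the map contracts by 1/2 on the whole of \<open>{0..T}\<close>, so no short
  intervals have to be glued.\<close>

theorem lipschitz_ode_solution:
  fixes f :: "real \<Rightarrow> 'a :: banach \<Rightarrow> 'a"
  assumes T: "0 \<le> T"
    and cont: "\<And>x. continuous_on {0..T} x \<Longrightarrow> continuous_on {0..T} (\<lambda>t. f t (x t))"
    and lip: "\<And>t x y. t \<in> {0..T} \<Longrightarrow> norm (f t x - f t y) \<le> L * norm (x - y)"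
    and L: "0 < L"
  obtains x where "x 0 = x0"
    and "\<And>t. t \<in> {0..T} \<Longrightarrow> (x has_vector_derivative f t (x t)) (at t within {0..T})"
proof -
  \<comment> \<open>Clamping time to \<open>{0..T}\<close> extends the iterates to bounded
    continuous functions on the whole line, the complete space in which the fixed point is
    taken.\<close>
  define cl where "cl t = max 0 (min T t)" for t
  have cl: "cl t \<in> {0..T}" for t
    using T by (auto simp: cl_def)
  have cl_id: "cl t = t" if "t \<in> {0..T}" for t
    using that by (auto simp: cl_def)
  define h where "h y s = f s (exp (2 * L * s) *\<^sub>R y s)" for y s
  define Psi where "Psi y t = exp (- (2 * L * t)) *\<^sub>R (x0 + integral {0..t} (h y))" for y t
  have h_cont: "continuous_on {0..T} (h (apply_bcontfun y))" for y
    unfolding h_def by (intro cont continuous_intros continuous_on_apply_bcontfun)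
  have h_int: "h (apply_bcontfun y) integrable_on {0..t}" if "t \<in> {0..T}" for y t
    by (rule integrable_continuous_real, rule continuous_on_subset[OF h_cont]) (use that in auto)
  have Psi_cont: "continuous_on {0..T} (Psi (apply_bcontfun y))" for y
    unfolding Psi_def using T
    by (intro continuous_intros indefinite_integral_continuous_1 h_int) auto
  have in_b: "(\<lambda>t. Psi (apply_bcontfun y) (cl t)) \<in> bcontfun" for y
  proof -
    have "continuous_on UNIV (\<lambda>t. Psi (apply_bcontfun y) (cl t))"
      by (rule continuous_on_compose2[OF Psi_cont]) (use cl in \<open>auto simp: cl_def[abs_def] intro!: continuous_intros\<close>)
    moreover have "bounded (Psi (apply_bcontfun y) ` {0..T})"
      by (intro compact_imp_bounded compact_continuous_image Psi_cont compact_Icc)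
    then have "bounded (range (\<lambda>t. Psi (apply_bcontfun y) (cl t)))"
      by (rule bounded_subset) (use cl in auto)
    ultimately show ?thesis by (simp add: bcontfun_def)
  qed
  define Phi where "Phi y = Bcontfun (\<lambda>t. Psi (apply_bcontfun y) (cl t))" for y
  have Phi: "apply_bcontfun (Phi y) t = Psi (apply_bcontfun y) (cl t)" for y t
    unfolding Phi_def using Bcontfun_inverse[OF in_b] by simp
  have contraction: "dist (Phi y) (Phi z) \<le> 1/2 * dist y z" for y z
  proof (rule dist_bound)
    fix t' define t where "t = cl t'"
    have t: "t \<in> {0..T}" unfolding t_def by (rule cl)
    define D where "D = dist y z"
    have D: "0 \<le> D" by (simp add: D_def)
    have int: "((\<lambda>s. L * (exp (2 * L * s) * D)) has_integral (exp (2 * L * t) * D / 2 - exp (2 * L * 0) * D / 2)) {0..t}"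
      by (rule fundamental_theorem_of_calculus)
         (use t in \<open>auto intro!: derivative_eq_intros simp flip: has_real_derivative_iff_has_vector_derivative\<close>)
    have "norm (integral {0..t} (h y) - integral {0..t} (h z)) = norm (integral {0..t} (\<lambda>s. h y s - h z s))"
      by (subst integral_diff) (use h_int t in auto)
    also have "\<dots> \<le> integral {0..t} (\<lambda>s. L * (exp (2 * L * s) * D))"
    proof (rule Henstock_Kurzweil_Integration.integral_norm_bound_integral)
      show "(\<lambda>s. h y s - h z s) integrable_on {0..t}"
        by (intro integrable_diff h_int t)
      show "(\<lambda>s. L * (exp (2 * L * s) * D)) integrable_on {0..t}"
        using int by blast
      fix s assume "s \<in> {0..t}"
      then have "norm (h y s - h z s) \<le> L * norm (exp (2 * L * s) *\<^sub>R y s - exp (2 * L * s) *\<^sub>R z s)"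
        unfolding h_def using t by (intro lip) auto
      also have "\<dots> = L * (exp (2 * L * s) * dist (y s) (z s))"
        by (simp add: dist_norm flip: scaleR_diff_right)
      also have "\<dots> \<le> L * (exp (2 * L * s) * D)"
        unfolding D_def using L by (intro mult_left_mono dist_bounded) auto
      finally show "norm (h y s - h z s) \<le> L * (exp (2 * L * s) * D)" .
    qed
    also have "\<dots> \<le> exp (2 * L * t) * (D / 2)"
      using integral_unique[OF int] D by simp
    finally have *: "norm (integral {0..t} (h y) - integral {0..t} (h z)) \<le> exp (2 * L * t) * (D / 2)" .
    have "dist (Phi y t') (Phi z t') = norm (exp (- (2 * L * t)) *\<^sub>R (integral {0..t} (h y) - integral {0..t} (h z)))"
      by (simp add: Phi Psi_def dist_norm algebra_simps flip: t_def)
    also have "\<dots> \<le> exp (- (2 * L * t)) * (exp (2 * L * t) * (D / 2))"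
      unfolding norm_scaleR using * by (intro mult_mono) auto
    also have "\<dots> = D / 2"
      by (simp add: exp_minus field_simps)
    finally show "dist (Phi y t') (Phi z t') \<le> 1/2 * dist y z"
      by (simp add: D_def)
  qed
  obtain y where y: "Phi y = y"
    using banach_fix_type[of "1/2" Phi] contraction by auto
  define x where "x t = exp (2 * L * t) *\<^sub>R y t" for t
  have x: "x t = x0 + integral {0..t} (h y)" if "t \<in> {0..T}" for t
  proof -
    have "y t = Psi y t"
      using Phi[of y t] by (simp add: y cl_id[OF that])
    then show ?thesis
      by (simp add: x_def Psi_def flip: exp_add)
  qed
  show ?thesis
  proof
    show "x 0 = x0"
      using x[of 0] T by simp
    fix t assume t: "t \<in> {0..T}"
    have "((\<lambda>t. x0 + integral {0..t} (h y)) has_vector_derivative 0 + h y t) (at t within {0..T})"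
      by (intro has_vector_derivative_add has_vector_derivative_const integral_has_vector_derivative h_cont t)
    then have "((\<lambda>t. x0 + integral {0..t} (h y)) has_vector_derivative f t (x t)) (at t within {0..T})"
      by (simp add: h_def x_def)
    then show "(x has_vector_derivative f t (x t)) (at t within {0..T})"
      by (rule has_vector_derivative_transform[OF t, rotated]) (use x in auto)
  qed
qed

section \<open>The Lax pair and the bound in the Wiener algebra\<close>

text \<open>The mean value of \<open>x cnj y\<close>, that is the normalised L2 inner product. Going
  through \<open>corr\<close> makes \<open>corr _ w\<close> adjoint to multiplication by
  \<open>w\<close> at once.\<close>

definition ip :: "ell1 \<Rightarrow> ell1 \<Rightarrow> complex" where
  "ip x y = coef (corr x y) 0"

lemma bounded_bilinear_ip: "bounded_bilinear ip"
proof (rule bounded_bilinear.intro)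
  show "\<exists>K. \<forall>a b. norm (ip a b) \<le> norm a * norm b * K"
    unfolding ip_def by (rule exI[of _ 1]) (auto intro: order_trans[OF coef_le_norm norm_corr])
qed (simp_all add: ip_def corr.add_left corr.add_right corr.scaleR_left corr.scaleR_right)

interpretation ip: bounded_bilinear ip
  by (rule bounded_bilinear_ip)

lemma ip_series: "ip x y = (\<Sum>b. coef x b * cnj (coef y b))"
  by (simp add: ip_def coef_corr)

lemma ip_cnj: "cnj (ip x y) = ip y x"
  by (simp add: ip_def coef_corr_0_cnj)

lemma ip_cst_left: "ip (cst c * x) y = c * ip x y"
  by (simp add: ip_def corr_cst_left)

lemma ip_cst_right: "ip x (cst c * y) = cnj c * ip x y"
  by (simp add: ip_def corr_cst_right)

lemma ip_corr_left: "ip (corr x w) y = ip x (w * y)"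
  by (simp add: ip_def corr_corr)

lemma ip_single_right: "ip x (single n 1) = coef x n"
proof -
  have "(\<lambda>b. coef x b * cnj (coef (single n 1) b)) = (\<lambda>b. if b = n then coef x b else 0)"
    by (auto simp: coef_single)
  then show ?thesis
    unfolding ip_series using sums_single[of n "coef x"] by (simp add: sums_iff)
qed

lemma ip_single_left: "ip (single n 1) x = cnj (coef x n)"
  by (metis ip_cnj ip_single_right)

lemma Re_ip_self_nonneg: "0 \<le> Re (ip x x)"
proof -
  have "summable (\<lambda>b. coef x b * cnj (coef x b))"
    using summable_corr'[of x 0 x] by simp
  then have "Re (ip x x) = (\<Sum>b. Re (coef x b * cnj (coef x b)))"
    unfolding ip_series by (rule bounded_linear.suminf[OF bounded_linear_Re])
  also have "\<dots> \<ge> 0"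
    by (intro suminf_nonneg summable_Re) (use \<open>summable _\<close> in simp_all)
  finally show ?thesis .
qed

text \<open>Bessel's inequality for the vector \<open>single j 1\<close>, whose projection onto the
  first \<open>N\<close> vectors is \<open>y\<close>. The sum runs over the vectors at a fixed
  coordinate, not over the coordinates of one vector.\<close>

lemma bessel_coef:
  fixes e :: "nat \<Rightarrow> ell1"
  assumes e: "\<And>n m. ip (e n) (e m) = (if n = m then 1 else 0)"
  shows "(\<Sum>n<N. (cmod (coef (e n) j))\<^sup>2) \<le> 1"
proof -
  define a where "a n = cnj (coef (e n) j)" for n
  define S where "S = (\<Sum>n<N. (cmod (coef (e n) j))\<^sup>2)"
  define y where "y = (\<Sum>n<N. cst (a n) * e n)"
  have aa: "a n * cnj (a n) = complex_of_real ((cmod (coef (e n) j))\<^sup>2)" for n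
    unfolding complex_norm_square by (simp add: a_def)
  have "ip (single j 1) y = (\<Sum>n<N. cnj (a n) * a n)"
    by (simp add: y_def ip.sum_right ip_cst_right ip_single_left a_def)
  also have "\<dots> = S"
    unfolding S_def of_real_sum aa[symmetric] by (simp only: mult.commute)
  finally have 1: "ip (single j 1) y = S" .
  then have 2: "ip y (single j 1) = S"
    by (metis complex_cnj_complex_of_real ip_cnj)
  have "ip y y = (\<Sum>i<N. cnj (a i) * (\<Sum>n<N. a n * (if n = i then 1 else 0)))"
    by (simp add: y_def ip.sum_left ip.sum_right ip_cst_left ip_cst_right e)
  also have "\<dots> = (\<Sum>i<N. cnj (a i) * a i)"
    by (simp add: mult_delta_right)
  also have "\<dots> = S"
    unfolding S_def of_real_sum aa[symmetric] by (simp only: mult.commute)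
  finally have 3: "ip y y = S" .
  have 0: "ip (single j 1) (single j 1) = 1"
    by (simp add: ip_single_left coef_single)
  have "ip (single j 1 - y) (single j 1 - y) = 1 - of_real S"
    by (simp add: ip.diff_left ip.diff_right 0 1 2 3)
  with Re_ip_self_nonneg[of "single j 1 - y"] show ?thesis
    by (simp add: S_def)
qed

definition cubic :: "ell1 \<Rightarrow> ell1" where
  "cubic v = corr (v * v) v"

text \<open>The Lax operator: with \<open>H\<^sub>v g = corr v g\<close> the Hankel operator and \<open>T g = corr (v * g) v\<close> the
  Toeplitz operator of symbol \<open>|v|\<^sup>2\<close>, this is \<open>(i/2) H\<^sub>v\<^sup>2 - i T\<close>.\<close>

definition lax :: "ell1 \<Rightarrow> ell1 \<Rightarrow> ell1" where
  "lax v g = cst (\<i> / 2) * corr v (corr v g) - cst \<i> * corr (v * g) v"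

text \<open>The Hankel operator is conjugate linear with \<open><H g, h> = <H h, g>\<close>, so its
  square is self-adjoint; so is the Toeplitz operator, by \<open><T g, h> = <v g, v h>\<close>. The
  factors \<open>\<i>\<close> make the combination antisymmetric.\<close>

lemma lax_antisymmetric: "ip (lax v g) h + ip g (lax v h) = 0"
proof -
  have 1: "ip (corr v (corr v g)) h = ip (corr v h) (corr v g)" for g h
    by (simp add: ip_corr_left mult.commute)
  have 2: "ip (corr (v * g) v) h = ip (v * g) (v * h)" for g h
    by (simp add: ip_corr_left)
  have "ip g (corr v (corr v h)) = ip (corr v h) (corr v g)" "ip g (corr (v * h) v) = ip (v * g) (v * h)"
    by (metis 1 2 ip_cnj)+
  then show ?thesis
    by (simp add: lax_def ip.diff_left ip.diff_right ip_cst_left ip_cst_right 1 2)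
qed

text \<open>The Lax equation in weak form: \<open>ip v (g * h)\<close> is the matrix element
  \<open><H g, h>\<close> of the Hankel operator, and the left-hand side is its time derivative when
  \<open>v\<close>, \<open>g\<close>, \<open>h\<close> all evolve.\<close>

lemma lax_pairing:
  "ip (- (cst \<i> * cubic v)) (g * h) + ip v (lax v g * h) + ip v (g * lax v h) = 0"
proof -
  define p where "p = corr v g"
  define q where "q = corr v h"
  define r where "r = corr h v"
  define \<rho> where "\<rho> = coef r 0"
  have q0: "coef q 0 = cnj \<rho>"
    by (simp add: q_def \<rho>_def r_def coef_corr_0_cnj)
  define S where "S = ip q (corr v p)"
  have S': "ip p (corr v q) = S"
    unfolding S_def by (metis ip_cnj ip_corr_left mult.commute)
  define A where "A = ip (v * q) (v * g)"
  define B where "B = ip v (r * (v * g))"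
  define D where "D = ip v (v * g)"
  have h1: "ip q (corr (v * g) v) = A"
    unfolding A_def by (metis ip_cnj ip_corr_left)
  \<comment> \<open>The asymmetric choice of expanding the Toeplitz term of \<open>h\<close> but not
    that of \<open>g\<close> leaves an extra \<open>S\<close>, which the two terms with
    \<open>\<i> / 2\<close> cancel together. The mean value terms \<open>cnj \<rho> * D\<close>
    cancel against the one in \<open>h3\<close>.\<close>
  have "corr (v * h) v = v * r + corr v q - cst \<rho> * v"
    unfolding r_def q_def \<rho>_def by (subst corr_mult_left) (simp add: mult.commute)
  then have h2: "ip p (corr (v * h) v) = B + S - cnj \<rho> * D"
    by (simp add: ip.diff_right ip.add_right ip_cst_right S')
       (simp add: p_def B_def D_def ip_corr_left mult_ac)
  have "corr (v * v) h = v * q + corr v r - cst (cnj \<rho>) * v"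
    unfolding q0[symmetric] unfolding r_def q_def by (subst corr_mult_left) (simp add: mult.commute)
  moreover have "ip (cubic v) (g * h) = ip (corr (v * v) h) (v * g)"
    by (simp add: cubic_def ip_corr_left mult_ac)
  ultimately have h3: "ip (cubic v) (g * h) = A + B - cnj \<rho> * D"
    by (simp add: ip.diff_left ip.add_left ip_cst_left ip_corr_left A_def B_def D_def)
  have k1: "ip v (lax v g * h) = ip q (lax v g)" and k2: "ip v (g * lax v h) = ip p (lax v h)"
    unfolding q_def p_def by (simp_all add: ip_corr_left mult.commute)
  show ?thesis
    unfolding k1 k2 unfolding lax_def p_def[symmetric] q_def[symmetric]
    by (simp add: ip.diff_right ip.minus_left ip_cst_right ip_cst_left h3 h1 h2 S')
       (simp add: S_def[symmetric] algebra_simps)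
qed

lemma cmod_ip_mult_le:
  assumes "\<And>m. (\<Sum>j\<le>m. cmod (coef g j) * cmod (coef h (m - j))) \<le> C m"
    and "summable (\<lambda>m. cmod (coef u m) * C m)"
  shows "cmod (ip u (g * h)) \<le> (\<Sum>m. cmod (coef u m) * C m)"
proof -
  have "cmod (coef u m * cnj (coef (g * h) m)) \<le> cmod (coef u m) * C m" for m
    unfolding coef_mult norm_mult complex_mod_cnj
    by (intro mult_left_mono order_trans[OF sum_norm_le assms(1)]) (auto simp: norm_mult)
  then show ?thesis
    unfolding ip_series using assms(2) by (intro norm_suminf_le)
qed


lemma norm_lax: "norm (lax v g) \<le> 2 * (norm v)\<^sup>2 * norm g"
proof -
  have "norm (cst (\<i> / 2) * corr v (corr v g)) \<le> norm (cst (\<i> / 2)) * (norm v * (norm v * norm g))"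
    by (intro norm_mult_ineq[THEN order_trans] mult_left_mono norm_corr[THEN order_trans] norm_corr norm_ge_zero)
  moreover have "norm (cst \<i> * corr (v * g) v) \<le> norm (cst \<i>) * ((norm v * norm g) * norm v)"
    by (intro norm_mult_ineq[THEN order_trans] mult_left_mono norm_corr[THEN order_trans]
        mult_right_mono norm_mult_ineq norm_ge_zero)
  ultimately have "norm (lax v g) \<le> 1/2 * (norm v * (norm v * norm g)) + (norm v * norm g) * norm v"
    unfolding lax_def by (intro norm_triangle_ineq4[THEN order_trans] add_mono)
      (simp_all add: cst_def norm_divide)
  also have "\<dots> \<le> 2 * (norm v)\<^sup>2 * norm g"
    by (simp add: power2_eq_square)
  finally show ?thesis .
qed

lemma lax_diff: "lax v (g - h) = lax v g - lax v h"
  by (simp add: lax_def corr.diff_left corr.diff_right algebra_simps)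

lemma continuous_on_corr [continuous_intros]:
  "continuous_on S f \<Longrightarrow> continuous_on S g \<Longrightarrow> continuous_on S (\<lambda>x. corr (f x) (g x))"
  by (rule corr.continuous_on)

text \<open>The scalar \<open>c\<close> allows for the damping factor of the truncated equation below, which only
  reparametrises time.\<close>

lemma lax_flow_backward:
  assumes T: "0 \<le> T" and v: "continuous_on {0..T} v" and c: "continuous_on {0..T} c"
  obtains g where "g T = g0"
    and "\<And>t. t \<in> {0..T} \<Longrightarrow> (g has_vector_derivative (c t *\<^sub>R lax (v t) (g t))) (at t within {0..T})"
proof -
  \<comment> \<open>Time is reversed because the value is prescribed at \<open>T\<close>, whereas
    the existence theorem starts at 0.\<close>
  define r where "r t = T - t" for t
  have r: "r ` {0..T} = {0..T}"
    by (auto simp: r_def image_iff intro!: bexI[of _ "T - _"])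
  have cr: "continuous_on {0..T} (\<lambda>t. v (r t))" "continuous_on {0..T} (\<lambda>t. c (r t))"
    by (rule continuous_on_compose2[OF v] continuous_on_compose2[OF c],
        auto simp: r_def intro!: continuous_intros)+
  have "compact ((\<lambda>t. \<bar>c (r t)\<bar> * (2 * (norm (v (r t)))\<^sup>2)) ` {0..T})"
    by (intro compact_continuous_image continuous_intros cr compact_Icc)
  then obtain L where L: "\<And>t. t \<in> {0..T} \<Longrightarrow> \<bar>c (r t)\<bar> * (2 * (norm (v (r t)))\<^sup>2) \<le> L"
    by (meson bdd_above.E bounded_imp_bdd_above compact_imp_bounded image_eqI)
  obtain G where G: "G 0 = g0"
    "\<And>t. t \<in> {0..T} \<Longrightarrow> (G has_vector_derivative (- c (r t)) *\<^sub>R lax (v (r t)) (G t)) (at t within {0..T})"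
  proof (rule lipschitz_ode_solution[OF T, of "\<lambda>t g. (- c (r t)) *\<^sub>R lax (v (r t)) g" "max 1 L" g0])
    fix x :: "real \<Rightarrow> ell1" assume x: "continuous_on {0..T} x"
    show "continuous_on {0..T} (\<lambda>t. (- c (r t)) *\<^sub>R lax (v (r t)) (x t))"
      unfolding lax_def by (intro continuous_intros cr x)
  next
    fix t and x y :: ell1 assume t: "t \<in> {0..T}"
    have "norm ((- c (r t)) *\<^sub>R lax (v (r t)) x - (- c (r t)) *\<^sub>R lax (v (r t)) y)
        = \<bar>c (r t)\<bar> * norm (lax (v (r t)) (x - y))"
      by (simp add: lax_diff flip: scaleR_diff_right)
         (metis norm_minus_commute norm_scaleR real_norm_def scaleR_diff_right)
    also have "\<dots> \<le> \<bar>c (r t)\<bar> * (2 * (norm (v (r t)))\<^sup>2 * norm (x - y))"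
      by (intro mult_left_mono norm_lax) auto
    also have "\<dots> = \<bar>c (r t)\<bar> * (2 * (norm (v (r t)))\<^sup>2) * norm (x - y)"
      by simp
    also have "\<dots> \<le> max 1 L * norm (x - y)"
      using L[OF t] by (intro mult_right_mono) auto
    finally show "norm ((- c (r t)) *\<^sub>R lax (v (r t)) x - (- c (r t)) *\<^sub>R lax (v (r t)) y) \<le> max 1 L * norm (x - y)" .
  qed auto
  show ?thesis
  proof
    show "(G \<circ> r) T = g0"
      by (simp add: r_def G)
    fix t assume t: "t \<in> {0..T}"
    have "(r has_vector_derivative -1) (at t within {0..T})"
      unfolding r_def by (auto intro!: derivative_eq_intros)
    moreover have "(G has_vector_derivative (- c t) *\<^sub>R lax (v t) (G (r t))) (at (r t) within r ` {0..T})"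
      using G(2)[of "r t"] t unfolding r by (simp add: r_def)
    ultimately show "(G \<circ> r has_vector_derivative c t *\<^sub>R lax (v t) ((G \<circ> r) t)) (at t within {0..T})"
      by (rule vector_diff_chain_within[THEN has_vector_derivative_eq_rhs]) simp
  qed
qed

lemma constant_on_Icc:
  fixes f :: "real \<Rightarrow> 'a :: real_normed_vector"
  assumes "\<And>t. t \<in> {a..b} \<Longrightarrow> (f has_vector_derivative 0) (at t within {a..b})" "a \<le> b"
  shows "f a = f b"
  using has_vector_derivative_zero_constant[OF convex_real_interval(5) assms(1)] assms(2)
  by (metis atLeastAtMost_iff order_refl)

text \<open>The indices \<open>n + n\<close> and \<open>n + (n + 1)\<close> exhaust all
  coefficients, so two diagonals of the Hankel matrix suffice; hence the factor 2. On the diagonal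
  with offset \<open>d\<close> both \<open>e n\<close> and \<open>e (n + d)\<close> run through
  orthonormal families.\<close>

lemma wiener_norm_bound:
  assumes T: "0 \<le> T" and c: "continuous_on {0..T} c"
    and v: "\<And>t. t \<in> {0..T} \<Longrightarrow> (v has_vector_derivative c t *\<^sub>R (- (cst \<i> * cubic (v t)))) (at t within {0..T})"
    and s: "summable (\<lambda>m. cmod (coef (v 0) m) * (m + 1))"
  shows "norm (v T) \<le> 2 * (\<Sum>m. cmod (coef (v 0) m) * (m + 1))"
proof -
  define K where "K = (\<Sum>m. cmod (coef (v 0) m) * (m + 1))"
  have vc: "continuous_on {0..T} v"
    using v by (metis continuous_on_eq_continuous_within has_vector_derivative_continuous)
  have "\<exists>g. g T = single n 1 \<and> (\<forall>t\<in>{0..T}. (g has_vector_derivative (c t *\<^sub>R lax (v t) (g t))) (at t within {0..T}))" for n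
    using lax_flow_backward[OF T vc c] by metis
  then obtain g where gT: "\<And>n. g n T = single n 1"
    and g: "\<And>n t. t \<in> {0..T} \<Longrightarrow> (g n has_vector_derivative (c t *\<^sub>R lax (v t) (g n t))) (at t within {0..T})"
    by metis
  define e where "e n = g n 0" for n
  have orth: "ip (e n) (e m) = (if n = m then 1 else 0)" for n m
  proof -
    have "ip (g n 0) (g m 0) = ip (g n T) (g m T)"
    proof (rule constant_on_Icc[OF _ T])
      fix t assume t: "t \<in> {0..T}"
      show "((\<lambda>t. ip (g n t) (g m t)) has_vector_derivative 0) (at t within {0..T})"
        by (rule has_vector_derivative_eq_rhs[OF ip.has_vector_derivative[OF g[OF t] g[OF t]]])
           (metis add.commute ip.scaleR_left ip.scaleR_right lax_antisymmetric scaleR_add_right scaleR_zero_right)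
    qed
    then show ?thesis
      by (simp add: e_def gT ip_single_right coef_single)
  qed
  have coef_vT: "coef (v T) (n + m) = ip (v 0) (e n * e m)" for n m
  proof -
    have "ip (v 0) (g n 0 * g m 0) = ip (v T) (g n T * g m T)"
    proof (rule constant_on_Icc[OF _ T])
      fix t assume t: "t \<in> {0..T}"
      have "ip (v t) (g n t * (c t *\<^sub>R lax (v t) (g m t)) + (c t *\<^sub>R lax (v t) (g n t)) * g m t)
          + ip (c t *\<^sub>R (- (cst \<i> * cubic (v t)))) (g n t * g m t)
          = c t *\<^sub>R (ip (- (cst \<i> * cubic (v t))) (g n t * g m t) + ip (v t) (lax (v t) (g n t) * g m t)
                    + ip (v t) (g n t * lax (v t) (g m t)))"
        by (simp only: ip.add_right ip.scaleR_left ip.scaleR_right mult_scaleR_left mult_scaleR_right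
              scaleR_add_right add_ac)
      also have "\<dots> = 0"
        by (simp only: lax_pairing scaleR_zero_right)
      finally show "((\<lambda>t. ip (v t) (g n t * g m t)) has_vector_derivative 0) (at t within {0..T})"
        by (rule has_vector_derivative_eq_rhs[OF ip.has_vector_derivative[OF v[OF t]
              has_vector_derivative_mult[OF g[OF t] g[OF t]]]])
    qed
    then show ?thesis
      by (simp add: e_def gT mult_single ip_single_right)
  qed
  have partial: "(\<Sum>n<N. cmod (ip (v 0) (e n * e (n + d)))) \<le> K" for N d
  proof -
    define C where "C n m = (\<Sum>j\<le>m. cmod (coef (e n) j) * cmod (coef (e (n + d)) (m - j)))" for n m
    have C0: "0 \<le> C n m" for n m
      unfolding C_def by (intro sum_nonneg) auto
    \<comment> \<open>Index \<open>m\<close> splits as \<open>j + (m - j)\<close> in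
      \<open>m + 1\<close> ways, and each splitting contributes at most 1/2 + 1/2 by Bessel. This is
      where the weight \<open>m + 1\<close> comes from.\<close>
    have CN: "(\<Sum>n<N. C n m) \<le> m + 1" for m N
    proof -
      have "(\<Sum>n<N. cmod (coef (e n) j) * cmod (coef (e (n + d)) k)) \<le> 1" for j k
      proof -
        have "(\<Sum>n<N. cmod (coef (e n) j) * cmod (coef (e (n + d)) k))
          \<le> (\<Sum>n<N. (cmod (coef (e n) j))\<^sup>2 / 2 + (cmod (coef (e (n + d)) k))\<^sup>2 / 2)"
        proof (rule sum_mono)
          fix n
          show "cmod (coef (e n) j) * cmod (coef (e (n + d)) k)
              \<le> (cmod (coef (e n) j))\<^sup>2 / 2 + (cmod (coef (e (n + d)) k))\<^sup>2 / 2"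
            using sum_squares_bound[of "cmod (coef (e n) j)" "cmod (coef (e (n + d)) k)"] by simp
        qed
        also have "\<dots> \<le> 1/2 + 1/2"
          unfolding sum.distrib sum_divide_distrib[symmetric]
          by (intro add_mono divide_right_mono bessel_coef) (auto simp: orth)
        finally show ?thesis by simp
      qed
      then have "(\<Sum>j\<le>m. \<Sum>n<N. cmod (coef (e n) j) * cmod (coef (e (n + d)) (m - j))) \<le> (\<Sum>j\<le>m. 1)"
        by (intro sum_mono)
      then show ?thesis
        unfolding C_def by (subst sum.swap) simp
    qed
    have C1: "C n m \<le> m + 1" for n m
      using member_le_sum[of n "{..<Suc n}" "\<lambda>n. C n m"] CN[of m "Suc n"] C0 by fastforce
    have sC: "summable (\<lambda>m. cmod (coef (v 0) m) * C n m)" for n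
      by (rule summable_comparison_test[OF _ s]) (use C0 C1 in \<open>auto intro!: mult_left_mono simp: abs_mult\<close>)
    have "(\<Sum>n<N. cmod (ip (v 0) (e n * e (n + d)))) \<le> (\<Sum>n<N. \<Sum>m. cmod (coef (v 0) m) * C n m)"
      by (intro sum_mono cmod_ip_mult_le sC) (simp add: C_def)
    also have "\<dots> = (\<Sum>m. \<Sum>n<N. cmod (coef (v 0) m) * C n m)"
      by (rule suminf_sum[symmetric]) (rule sC)
    also have "\<dots> \<le> K"
      unfolding K_def sum_distrib_left[symmetric]
      by (intro suminf_le mult_left_mono CN s norm_ge_zero)
         (simp add: sum_distrib_left, intro summable_sum sC)
    finally show ?thesis .
  qed
  have "(\<Sum>n<N. cmod (coef (v T) n)) \<le> 2 * K" for N
  proof -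
    have "(\<Sum>n<N. cmod (coef (v T) n)) \<le> (\<Sum>n<2 * N. cmod (coef (v T) n))"
      by (intro sum_mono2) auto
    also have "\<dots> = (\<Sum>n<N. cmod (coef (v T) (n + n)) + cmod (coef (v T) (n + Suc n)))"
      by (induction N) (simp_all add: mult_2[symmetric] mult_Suc_right del: mult_2_right)
    also have "\<dots> \<le> K + K"
      unfolding sum.distrib coef_vT using partial[of 0 N] partial[of 1 N] by (intro add_mono) simp_all
    finally show ?thesis by simp
  qed
  then show ?thesis
    unfolding K_def by (rule norm_ell1_leI)
qed

section \<open>Existence of solutions in the Wiener algebra, by truncation\<close>

abbreviation szego_ode :: "(real \<Rightarrow> ell1) \<Rightarrow> real \<Rightarrow> real \<Rightarrow> bool" where
  "szego_ode v T t \<equiv> (v has_vector_derivative (- (cst \<i> * cubic (v t)))) (at t within {0..T})"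

lemma cubic_lipschitz:
  assumes "norm x \<le> R" "norm y \<le> R"
  shows "norm (cubic x - cubic y) \<le> 3 * R\<^sup>2 * norm (x - y)"
proof -
  have R: "0 \<le> R"
    using assms(1) norm_ge_zero order_trans by blast
  have "cubic x - cubic y = corr ((x - y) * (x + y)) x + corr (y * y) (x - y)"
    by (simp add: cubic_def corr.diff_left corr.diff_right corr.add_left algebra_simps)
  also have "norm \<dots> \<le> norm (x - y) * (R + R) * R + (R * R) * norm (x - y)"
    by (intro norm_triangle_ineq[THEN order_trans] add_mono norm_corr[THEN order_trans] mult_mono
        norm_mult_ineq[THEN order_trans] norm_triangle_ineq[THEN order_trans] assms mult_nonneg_nonneg
        add_nonneg_nonneg norm_ge_zero order_refl R)
  finally show ?thesis
    by (simp add: power2_eq_square algebra_simps)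
qed

lemma cubic_scaleR: "cubic (r *\<^sub>R x) = r ^ 3 *\<^sub>R cubic x"
  by (simp add: cubic_def corr.scaleR_left corr.scaleR_right power3_eq_cube)

lemma continuous_on_cubic [continuous_intros]:
  "continuous_on S f \<Longrightarrow> continuous_on S (\<lambda>x. cubic (f x))"
  unfolding cubic_def by (intro continuous_intros)

text \<open>Composing the cubic nonlinearity with the radial retraction \<open>x \<mapsto> \<kappa> x\<close> onto the ball of radius \<open>R\<close>
  makes it globally Lipschitz. By homogeneity this multiplies it by \<open>\<kappa>\<^sup>3\<close>, so the Lax pair survives,
  and the bound \<open>R\<close> it yields shows that the truncation is never active.\<close>

theorem szego_solution_ell1:
  assumes T: "0 \<le> T" and s: "summable (\<lambda>m. cmod (coef u0 m) * (m + 1))"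
  obtains v where "v 0 = u0"
    and "\<And>t. t \<in> {0..T} \<Longrightarrow> szego_ode v T t"
    and "\<And>t. t \<in> {0..T} \<Longrightarrow> norm (v t) \<le> 2 * (\<Sum>m. cmod (coef u0 m) * (m + 1))"
proof -
  \<comment> \<open>The maximum with 1 keeps \<open>R\<close> positive when the datum
    vanishes.\<close>
  define R where "R = max 1 (2 * (\<Sum>m. cmod (coef u0 m) * (m + 1)))"
  have R: "0 < R" by (simp add: R_def)
  define \<kappa> :: "ell1 \<Rightarrow> real" where "\<kappa> x = 1 / max 1 (norm x / R)" for x
  have \<kappa>: "0 < \<kappa> x" "\<kappa> x \<le> 1" "\<kappa> x * norm x \<le> R" for x
  proof -
    have m: "0 < max 1 (norm x / R)" "1 \<le> max 1 (norm x / R)" "norm x \<le> max 1 (norm x / R) * R"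
      using R by (auto simp: max_def field_simps)
    show "0 < \<kappa> x" "\<kappa> x \<le> 1"
      using m(1,2) by (simp_all add: \<kappa>_def)
    show "\<kappa> x * norm x \<le> R"
      using m(1,3) unfolding \<kappa>_def by (simp add: pos_divide_le_eq mult.commute)
  qed
  \<comment> \<open>Split off \<open>\<kappa> x (x - y)\<close>. In the remaining
    \<open>(\<kappa> x - \<kappa> y) y\<close> the difference of the factors is at most
    \<open>norm (x - y) / R * \<kappa> y\<close>, and \<open>\<kappa> y\<close> times the norm of
    \<open>y\<close> is at most \<open>R\<close>.\<close>
  have retract: "norm (\<kappa> x *\<^sub>R x - \<kappa> y *\<^sub>R y) \<le> 2 * norm (x - y)" for x y
  proof -
    have "\<kappa> x - \<kappa> y = (max 1 (norm y / R) - max 1 (norm x / R)) * (\<kappa> x * \<kappa> y)"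
    proof -
      have "1 / a - 1 / b = (b - a) * (1 / a * (1 / b))" if "0 < a" "0 < b" for a b :: real
        using that by (simp add: field_simps)
      then show ?thesis unfolding \<kappa>_def by simp
    qed
    also have "\<bar>\<dots>\<bar> \<le> norm (x - y) / R * (1 * \<kappa> y)"
      unfolding abs_mult
    proof (intro mult_mono)
      have "\<bar>max 1 (norm y / R) - max 1 (norm x / R)\<bar> \<le> \<bar>norm x / R - norm y / R\<bar>"
        by (auto simp: max_def)
      also have "\<dots> \<le> norm (x - y) / R"
        using norm_triangle_ineq3[of x y] R by (simp add: abs_divide divide_right_mono flip: diff_divide_distrib)
      finally show "\<bar>max 1 (norm y / R) - max 1 (norm x / R)\<bar> \<le> norm (x - y) / R" .
    qed (use \<kappa>[of x] \<kappa>[of y] R in auto)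
    finally have "\<bar>\<kappa> x - \<kappa> y\<bar> * norm y \<le> norm (x - y) / R * \<kappa> y * norm y"
      by (intro mult_right_mono) auto
    also have "\<dots> = norm (x - y) / R * (\<kappa> y * norm y)"
      by simp
    also have "\<dots> \<le> norm (x - y) / R * R"
      using \<kappa> R by (intro mult_left_mono) auto
    finally have 1: "\<bar>\<kappa> x - \<kappa> y\<bar> * norm y \<le> norm (x - y)"
      using R by simp
    have "\<kappa> x *\<^sub>R x - \<kappa> y *\<^sub>R y = \<kappa> x *\<^sub>R (x - y) + (\<kappa> x - \<kappa> y) *\<^sub>R y"
      by (simp add: algebra_simps)
    also have "norm \<dots> \<le> 1 * norm (x - y) + norm (x - y)"
      by (intro norm_triangle_ineq[THEN order_trans] add_mono)
         (use 1 \<kappa>[of x] in \<open>auto intro: mult_right_mono[of "\<kappa> x" 1, simplified]\<close>)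
    finally show ?thesis by simp
  qed
  have \<kappa>_cont: "continuous_on S (\<lambda>t. \<kappa> (x t))" if "continuous_on S x" for S and x :: "real \<Rightarrow> ell1"
    unfolding \<kappa>_def using that R by (intro continuous_intros) auto
  obtain v where v0: "v 0 = u0"
    and v: "\<And>t. t \<in> {0..T} \<Longrightarrow> (v has_vector_derivative - (cst \<i> * cubic (\<kappa> (v t) *\<^sub>R v t))) (at t within {0..T})"
  proof (rule lipschitz_ode_solution[OF T, of "\<lambda>t v. - (cst \<i> * cubic (\<kappa> v *\<^sub>R v))" "6 * R\<^sup>2" u0])
    fix x :: "real \<Rightarrow> ell1" assume x: "continuous_on {0..T} x"
    show "continuous_on {0..T} (\<lambda>t. - (cst \<i> * cubic (\<kappa> (x t) *\<^sub>R x t)))"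
      by (intro continuous_intros x \<kappa>_cont)
  next
    fix t and x y :: ell1
    have "norm (- (cst \<i> * cubic (\<kappa> x *\<^sub>R x)) - - (cst \<i> * cubic (\<kappa> y *\<^sub>R y)))
        = norm (cst \<i> * (cubic (\<kappa> x *\<^sub>R x) - cubic (\<kappa> y *\<^sub>R y)))"
      by (simp add: algebra_simps norm_minus_commute)
    also have "\<dots> \<le> norm (cst \<i>) * norm (cubic (\<kappa> x *\<^sub>R x) - cubic (\<kappa> y *\<^sub>R y))"
      by (rule norm_mult_ineq)
    also have "\<dots> \<le> 1 * (3 * R\<^sup>2 * (2 * norm (x - y)))"
    proof (rule mult_mono)
      have "norm (cubic (\<kappa> x *\<^sub>R x) - cubic (\<kappa> y *\<^sub>R y)) \<le> 3 * R\<^sup>2 * norm (\<kappa> x *\<^sub>R x - \<kappa> y *\<^sub>R y)"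
        by (rule cubic_lipschitz) (use \<kappa>[of x] \<kappa>[of y] in auto)
      also have "\<dots> \<le> 3 * R\<^sup>2 * (2 * norm (x - y))"
        by (intro mult_left_mono retract) auto
      finally show "norm (cubic (\<kappa> x *\<^sub>R x) - cubic (\<kappa> y *\<^sub>R y)) \<le> 3 * R\<^sup>2 * (2 * norm (x - y))" .
    qed (auto simp: cst_def)
    finally show "norm (- (cst \<i> * cubic (\<kappa> x *\<^sub>R x)) - - (cst \<i> * cubic (\<kappa> y *\<^sub>R y))) \<le> 6 * R\<^sup>2 * norm (x - y)"
      by simp
  qed (use R in auto)
  have vc: "continuous_on {0..T} v"
    using v by (metis continuous_on_eq_continuous_within has_vector_derivative_continuous)
  \<comment> \<open>\<open>wiener_norm_bound\<close> controls the final time only, so it is applied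
    on each \<open>{0..t}\<close>.\<close>
  have bound: "norm (v t) \<le> 2 * (\<Sum>m. cmod (coef u0 m) * (m + 1))" if t: "t \<in> {0..T}" for t
  proof (unfold v0[symmetric], rule wiener_norm_bound[of t "\<lambda>s. \<kappa> (v s) ^ 3"])
    show "continuous_on {0..t} (\<lambda>s. \<kappa> (v s) ^ 3)"
      by (intro continuous_intros \<kappa>_cont continuous_on_subset[OF vc]) (use t in auto)
    fix r assume r: "r \<in> {0..t}"
    have "(v has_vector_derivative - (cst \<i> * cubic (\<kappa> (v r) *\<^sub>R v r))) (at r within {0..t})"
      by (rule has_vector_derivative_within_subset[OF v]) (use r t in auto)
    then show "(v has_vector_derivative \<kappa> (v r) ^ 3 *\<^sub>R - (cst \<i> * cubic (v r))) (at r within {0..t})"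
      by (simp add: cubic_scaleR)
  qed (use t s v0 in auto)
  have "\<kappa> (v t) = 1" if "t \<in> {0..T}" for t
  proof -
    have "norm (v t) \<le> R"
      using bound[OF that] by (simp add: R_def)
    then show ?thesis
      using R by (simp add: \<kappa>_def)
  qed
  with v have "\<And>t. t \<in> {0..T} \<Longrightarrow> szego_ode v T t"
    by force
  with v0 bound show ?thesis
    using that by blast
qed

section \<open>The Gevrey estimate\<close>

text \<open>A weight that is constant from \<open>N\<close> on leaves finitely many terms and a
  multiple of the unweighted sum. Time derivatives of such sums then need no exchange with an
  infinite series.\<close>

lemma suminf_eventually_const_weight:
  fixes f a :: "nat \<Rightarrow> real"
  assumes f: "summable f"
  shows "summable (\<lambda>k. a (min k N) * f k)"
    and "(\<Sum>k. a (min k N) * f k) = (\<Sum>j<N. a j * f j) + a N * (suminf f - (\<Sum>j<N. f j))"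
proof -
  have s: "summable (\<lambda>k. a (min (k + N) N) * f (k + N))"
    using f by (simp add: summable_iff_shift summable_mult)
  then show s': "summable (\<lambda>k. a (min k N) * f k)"
    by (subst (asm) summable_iff_shift)
  have "(\<Sum>k. a (min k N) * f k) = (\<Sum>k. a (min (k + N) N) * f (k + N)) + (\<Sum>j<N. a (min j N) * f j)"
    by (rule suminf_split_initial_segment[OF s'])
  also have "(\<Sum>k. a (min (k + N) N) * f (k + N)) = a N * (\<Sum>k. f (k + N))"
    using f by (simp add: suminf_mult summable_iff_shift)
  also have "(\<Sum>k. f (k + N)) = suminf f - (\<Sum>j<N. f j)"
    using suminf_minus_initial_segment[OF f] .
  also have "(\<Sum>j<N. a (min j N) * f j) = (\<Sum>j<N. a j * f j)"
    by (intro sum.cong) auto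
  finally show "(\<Sum>k. a (min k N) * f k) = (\<Sum>j<N. a j * f j) + a N * (suminf f - (\<Sum>j<N. f j))"
    by simp
qed

text \<open>An output frequency \<open>k\<close> arises from \<open>i + j = k + b\<close>, so
  monotonicity and submultiplicativity give \<open>w k \<le> w i * w j\<close>, and the conjugate
  factor carries no weight. Boundedness of \<open>w\<close> serves convergence; \<open>B\<close>
  does not enter the estimate, which is thus uniform in the cutoff.\<close>

lemma cubic_submultiplicative_weight:
  assumes w: "\<And>n. 0 \<le> w n" "\<And>n. w n \<le> B" "\<And>m n. m \<le> n \<Longrightarrow> w m \<le> w n" "\<And>m n. w (m + n) \<le> w m * w n"
  shows "(\<Sum>k. w k * cmod (coef (cubic v) k)) \<le> (\<Sum>k. w k * cmod (coef v k))\<^sup>2 * norm v"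
proof -
  have sw: "summable (\<lambda>k. w k * cmod (coef x k))" for x
    by (rule summable_comparison_test[OF _ summable_mult[OF summable_coef[of x], of B]])
       (use w in \<open>auto intro!: mult_right_mono simp: abs_mult\<close>)
  \<comment> \<open>Majorants with nonnegative coefficients: after comparison with them, the algebra
    norm inequalities give the bound.\<close>
  define V where "V = Ell1 (\<lambda>k. complex_of_real (w k * cmod (coef v k)))"
  define A where "A = Ell1 (\<lambda>k. complex_of_real (cmod (coef v k)))"
  have V: "coef V k = complex_of_real (w k * cmod (coef v k))" for k
    unfolding V_def by (subst Ell1_inverse) (use sw w in \<open>auto simp: norm_mult\<close>)
  have A: "coef A k = complex_of_real (cmod (coef v k))" for k
    unfolding A_def by (subst Ell1_inverse) auto
  have nV: "norm V = (\<Sum>k. w k * cmod (coef v k))"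
    unfolding norm_ell1_def V using w by (simp add: norm_mult)
  have nA: "norm A = norm v"
    unfolding norm_ell1_def A by simp
  have VV: "coef (V * V) n = complex_of_real (cmod (coef (V * V) n))" for n
    unfolding coef_mult V of_real_mult[symmetric] of_real_sum[symmetric] norm_of_real
    using w by (subst abs_of_nonneg) (auto intro!: sum_nonneg)
  have le: "w k * cmod (coef (v * v) (k + b)) \<le> cmod (coef (V * V) (k + b))" for k b
  proof -
    have "w k * cmod (coef (v * v) (k + b)) \<le> w k * (\<Sum>i\<le>k + b. cmod (coef v i) * cmod (coef v (k + b - i)))"
      unfolding coef_mult using w by (intro mult_left_mono sum_norm_le) (auto simp: norm_mult)
    also have "\<dots> = (\<Sum>i\<le>k + b. w k * (cmod (coef v i) * cmod (coef v (k + b - i))))"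
      by (simp add: sum_distrib_left)
    also have "\<dots> \<le> (\<Sum>i\<le>k + b. (w i * w (k + b - i)) * (cmod (coef v i) * cmod (coef v (k + b - i))))"
    proof (intro sum_mono mult_right_mono)
      fix i assume "i \<in> {..k + b}"
      then have "w (i + (k + b - i)) \<le> w i * w (k + b - i)" "i + (k + b - i) = k + b"
        by (simp_all only: w) simp_all
      then show "w k \<le> w i * w (k + b - i)"
        using w(3)[of k "k + b"] by simp
    qed auto
    also have "\<dots> = Re (coef (V * V) (k + b))"
      unfolding coef_mult V by (simp add: mult_ac)
    also have "\<dots> \<le> cmod (coef (V * V) (k + b))"
      by (rule complex_Re_le_cmod)
    finally show ?thesis .
  qed
  have main: "w k * cmod (coef (cubic v) k) \<le> cmod (coef (corr (V * V) A) k)" for k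
  proof -
    have "w k * cmod (coef (cubic v) k) \<le> w k * (\<Sum>b. cmod (coef (v * v) (k + b)) * cmod (coef v b))"
      unfolding cubic_def coef_corr
      using summable_norm[of "\<lambda>b. coef (v * v) (k + b) * cnj (coef v b)"] summable_corr[of "v * v" k v] w(1)
      by (intro mult_left_mono) (simp_all add: norm_mult)
    also have "\<dots> = (\<Sum>b. w k * cmod (coef (v * v) (k + b)) * cmod (coef v b))"
      by (subst suminf_mult[OF summable_corr, symmetric]) (simp add: mult_ac)
    also have "\<dots> \<le> (\<Sum>b. cmod (coef (V * V) (k + b)) * cmod (coef v b))"
    proof (rule suminf_le)
      show "w k * cmod (coef (v * v) (k + b)) * cmod (coef v b) \<le> cmod (coef (V * V) (k + b)) * cmod (coef v b)" for b
        by (intro mult_right_mono le) auto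
      show "summable (\<lambda>b. w k * cmod (coef (v * v) (k + b)) * cmod (coef v b))"
        using summable_mult[OF summable_corr[of "v * v" k v], of "w k"] by (simp add: mult_ac)
      show "summable (\<lambda>b. cmod (coef (V * V) (k + b)) * cmod (coef v b))"
        using summable_corr[of "V * V" k v] .
    qed
    also have "\<dots> = Re (\<Sum>b. complex_of_real (cmod (coef (V * V) (k + b)) * cmod (coef v b)))"
      by (subst suminf_of_real[symmetric]) (simp_all add: summable_corr)
    also have "(\<Sum>b. complex_of_real (cmod (coef (V * V) (k + b)) * cmod (coef v b))) = coef (corr (V * V) A) k"
      unfolding coef_corr A of_real_mult VV[symmetric] by simp
    also have "Re \<dots> \<le> cmod \<dots>"
      by (rule complex_Re_le_cmod)
    finally show ?thesis .
  qed
  have "(\<Sum>k. w k * cmod (coef (cubic v) k)) \<le> norm (corr (V * V) A)"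
    unfolding norm_ell1_def by (intro suminf_le main sw summable_coef)
  also have "\<dots> \<le> (norm V * norm V) * norm A"
    by (intro norm_corr[THEN order_trans] mult_right_mono norm_mult_ineq) auto
  finally show ?thesis
    by (simp add: nV nA power2_eq_square)
qed

text \<open>The weights \<open>exp (\<tau> min k N)\<close> are bounded, so the weighted norm is finite and differentiable in time,
  and they are still submultiplicative. At a first time where the weighted norm
  reaches \<open>C\<close>, freezing the phases of the coefficients yields a differentiable minorant that
  touches it there, with derivative at most \<open>-\<lambda>(C - M) + M C\<^sup>2 < 0\<close>.\<close>

lemma truncated_gevrey_bound:
  fixes v :: "real \<Rightarrow> ell1" and \<sigma> M Y C lam :: real
  assumes \<sigma>: "0 < \<sigma>"
    and v: "\<And>t. t \<in> {0..T} \<Longrightarrow> szego_ode v T t"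
    and M: "\<And>t. t \<in> {0..T} \<Longrightarrow> norm (v t) \<le> M"
    and s: "summable (\<lambda>k. exp (\<sigma> * real k) * cmod (coef (v 0) k))"
    and Y: "(\<Sum>k. exp (\<sigma> * real k) * cmod (coef (v 0) k)) \<le> Y"
    and C: "max M Y + 1 \<le> C" and lam: "M * C\<^sup>2 < lam"
    and t: "t \<in> {0..T}"
  shows "(\<Sum>k. exp (\<sigma> * exp (- lam * t) * real (min k N)) * cmod (coef (v t) k)) \<le> C"
proof (rule ccontr)
  define \<tau> where "\<tau> t = \<sigma> * exp (- lam * t)" for t
  define w where "w t j = exp (\<tau> t * real j)" for t j
  define y where "y t = (\<Sum>k. w t (min k N) * cmod (coef (v t) k))" for t
  assume "\<not> ?thesis"
  then have gt: "C < y t"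
    by (simp add: y_def w_def \<tau>_def)
  have M0: "0 \<le> M"
    using M[OF t] norm_ge_zero order_trans by blast
  have lam0: "0 < lam"
    using lam M0 by (smt (verit) mult_nonneg_nonneg zero_le_power2)
  have \<tau>0: "0 < \<tau> t" for t
    using \<sigma> by (simp add: \<tau>_def)
  have vc: "continuous_on {0..T} v"
    using v by (metis continuous_on_eq_continuous_within has_vector_derivative_continuous)
  have y_alt: "y t = (\<Sum>j<N. w t j * cmod (coef (v t) j)) + w t N * (norm (v t) - (\<Sum>j<N. cmod (coef (v t) j)))" for t
    unfolding y_def norm_ell1_def by (rule suminf_eventually_const_weight) (rule summable_coef)
  have yc: "continuous_on {0..T} y"
    unfolding y_alt[abs_def] w_def \<tau>_def
    by (intro continuous_intros vc bounded_linear.continuous_on[OF bounded_linear_coef])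
  have "y 0 \<le> (\<Sum>k. exp (\<sigma> * real k) * cmod (coef (v 0) k))"
    unfolding y_def
  proof (rule suminf_le)
    show "w 0 (min k N) * cmod (coef (v 0) k) \<le> exp (\<sigma> * real k) * cmod (coef (v 0) k)" for k
      using \<sigma> by (intro mult_right_mono) (auto simp: w_def \<tau>_def)
  qed (use s suminf_eventually_const_weight(1)[OF summable_coef] in auto)
  then have y0: "y 0 < C"
    using Y C by linarith
  define Z where "Z = {s \<in> {0..t}. y s = C}"
  have yct: "continuous_on {0..t} y"
    using yc by (rule continuous_on_subset) (use t in auto)
  have "closed Z"
    unfolding Z_def by (rule continuous_closed_preimage_constant[OF yct]) simp
  moreover have "bounded Z"
    by (rule bounded_subset[OF compact_imp_bounded[OF compact_Icc[of 0 t]]]) (auto simp: Z_def)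
  ultimately have "compact Z"
    by (simp add: compact_eq_bounded_closed)
  moreover have "Z \<noteq> {}"
    using IVT'[of y 0 C t] y0 gt t yct by (auto simp: Z_def)
  ultimately have "\<exists>r\<in>Z. \<forall>s\<in>Z. r \<le> s"
    by (rule compact_attains_inf)
  then obtain r where r: "r \<in> Z" "\<And>s. s \<in> Z \<Longrightarrow> r \<le> s"
    by blast
  have rT: "r \<in> {0..T}" "y r = C" "r \<noteq> 0"
    using r t y0 by (auto simp: Z_def)
  have below: "y s < C" if sr: "0 \<le> s" "s < r" for s
  proof (rule ccontr)
    assume "\<not> y s < C"
    then have "C \<le> y s" by simp
    moreover have "continuous_on {0..s} y"
      by (rule continuous_on_subset[OF yct]) (use sr r(1) in \<open>auto simp: Z_def\<close>)
    ultimately obtain q where "0 \<le> q" "q \<le> s" "y q = C"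
      using IVT'[of y 0 C s] y0 sr by auto
    then show False
      using r(2)[of q] sr r(1) by (auto simp: Z_def)
  qed
  \<comment> \<open>The conjugate phases at the touching time \<open>r\<close>. The modulus need not
    be differentiable where a coefficient vanishes, but the linear functional \<open>f\<close> is;
    it lies below the modulus, with equality at \<open>r\<close>.\<close>
  define z where "z k = (if coef (v r) k = 0 then 0 else cnj (coef (v r) k) / cmod (coef (v r) k))" for k
  have z1: "cmod (z k) \<le> 1" for k
    by (simp add: z_def norm_divide)
  have zr: "Re (z k * coef (v r) k) = cmod (coef (v r) k)" for k
  proof -
    have "z k * coef (v r) k = complex_of_real (cmod (coef (v r) k))"
      using complex_norm_square[of "coef (v r) k"]
      by (auto simp: z_def field_simps power2_eq_square)
    then show ?thesis by simp
  qed
  define f where "f x k = Re (z k * coef x k)" for x k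
  have f_le: "\<bar>f x k\<bar> \<le> cmod (coef x k)" for x k
    unfolding f_def using abs_Re_le_cmod[of "z k * coef x k"] mult_right_mono[OF z1[of k], of "cmod (coef x k)"]
    by (simp add: norm_mult)
  have sf: "summable (f x)" for x
    by (rule summable_comparison_test[OF _ summable_coef[of x]]) (simp add: f_le)
  have bf: "bounded_linear (\<lambda>x. f x k)" for k
    unfolding f_def
    by (intro bounded_linear_compose[OF bounded_linear_Re] bounded_linear_compose[OF bounded_linear_mult_right] bounded_linear_coef)
  have fadd: "f (x + y) = (\<lambda>k. f x k + f y k)" and fscale: "f (c *\<^sub>R x) = (\<lambda>k. c * f x k)" for x y c
    by (simp_all add: fun_eq_iff f_def algebra_simps)
  have bsum: "bounded_linear (\<lambda>x. suminf (f x))"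
  proof (rule bounded_linear_intro[where K = 1])
    show "suminf (f (x + y)) = suminf (f x) + suminf (f y)" for x y
      by (subst suminf_add[OF sf sf]) (simp add: fadd)
    show "suminf (f (c *\<^sub>R x)) = c *\<^sub>R suminf (f x)" for c x
      using suminf_mult[OF sf, of c x] by (simp add: fscale)
    show "norm (suminf (f x)) \<le> norm x * 1" for x
      unfolding norm_ell1_def real_norm_def using f_le by (simp add: order_trans[OF summable_rabs suminf_le]
          summable_comparison_test[OF _ summable_coef[of x]] norm_suminf_le[of "f x", simplified])
  qed
  define \<phi> where "\<phi> s = (\<Sum>k. w s (min k N) * f (v s) k)" for s
  have \<phi>_alt: "\<phi> s = (\<Sum>j<N. w s j * f (v s) j) + w s N * (suminf (f (v s)) - (\<Sum>j<N. f (v s) j))" for s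
    unfolding \<phi>_def by (rule suminf_eventually_const_weight) (rule sf)
  define D where "D = - (cst \<i> * cubic (v r))"
  define d where "d = (\<Sum>k. w r (min k N) * f D k) - lam * \<tau> r * (\<Sum>k. (w r (min k N) * real (min k N)) * f (v r) k)"
  have \<phi>': "(\<phi> has_real_derivative d) (at r within {0..T})"
  proof -
    have vr: "(v has_vector_derivative D) (at r within {0..T})"
      unfolding D_def by (rule v[OF rT(1)])
    have w': "((\<lambda>s. w s j) has_real_derivative (- lam * \<tau> r) * (w r j * real j)) (at r within {0..T})" for j
      unfolding w_def \<tau>_def by (auto intro!: derivative_eq_intros)
    have f': "((\<lambda>s. f (v s) j) has_real_derivative f D j) (at r within {0..T})" for j
      using bounded_linear.has_vector_derivative[OF bf vr] by (simp add: has_real_derivative_iff_has_vector_derivative)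
    have s': "((\<lambda>s. suminf (f (v s))) has_real_derivative suminf (f D)) (at r within {0..T})"
      using bounded_linear.has_vector_derivative[OF bsum vr] by (simp add: has_real_derivative_iff_has_vector_derivative)
    have d_alt: "d = (\<Sum>j<N. w r j * f D j) + w r N * (suminf (f D) - (\<Sum>j<N. f D j))
        - lam * \<tau> r * ((\<Sum>j<N. (w r j * real j) * f (v r) j) + (w r N * real N) * (suminf (f (v r)) - (\<Sum>j<N. f (v r) j)))"
      unfolding d_def using suminf_eventually_const_weight(2)[OF sf, of "w r" N D]
        suminf_eventually_const_weight(2)[OF sf, of "\<lambda>j. w r j * real j" N "v r"] by simp
    show ?thesis
      unfolding \<phi>_alt[abs_def]
      by (rule DERIV_cong, (rule DERIV_add DERIV_sum DERIV_mult DERIV_diff w' f' s')+)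
         (simp add: d_alt sum.distrib sum_distrib_left sum_subtractf algebra_simps)
  qed
  have "d < 0"
  proof -
    have "(\<Sum>k. w r (min k N) * f D k) \<le> (\<Sum>k. w r (min k N) * cmod (coef (cubic (v r)) k))"
    proof (rule suminf_le)
      show "w r (min k N) * f D k \<le> w r (min k N) * cmod (coef (cubic (v r)) k)" for k
        using f_le[of D k] by (intro mult_left_mono) (auto simp: w_def D_def norm_mult)
    qed (intro suminf_eventually_const_weight sf summable_coef)+
    also have "\<dots> \<le> (y r)\<^sup>2 * norm (v r)"
      unfolding y_def
    proof (rule cubic_submultiplicative_weight[of "\<lambda>k. w r (min k N)" "w r N"])
      show "w r (min (m + n) N) \<le> w r (min m N) * w r (min n N)" for m n
      proof -
        have "\<tau> r * real (min (m + n) N) \<le> \<tau> r * (real (min m N) + real (min n N))"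
          using \<tau>0[of r] by (intro mult_left_mono) auto
        then show ?thesis
          by (simp add: w_def distrib_left flip: exp_add)
      qed
    qed (use \<tau>0[of r] in \<open>auto simp: w_def\<close>)
    also have "\<dots> \<le> C\<^sup>2 * M"
      using rT M[OF rT(1)] by (simp add: mult_left_mono)
    finally have 1: "(\<Sum>k. w r (min k N) * f D k) \<le> C\<^sup>2 * M" .
    have fr: "f (v r) = (\<lambda>k. cmod (coef (v r) k))"
      unfolding f_def zr ..
    have "C - norm (v r) = (\<Sum>k. w r (min k N) * f (v r) k - f (v r) k)"
      using suminf_diff[OF suminf_eventually_const_weight(1)[OF sf] sf, of "w r" N "v r" "v r"] rT(2)
      by (simp add: y_def fr norm_ell1_def)
    also have "\<dots> \<le> (\<Sum>k. \<tau> r * ((w r (min k N) * real (min k N)) * f (v r) k))"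
    proof (rule suminf_le)
      fix k
      \<comment> \<open>The weighted norm exceeds the Wiener norm by at most \<open>\<tau>\<close>
        times the sum with the additional factor \<open>min k N\<close>, which is minus the
        derivative produced by the shrinking radius, up to \<open>lam\<close>.\<close>
      have "exp x - 1 \<le> x * exp x" for x :: real
        using exp_ge_add_one_self[of "- x"] by (simp add: exp_minus field_simps)
      from this[of "\<tau> r * real (min k N)"]
      have "(w r (min k N) - 1) * f (v r) k \<le> (\<tau> r * real (min k N) * w r (min k N)) * f (v r) k"
        by (intro mult_right_mono) (auto simp: w_def fr)
      then show "w r (min k N) * f (v r) k - f (v r) k \<le> \<tau> r * ((w r (min k N) * real (min k N)) * f (v r) k)"
        by (simp add: algebra_simps)
    next
      show "summable (\<lambda>k. w r (min k N) * f (v r) k - f (v r) k)"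
        by (intro summable_diff suminf_eventually_const_weight sf)
      show "summable (\<lambda>k. \<tau> r * ((w r (min k N) * real (min k N)) * f (v r) k))"
        by (intro summable_mult suminf_eventually_const_weight(1)[of _ "\<lambda>j. w r j * real j"] sf)
    qed
    also have "\<dots> = \<tau> r * (\<Sum>k. (w r (min k N) * real (min k N)) * f (v r) k)"
      by (intro suminf_mult suminf_eventually_const_weight(1)[of _ "\<lambda>j. w r j * real j"] sf)
    \<comment> \<open>Here \<open>y r = C\<close>, while \<open>C - M\<close> is at least 1 by the
      choice of \<open>C\<close>; hence the decay term alone is at least \<open>lam\<close>, which
      exceeds \<open>M * C\<^sup>2\<close>.\<close>
    finally have "1 \<le> \<tau> r * (\<Sum>k. (w r (min k N) * real (min k N)) * f (v r) k)"
      using M[OF rT(1)] C by linarith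
    then have "lam * 1 \<le> lam * (\<tau> r * (\<Sum>k. (w r (min k N) * real (min k N)) * f (v r) k))"
      using lam0 by (intro mult_left_mono) auto
    with 1 lam show ?thesis
      by (simp add: d_def mult_ac)
  qed
  \<comment> \<open>A negative derivative at \<open>r\<close> puts the minorant above
    \<open>C\<close> just before \<open>r\<close>, where \<open>y\<close> is still below
    \<open>C\<close>.\<close>
  from has_real_derivative_neg_dec_left[OF \<phi>' this] obtain e where
    e: "0 < e" "\<And>h. 0 < h \<Longrightarrow> r - h \<in> {0..T} \<Longrightarrow> h < e \<Longrightarrow> \<phi> r < \<phi> (r - h)"
    by blast
  define h where "h = min r (e / 2)"
  have h: "0 < h" "h < e" "0 \<le> r - h" "r - h \<le> T"
    using e(1) rT by (auto simp: h_def min_def)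
  have "\<phi> r < \<phi> (r - h)"
    using h by (intro e) auto
  also have "\<phi> (r - h) \<le> y (r - h)"
    unfolding \<phi>_def y_def
  proof (rule suminf_le)
    show "w (r - h) (min k N) * f (v (r - h)) k \<le> w (r - h) (min k N) * cmod (coef (v (r - h)) k)" for k
      using f_le[of "v (r - h)" k] by (intro mult_left_mono) (auto simp: w_def)
  qed (intro suminf_eventually_const_weight sf summable_coef)+
  also have "\<dots> < C"
    using h by (intro below) auto
  also have "C = \<phi> r"
    using rT(2) unfolding \<phi>_def y_def f_def zr by simp
  finally show False by simp
qed

text \<open>The truncated bound is uniform in the cutoff. For a partial sum of \<open>N\<close>
  terms the cutoff \<open>N\<close> does not alter the weights.\<close>

theorem gevrey_bound_ell1:
  fixes v :: "real \<Rightarrow> ell1" and \<sigma> M Y C lam :: real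
  assumes "0 < \<sigma>"
    and "\<And>t. t \<in> {0..T} \<Longrightarrow> szego_ode v T t"
    and "\<And>t. t \<in> {0..T} \<Longrightarrow> norm (v t) \<le> M"
    and "summable (\<lambda>k. exp (\<sigma> * real k) * cmod (coef (v 0) k))"
    and "(\<Sum>k. exp (\<sigma> * real k) * cmod (coef (v 0) k)) \<le> Y"
    and "max M Y + 1 \<le> C" and "M * C\<^sup>2 < lam"
    and "t \<in> {0..T}"
  shows "summable (\<lambda>k. exp (\<sigma> * exp (- lam * t) * real k) * cmod (coef (v t) k))" (is ?A)
    and "(\<Sum>k. exp (\<sigma> * exp (- lam * t) * real k) * cmod (coef (v t) k)) \<le> C" (is ?B)
proof -
  define \<tau> where "\<tau> = \<sigma> * exp (- lam * t)"
  have *: "(\<Sum>k<N. exp (\<tau> * real k) * cmod (coef (v t) k)) \<le> C" for N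
  proof -
    have "(\<Sum>k<N. exp (\<tau> * real k) * cmod (coef (v t) k)) = (\<Sum>k<N. exp (\<tau> * real (min k N)) * cmod (coef (v t) k))"
      by (intro sum.cong) auto
    also have "\<dots> \<le> (\<Sum>k. exp (\<tau> * real (min k N)) * cmod (coef (v t) k))"
      by (intro sum_le_suminf suminf_eventually_const_weight(1)[of _ "\<lambda>j. exp (\<tau> * real j)"] summable_coef) auto
    also have "\<dots> \<le> C"
      unfolding \<tau>_def by (rule truncated_gevrey_bound[OF assms])
    finally show ?thesis .
  qed
  show ?A
    unfolding \<tau>_def[symmetric] by (rule summableI_nonneg_bounded[OF _ *]) auto
  then show ?B
    using * unfolding \<tau>_def by (rule suminf_le_const)
qed

section \<open>Uniqueness in the energy space\<close>

text \<open>Coefficient sequences of functions in \<open>L\<^sup>2\<^sub>+\<close> and \<open>H\<^sup>1\<^sup>/\<^sup>2\<^sub>+\<close>. The weight \<open>1 + k\<close> counts the entries with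
  index \<open>k\<close> of a Hankel matrix, so \<open>h12_sq x\<close> is its squared Hilbert-Schmidt norm.\<close>

definition in_l2 :: "(nat \<Rightarrow> complex) \<Rightarrow> bool" where
  "in_l2 x \<longleftrightarrow> summable (\<lambda>k. (cmod (x k))\<^sup>2)"

definition l2_sq :: "(nat \<Rightarrow> complex) \<Rightarrow> real" where
  "l2_sq x = (\<Sum>k. (cmod (x k))\<^sup>2)"

definition in_h12 :: "(nat \<Rightarrow> complex) \<Rightarrow> bool" where
  "in_h12 x \<longleftrightarrow> summable (\<lambda>k. (1 + real k) * (cmod (x k))\<^sup>2)"

definition h12_sq :: "(nat \<Rightarrow> complex) \<Rightarrow> real" where
  "h12_sq x = (\<Sum>k. (1 + real k) * (cmod (x k))\<^sup>2)"

definition conv :: "(nat \<Rightarrow> complex) \<Rightarrow> (nat \<Rightarrow> complex) \<Rightarrow> nat \<Rightarrow> complex" where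
  "conv x y n = (\<Sum>a\<le>n. x a * y (n - a))"

definition conv_abs :: "(nat \<Rightarrow> complex) \<Rightarrow> (nat \<Rightarrow> complex) \<Rightarrow> nat \<Rightarrow> real" where
  "conv_abs x y n = (\<Sum>a\<le>n. cmod (x a) * cmod (y (n - a)))"

text \<open>The formula of \<open>corr\<close> outside \<open>ell1\<close>: the square of an H^1/2
  sequence is only in l2, so convergence is established separately wherever the series is
  used.\<close>

definition crr :: "(nat \<Rightarrow> complex) \<Rightarrow> (nat \<Rightarrow> complex) \<Rightarrow> nat \<Rightarrow> complex" where
  "crr p y k = (\<Sum>b. p (k + b) * cnj (y b))"

definition l2_ip :: "(nat \<Rightarrow> complex) \<Rightarrow> (nat \<Rightarrow> complex) \<Rightarrow> complex" where
  "l2_ip p q = (\<Sum>n. p n * cnj (q n))"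

lemma in_h12_imp_in_l2:
  assumes "in_h12 x"
  shows "in_l2 x" "l2_sq x \<le> h12_sq x"
proof -
  have le: "(cmod (x k))\<^sup>2 \<le> (1 + real k) * (cmod (x k))\<^sup>2" for k
    by (simp add: mult_le_cancel_right1)
  show "in_l2 x"
    unfolding in_l2_def
    by (rule summable_comparison_test[OF _ assms[unfolded in_h12_def]]) (use le in auto)
  then show "l2_sq x \<le> h12_sq x"
    unfolding l2_sq_def h12_sq_def
    by (intro suminf_le le) (use assms in \<open>auto simp: in_l2_def in_h12_def\<close>)
qed

lemma h12_sq_nonneg: "in_h12 x \<Longrightarrow> 0 \<le> h12_sq x"
  unfolding h12_sq_def in_h12_def by (rule suminf_nonneg) auto

lemma l2_sq_nonneg: "in_l2 x \<Longrightarrow> 0 \<le> l2_sq x"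
  unfolding l2_sq_def in_l2_def by (rule suminf_nonneg) auto

lemma cmod_add_sq_le: "(cmod (x + y))\<^sup>2 \<le> 2 * (cmod x)\<^sup>2 + 2 * (cmod y)\<^sup>2"
proof -
  have "(cmod (x + y))\<^sup>2 \<le> (cmod x + cmod y)\<^sup>2"
    by (intro power_mono norm_triangle_ineq) auto
  also have "\<dots> \<le> 2 * (cmod x)\<^sup>2 + 2 * (cmod y)\<^sup>2"
    using sum_squares_bound[of "cmod x" "cmod y"] by (simp add: power2_sum)
  finally show ?thesis .
qed

lemma in_h12_add:
  assumes "in_h12 x" "in_h12 y"
  shows "in_h12 (\<lambda>k. x k + y k)" "h12_sq (\<lambda>k. x k + y k) \<le> 2 * h12_sq x + 2 * h12_sq y"
proof -
  have le: "(1 + real k) * (cmod (x k + y k))\<^sup>2 \<le> 2 * ((1 + real k) * (cmod (x k))\<^sup>2) + 2 * ((1 + real k) * (cmod (y k))\<^sup>2)" for k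
    using mult_left_mono[OF cmod_add_sq_le[of "x k" "y k"], of "1 + real k"] by (simp add: algebra_simps)
  have s: "summable (\<lambda>k. 2 * ((1 + real k) * (cmod (x k))\<^sup>2) + 2 * ((1 + real k) * (cmod (y k))\<^sup>2))"
    using assms by (intro summable_add summable_mult) (auto simp: in_h12_def)
  show "in_h12 (\<lambda>k. x k + y k)"
    unfolding in_h12_def by (rule summable_comparison_test[OF _ s]) (use le in auto)
  then have "h12_sq (\<lambda>k. x k + y k) \<le> (\<Sum>k. 2 * ((1 + real k) * (cmod (x k))\<^sup>2) + 2 * ((1 + real k) * (cmod (y k))\<^sup>2))"
    unfolding h12_sq_def by (intro suminf_le le s) (simp add: in_h12_def)
  also have "\<dots> = 2 * h12_sq x + 2 * h12_sq y"
    using assms unfolding h12_sq_def in_h12_def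
    by (subst suminf_add[symmetric]) (auto simp: suminf_mult intro: summable_mult)
  finally show "h12_sq (\<lambda>k. x k + y k) \<le> 2 * h12_sq x + 2 * h12_sq y" .
qed

lemma in_h12_uminus: "in_h12 x \<Longrightarrow> in_h12 (\<lambda>k. - x k)" "h12_sq (\<lambda>k. - x k) = h12_sq x"
  by (simp_all add: in_h12_def h12_sq_def)

lemma in_h12_diff:
  assumes "in_h12 x" "in_h12 y"
  shows "in_h12 (\<lambda>k. x k - y k)" "h12_sq (\<lambda>k. x k - y k) \<le> 2 * h12_sq x + 2 * h12_sq y"
  using in_h12_add[OF assms(1) in_h12_uminus(1)[OF assms(2)]] by (simp_all add: in_h12_uminus(2))

lemma conv_commute: "conv x y n = conv y x n"
  unfolding conv_def by (subst sum.atLeastAtMost_rev[of _ 0 n, folded atMost_atLeast0]) (simp add: mult.commute)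

lemma conv_abs_nonneg: "0 \<le> conv_abs x y n"
  unfolding conv_abs_def by (intro sum_nonneg) auto

lemma cmod_conv_le: "cmod (conv x y n) \<le> conv_abs x y n"
  unfolding conv_def conv_abs_def by (intro sum_norm_le) (simp add: norm_mult)

text \<open>The Sobolev embedding of \<open>H\<^sup>1\<^sup>/\<^sup>2\<close> into \<open>L\<^sup>4\<close>; the weights satisfy \<open>(1 + a)(1 + b) \<ge> 1 + a + b\<close>.\<close>

lemma conv_abs_sq_summable:
  assumes x: "in_h12 x" and y: "in_h12 y"
  shows "summable (\<lambda>n. (conv_abs x y n)\<^sup>2)" "(\<Sum>n. (conv_abs x y n)\<^sup>2) \<le> h12_sq x * h12_sq y"
proof -
  define X where "X k = (1 + real k) * (cmod (x k))\<^sup>2" for k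
  define Y where "Y k = (1 + real k) * (cmod (y k))\<^sup>2" for k
  have prod: "(\<lambda>n. \<Sum>a\<le>n. X a * Y (n - a)) sums (h12_sq x * h12_sq y)"
    unfolding h12_sq_def X_def[symmetric] Y_def[symmetric]
    by (rule Cauchy_product_sums) (use x y in \<open>auto simp: in_h12_def X_def Y_def abs_mult\<close>)
  have le: "(conv_abs x y n)\<^sup>2 \<le> (\<Sum>a\<le>n. X a * Y (n - a))" for n
  proof -
    have "(conv_abs x y n)\<^sup>2 \<le> (\<Sum>a\<le>n. 1\<^sup>2) * (\<Sum>a\<le>n. (cmod (x a) * cmod (y (n - a)))\<^sup>2)"
      unfolding conv_abs_def using Cauchy_Schwarz_ineq_sum[of "\<lambda>_. 1" "\<lambda>a. cmod (x a) * cmod (y (n - a))" "{..n}"]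
      by simp
    also have "\<dots> = (\<Sum>a\<le>n. (1 + real n) * (cmod (x a) * cmod (y (n - a)))\<^sup>2)"
      by (simp add: sum_distrib_left)
    also have "\<dots> \<le> (\<Sum>a\<le>n. ((1 + real a) * (1 + real (n - a))) * (cmod (x a) * cmod (y (n - a)))\<^sup>2)"
    proof (intro sum_mono mult_right_mono)
      fix a assume "a \<in> {..n}"
      then have "1 + real n = 1 + real a + real (n - a)"
        by simp
      also have "\<dots> \<le> (1 + real a) * (1 + real (n - a))"
        by (simp only: distrib_left distrib_right mult_1 mult_1_right) simp
      finally show "1 + real n \<le> (1 + real a) * (1 + real (n - a))" .
    qed auto
    also have "\<dots> = (\<Sum>a\<le>n. X a * Y (n - a))"
      by (simp add: X_def Y_def power_mult_distrib mult_ac)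
    finally show ?thesis .
  qed
  show s: "summable (\<lambda>n. (conv_abs x y n)\<^sup>2)"
    by (rule summable_comparison_test[OF _ sums_summable[OF prod]]) (use le in auto)
  show "(\<Sum>n. (conv_abs x y n)\<^sup>2) \<le> h12_sq x * h12_sq y"
    using suminf_le[OF le s sums_summable[OF prod]] sums_unique[OF prod] by simp
qed

lemma in_l2_conv:
  assumes "in_h12 x" "in_h12 y"
  shows "in_l2 (conv x y)" "l2_sq (conv x y) \<le> h12_sq x * h12_sq y"
proof -
  have le: "(cmod (conv x y n))\<^sup>2 \<le> (conv_abs x y n)\<^sup>2" for n
    by (intro power_mono cmod_conv_le) auto
  show 1: "in_l2 (conv x y)"
    unfolding in_l2_def
    by (rule summable_comparison_test[OF _ conv_abs_sq_summable(1)[OF assms]]) (use le in auto)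
  have "l2_sq (conv x y) \<le> (\<Sum>n. (conv_abs x y n)\<^sup>2)"
    unfolding l2_sq_def by (intro suminf_le le 1[unfolded in_l2_def] conv_abs_sq_summable assms)
  then show "l2_sq (conv x y) \<le> h12_sq x * h12_sq y"
    using conv_abs_sq_summable(2)[OF assms] by linarith
qed

lemma summable_mult_l2:
  fixes f g :: "nat \<Rightarrow> real"
  assumes "summable (\<lambda>n. (f n)\<^sup>2)" "summable (\<lambda>n. (g n)\<^sup>2)" "\<And>n. 0 \<le> f n" "\<And>n. 0 \<le> g n"
  shows "summable (\<lambda>n. f n * g n)" "(\<Sum>n. f n * g n) \<le> ((\<Sum>n. (f n)\<^sup>2) + (\<Sum>n. (g n)\<^sup>2)) / 2"
proof -
  have le: "f n * g n \<le> ((f n)\<^sup>2 + (g n)\<^sup>2) / 2" for n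
    using sum_squares_bound[of "f n" "g n"] by simp
  have s: "summable (\<lambda>n. ((f n)\<^sup>2 + (g n)\<^sup>2) / 2)"
    by (intro summable_divide summable_add assms)
  show s': "summable (\<lambda>n. f n * g n)"
    by (rule summable_comparison_test[OF _ s]) (use le assms in auto)
  have "(\<Sum>n. f n * g n) \<le> (\<Sum>n. ((f n)\<^sup>2 + (g n)\<^sup>2) / 2)"
    by (intro suminf_le le s s')
  also have "\<dots> = ((\<Sum>n. (f n)\<^sup>2) + (\<Sum>n. (g n)\<^sup>2)) / 2"
    using sums_divide[OF sums_add[OF assms(1,2)[THEN summable_sums]], of 2] by (simp add: sums_iff)
  finally show "(\<Sum>n. f n * g n) \<le> ((\<Sum>n. (f n)\<^sup>2) + (\<Sum>n. (g n)\<^sup>2)) / 2" .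
qed

lemma summable_l2_ip:
  assumes "in_l2 p" "in_l2 q"
  shows "summable (\<lambda>n. cmod (p n) * cmod (q n))" "summable (\<lambda>n. p n * cnj (q n))"
proof -
  show 1: "summable (\<lambda>n. cmod (p n) * cmod (q n))"
    by (rule summable_mult_l2) (use assms in \<open>auto simp: in_l2_def\<close>)
  show "summable (\<lambda>n. p n * cnj (q n))"
    by (rule summable_norm_cancel) (simp add: norm_mult 1)
qed

text \<open>Both sides are the absolutely convergent double series
  \<open>\<Sum> p (k + b) cnj (y b) cnj (z k)\<close>, summed by rows and along antidiagonals.\<close>

lemma crr_sums_l2_ip_aux:
  assumes s: "summable (\<lambda>n. cmod (p n) * conv_abs y z n)"
  shows "(\<lambda>k. crr p y k * cnj (z k)) sums l2_ip p (conv y z)"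
    and "z k \<noteq> 0 \<Longrightarrow> summable (\<lambda>b. cmod (p (k + b)) * cmod (y b))"
proof -
  define g where "g = (\<lambda>(k, b). p (k + b) * (cnj (y b) * cnj (z k)))"
  define h where "h = (\<lambda>(n, a). p n * (cnj (y a) * cnj (z (n - a))))"
  define S where "S = Sigma (UNIV :: nat set) (\<lambda>n. {..n})"
  have bij: "bij_betw (\<lambda>(n, a). (n - a, a)) S (UNIV \<times> UNIV)"
    unfolding S_def by (rule bij_betwI[of _ _ _ "\<lambda>(k, b). (k + b, b)"]) auto
  have gh: "g ((\<lambda>(n, a). (n - a, a)) x) = h x" if "x \<in> S" for x
    using that by (auto simp: g_def h_def S_def)
  have h_abs: "(\<lambda>x. norm (h x)) summable_on S"
    unfolding S_def Infinite_Sum.abs_summable_on_Sigma_iff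
  proof (intro conjI ballI)
    have "(\<Sum>\<^sub>\<infinity>a\<in>{..n}. norm (h (n, a))) = cmod (p n) * conv_abs y z n" for n
      by (simp add: h_def conv_abs_def norm_mult sum_distrib_left)
    moreover have "(\<lambda>n. norm (cmod (p n) * conv_abs y z n)) summable_on UNIV"
      using s conv_abs_nonneg by (subst summable_on_UNIV_nonneg_real_iff) (auto simp: abs_mult)
    ultimately show "(\<lambda>n. norm (\<Sum>\<^sub>\<infinity>a\<in>{..n}. norm (h (n, a)))) summable_on UNIV"
      by simp
  qed simp
  have g_abs: "(\<lambda>x. norm (g x)) summable_on UNIV \<times> UNIV"
  proof -
    have "(\<lambda>x. norm (g ((\<lambda>(n, a). (n - a, a)) x))) summable_on S"
      using h_abs by (subst summable_on_cong[of S _ "\<lambda>x. norm (h x)"]) (simp_all add: gh)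
    then show ?thesis
      by (subst (asm) summable_on_reindex_bij_betw[OF bij])
  qed
  have "(h has_sum infsum h S) S"
    by (rule has_sum_infsum[OF Infinite_Sum.abs_summable_summable[OF h_abs]])
  then have hS: "((\<lambda>n. p n * cnj (conv y z n)) has_sum infsum h S) UNIV"
    unfolding S_def
    by (rule has_sum_SigmaD)
       (auto intro!: has_sum_finiteI simp: h_def conv_def sum_distrib_left mult_ac)
  have g_row: "(\<lambda>b. norm (g (k, b))) summable_on UNIV" for k
    using g_abs unfolding Infinite_Sum.abs_summable_on_Sigma_iff by blast
  have g_row': "summable (\<lambda>b. cmod (p (k + b)) * cmod (y b) * cmod (z k))" for k
    using summable_on_imp_summable[OF g_row[of k]] by (simp add: g_def norm_mult mult_ac)
  \<comment> \<open>Only the rows multiplied by \<open>z k\<close> are known to converge. Where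
    \<open>z k = 0\<close> the value of \<open>crr p y k\<close> is immaterial.\<close>
  show row: "summable (\<lambda>b. cmod (p (k + b)) * cmod (y b))" if "z k \<noteq> 0" for k
    using g_row'[of k] that summable_cmult_iff[of "cmod (z k)" "\<lambda>b. cmod (p (k + b)) * cmod (y b)"]
    by (simp add: mult.commute)
  have row_sum: "(\<lambda>b. g (k, b)) sums (crr p y k * cnj (z k))" for k
  proof (cases "z k = 0")
    case False
    have "summable (\<lambda>b. p (k + b) * cnj (y b))"
      by (rule summable_norm_cancel) (simp add: norm_mult row[OF False])
    then show ?thesis
      unfolding crr_def g_def using sums_mult2[OF summable_sums, of "\<lambda>b. p (k + b) * cnj (y b)" "cnj (z k)"]
      by (simp add: mult.assoc)
  qed (simp add: g_def)
  have row_has: "((\<lambda>b. g (k, b)) has_sum (crr p y k * cnj (z k))) UNIV" for k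
    using summable_on_imp_summable[OF g_row[of k]] row_sum by (intro norm_summable_imp_has_sum)
  have "infsum g (UNIV \<times> UNIV) = infsum h S"
    using infsum_reindex_bij_betw[OF bij, of g] infsum_cong[OF gh, of S "\<lambda>x. x"] by simp
  then have "(g has_sum infsum h S) (UNIV \<times> UNIV)"
    using has_sum_infsum[OF Infinite_Sum.abs_summable_summable[OF g_abs]] by simp
  then have gS: "((\<lambda>k. crr p y k * cnj (z k)) has_sum infsum h S) UNIV"
    using row_has by (rule has_sum_SigmaD)
  have "infsum h S = l2_ip p (conv y z)"
    unfolding l2_ip_def using has_sum_imp_sums[OF hS] by (simp add: sums_iff)
  then show "(\<lambda>k. crr p y k * cnj (z k)) sums l2_ip p (conv y z)"
    using has_sum_imp_sums[OF gS] by simp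
qed

text \<open>The identity computes the energy flux; the bound on absolute partial sums, uniform in
  \<open>N\<close>, later dominates it in time.\<close>

lemma crr_sums_l2_ip:
  assumes p: "in_l2 p" and y: "in_h12 y" and z: "in_h12 z"
  shows "(\<lambda>k. crr p y k * cnj (z k)) sums l2_ip p (conv y z)"
    and "(\<Sum>k<N. cmod (crr p y k) * cmod (z k)) \<le> (l2_sq p + h12_sq y * h12_sq z) / 2"
proof -
  have s: "summable (\<lambda>n. cmod (p n) * conv_abs y z n)"
    by (rule summable_mult_l2[of "\<lambda>n. cmod (p n)" "conv_abs y z", OF p[unfolded in_l2_def]
        conv_abs_sq_summable(1)[OF y z] norm_ge_zero conv_abs_nonneg])
  have le: "(\<Sum>n. cmod (p n) * conv_abs y z n) \<le> (l2_sq p + h12_sq y * h12_sq z) / 2"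
  proof (rule order_trans[OF summable_mult_l2(2)])
    show "((\<Sum>n. (cmod (p n))\<^sup>2) + (\<Sum>n. (conv_abs y z n)\<^sup>2)) / 2 \<le> (l2_sq p + h12_sq y * h12_sq z) / 2"
      unfolding l2_sq_def by (intro divide_right_mono add_left_mono conv_abs_sq_summable y z) simp
  qed (use p conv_abs_sq_summable(1)[OF y z] conv_abs_nonneg in \<open>simp_all add: in_l2_def\<close>)
  show "(\<lambda>k. crr p y k * cnj (z k)) sums l2_ip p (conv y z)"
    by (rule crr_sums_l2_ip_aux(1)[OF s])
  \<comment> \<open>The summation identity applied to the moduli yields absolute
    convergence.\<close>
  define p' y' z' where "p' = (\<lambda>k. complex_of_real (cmod (p k)))" and "y' = (\<lambda>k. complex_of_real (cmod (y k)))"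
    and "z' = (\<lambda>k. complex_of_real (cmod (z k)))"
  have s': "summable (\<lambda>n. cmod (p' n) * conv_abs y' z' n)"
    using s by (simp add: p'_def y'_def z'_def conv_abs_def)
  have conv': "conv y' z' n = complex_of_real (conv_abs y z n)" for n
    by (simp add: y'_def z'_def conv_def conv_abs_def)
  have "(\<lambda>k. crr p' y' k * cnj (z' k)) sums l2_ip p' (conv y' z')"
    by (rule crr_sums_l2_ip_aux(1)[OF s'])
  also have "l2_ip p' (conv y' z') = complex_of_real (\<Sum>n. cmod (p n) * conv_abs y z n)"
    unfolding l2_ip_def conv' p'_def using s by (simp add: suminf_of_real)
  finally have sums: "(\<lambda>k. Re (crr p' y' k) * cmod (z k)) sums (\<Sum>n. cmod (p n) * conv_abs y z n)"
    by (drule_tac sums_Re) (simp add: z'_def)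
  have le2: "cmod (crr p y k) * cmod (z k) \<le> Re (crr p' y' k) * cmod (z k)" for k
  proof (cases "z k = 0")
    case False
    have row: "summable (\<lambda>b. cmod (p (k + b)) * cmod (y b))"
      by (rule crr_sums_l2_ip_aux(2)[OF s False])
    then have "crr p' y' k = complex_of_real (\<Sum>b. cmod (p (k + b)) * cmod (y b))"
      unfolding crr_def p'_def y'_def by (simp add: suminf_of_real)
    moreover have "cmod (crr p y k) \<le> (\<Sum>b. cmod (p (k + b)) * cmod (y b))"
      unfolding crr_def by (rule norm_suminf_le) (use row in \<open>auto simp: norm_mult\<close>)
    ultimately show ?thesis
      by (intro mult_right_mono) auto
  qed simp
  have "(\<Sum>k<N. cmod (crr p y k) * cmod (z k)) \<le> (\<Sum>k<N. Re (crr p' y' k) * cmod (z k))"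
    by (intro sum_mono le2)
  also have "\<dots> \<le> (\<Sum>n. cmod (p n) * conv_abs y z n)"
  proof -
    have "0 \<le> Re (crr p' y' k) * cmod (z k)" for k
      using le2[of k] by (meson mult_nonneg_nonneg norm_ge_zero order_trans)
    then show ?thesis
      using sum_le_suminf[OF sums_summable[OF sums], of "{..<N}"] sums_unique[OF sums] by simp
  qed
  finally show "(\<Sum>k<N. cmod (crr p y k) * cmod (z k)) \<le> (l2_sq p + h12_sq y * h12_sq z) / 2"
    using le by linarith
qed


abbreviation cubic_coef :: "(nat \<Rightarrow> complex) \<Rightarrow> nat \<Rightarrow> complex" where
  "cubic_coef x \<equiv> crr (conv x x) x"

text \<open>The Fourier coefficient of \<open>|w|\<^sup>2 w\<close> at \<open>b\<close> is the sum of \<open>w\<^sub>a w\<^sub>c cnj w\<^sub>d\<close> over \<open>a + c = b + d\<close>. One splits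
  according to \<open>d \<le> a\<close> or \<open>a < d\<close> and applies Cauchy-Schwarz, isolating the factor with the larger of
  the indices \<open>a\<close>, \<open>d\<close>.\<close>

lemma cubic_coef_bound:
  assumes w: "in_h12 w"
  shows "cmod (cubic_coef w b) \<le> 2 * sqrt (h12_sq w) * l2_sq w"
proof -
  define W where "W k = cmod (w k)" for k
  have E: "(\<Sum>k\<in>A. (W k)\<^sup>2) \<le> l2_sq w" if "finite A" for A
    unfolding W_def l2_sq_def
    using that in_h12_imp_in_l2(1)[OF w] by (intro sum_le_suminf) (auto simp: in_l2_def)
  have H: "(\<Sum>k\<in>A. (1 + real k) * (W k)\<^sup>2) \<le> h12_sq w" if "finite A" for A
    unfolding W_def h12_sq_def
    using that w by (intro sum_le_suminf) (auto simp: in_h12_def)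
  have E0: "0 \<le> l2_sq w" and H0: "0 \<le> h12_sq w"
    using w in_h12_imp_in_l2(1) l2_sq_nonneg h12_sq_nonneg by auto
  have EE: "(\<Sum>(i, j)\<in>A. (W i)\<^sup>2 * (W j)\<^sup>2) \<le> (l2_sq w)\<^sup>2" if A: "finite A" for A
  proof -
    have "(\<Sum>(i, j)\<in>A. (W i)\<^sup>2 * (W j)\<^sup>2) \<le> (\<Sum>(i, j)\<in>fst ` A \<times> snd ` A. (W i)\<^sup>2 * (W j)\<^sup>2)"
      by (intro sum_mono2) (use A in \<open>auto intro: rev_image_eqI\<close>)
    also have "\<dots> = (\<Sum>i\<in>fst ` A. (W i)\<^sup>2) * (\<Sum>j\<in>snd ` A. (W j)\<^sup>2)"
      by (simp add: sum_product sum.cartesian_product)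
    also have "\<dots> \<le> l2_sq w * l2_sq w"
      using A by (intro mult_mono E E0) (auto intro: sum_nonneg)
    finally show ?thesis by (simp add: power2_eq_square)
  qed
  \<comment> \<open>\<open>f\<close> is the factor with the larger index. The other two indices
    determine the pair, so their product is square summable over distinct pairs, with total at most
    the square of \<open>l2_sq w\<close>.\<close>
  have CS: "(\<Sum>x\<in>X. f x * (W (g1 x) * W (g2 x))) \<le> sqrt (h12_sq w) * l2_sq w"
    if X: "finite X" "(\<Sum>x\<in>X. (f x)\<^sup>2) \<le> h12_sq w" "inj_on (\<lambda>x. (g1 x, g2 x)) X"
    for X :: "(nat \<times> nat) set" and f g1 g2
  proof -
    have "(\<Sum>x\<in>X. f x * (W (g1 x) * W (g2 x)))\<^sup>2 \<le> (\<Sum>x\<in>X. (f x)\<^sup>2) * (\<Sum>x\<in>X. (W (g1 x) * W (g2 x))\<^sup>2)"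
      by (rule Cauchy_Schwarz_ineq_sum)
    also have "(\<Sum>x\<in>X. (W (g1 x) * W (g2 x))\<^sup>2) = (\<Sum>(i, j)\<in>(\<lambda>x. (g1 x, g2 x)) ` X. (W i)\<^sup>2 * (W j)\<^sup>2)"
      by (subst sum.reindex[OF X(3)]) (simp add: power_mult_distrib)
    also have "(\<Sum>x\<in>X. (f x)\<^sup>2) * \<dots> \<le> h12_sq w * (l2_sq w)\<^sup>2"
      using X H0 by (intro mult_mono EE) (auto intro!: sum_nonneg)
    also have "\<dots> = (sqrt (h12_sq w) * l2_sq w)\<^sup>2"
      using H0 by (simp add: power_mult_distrib)
    finally show ?thesis
      by (rule power2_le_imp_le) (use E0 H0 in simp)
  qed
  have partial: "(\<Sum>d<D. W d * conv_abs w w (b + d)) \<le> 2 * sqrt (h12_sq w) * l2_sq w" for D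
  proof -
    define X where "X = Sigma {..<D} (\<lambda>d. {..b + d})"
    define X1 where "X1 = {(d, a) \<in> X. d \<le> a}"
    define X2 where "X2 = {(d, a) \<in> X. a < d}"
    have "finite X"
      by (simp add: X_def)
    moreover have "X1 \<subseteq> X" "X2 \<subseteq> X"
      by (auto simp: X1_def X2_def)
    ultimately have fin: "finite X" "finite X1" "finite X2"
      using finite_subset by blast+
    have X12: "X = X1 \<union> X2" "X1 \<inter> X2 = {}"
      by (auto simp: X1_def X2_def)
    have "(\<Sum>d<D. W d * conv_abs w w (b + d)) = (\<Sum>(d, a)\<in>X. W d * (W a * W (b + d - a)))"
      by (simp add: X_def conv_abs_def W_def sum_distrib_left sum.Sigma)
    also have "\<dots> = (\<Sum>(d, a)\<in>X1. W d * (W a * W (b + d - a))) + (\<Sum>(d, a)\<in>X2. W d * (W a * W (b + d - a)))"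
      by (subst X12(1), rule sum.union_disjoint[OF fin(2,3) X12(2)])
    also have "(\<Sum>(d, a)\<in>X1. W d * (W a * W (b + d - a))) \<le> sqrt (h12_sq w) * l2_sq w"
    proof -
      \<comment> \<open>For fixed \<open>a\<close> there are at most \<open>a + 1\<close> indices
        \<open>d \<le> a\<close>; counting them produces the weight in
        \<open>h12_sq\<close>.\<close>
      have "(\<Sum>x\<in>X1. (W (snd x))\<^sup>2) \<le> (\<Sum>x\<in>prod.swap ` Sigma {..b + D} (\<lambda>a. {..a}). (W (snd x))\<^sup>2)"
        by (intro sum_mono2) (auto simp: X_def X1_def image_iff)
      also have "\<dots> = (\<Sum>x\<in>Sigma {..b + D} (\<lambda>a. {..a}). (W (fst x))\<^sup>2)"
        by (subst sum.reindex) auto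
      also have "\<dots> = (\<Sum>a\<le>b + D. \<Sum>d\<le>a. (W a)\<^sup>2)"
        by (subst sum.Sigma) (auto simp: case_prod_unfold)
      also have "\<dots> \<le> h12_sq w"
        using H[of "{..b + D}"] by simp
      finally have "(\<Sum>x\<in>X1. W (snd x) * (W (fst x) * W (b + fst x - snd x))) \<le> sqrt (h12_sq w) * l2_sq w"
        by (intro CS fin) (auto simp: inj_on_def X1_def X_def)
      then show ?thesis
        by (simp add: case_prod_unfold mult.left_commute)
    qed
    also have "(\<Sum>(d, a)\<in>X2. W d * (W a * W (b + d - a))) \<le> sqrt (h12_sq w) * l2_sq w"
    proof -
      have "(\<Sum>x\<in>X2. (W (fst x))\<^sup>2) \<le> (\<Sum>x\<in>Sigma {..<D} (\<lambda>d. {..d}). (W (fst x))\<^sup>2)"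
        by (intro sum_mono2) (auto simp: X_def X2_def)
      also have "\<dots> = (\<Sum>d<D. \<Sum>a\<le>d. (W d)\<^sup>2)"
        by (subst sum.Sigma) (auto simp: case_prod_unfold)
      also have "\<dots> \<le> h12_sq w"
        using H[of "{..<D}"] by simp
      finally have "(\<Sum>x\<in>X2. W (fst x) * (W (snd x) * W (b + fst x - snd x))) \<le> sqrt (h12_sq w) * l2_sq w"
        by (intro CS fin) (auto simp: inj_on_def X2_def X_def)
      then show ?thesis
        by (simp add: case_prod_unfold)
    qed
    finally show ?thesis by (simp add: mult_ac)
  qed
  have le: "cmod (conv w w (b + d) * cnj (w d)) \<le> W d * conv_abs w w (b + d)" for d
    unfolding norm_mult complex_mod_cnj W_def by (subst mult.commute) (intro mult_left_mono cmod_conv_le norm_ge_zero)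
  have s: "summable (\<lambda>d. W d * conv_abs w w (b + d))"
    by (rule summableI_nonneg_bounded[OF _ partial]) (auto simp: W_def conv_abs_nonneg)
  have "cmod (cubic_coef w b) \<le> (\<Sum>d. W d * conv_abs w w (b + d))"
    unfolding crr_def by (rule norm_suminf_le[OF le s])
  also have "\<dots> \<le> 2 * sqrt (h12_sq w) * l2_sq w"
    by (rule suminf_le_const[OF s partial])
  finally show ?thesis .
qed

lemma conv_abs_self_le:
  assumes "in_l2 w"
  shows "conv_abs w w n \<le> l2_sq w"
proof -
  have "conv_abs w w n \<le> (\<Sum>a\<le>n. ((cmod (w a))\<^sup>2 + (cmod (w (n - a)))\<^sup>2) / 2)"
    unfolding conv_abs_def
  proof (rule sum_mono)
    show "cmod (w a) * cmod (w (n - a)) \<le> ((cmod (w a))\<^sup>2 + (cmod (w (n - a)))\<^sup>2) / 2" for a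
      using sum_squares_bound[of "cmod (w a)" "cmod (w (n - a))"] by simp
  qed
  also have "\<dots> = ((\<Sum>a\<le>n. (cmod (w a))\<^sup>2) + (\<Sum>a\<le>n. (cmod (w (n - a)))\<^sup>2)) / 2"
    by (simp add: sum.distrib sum_divide_distrib add_divide_distrib)
  also have "(\<Sum>a\<le>n. (cmod (w (n - a)))\<^sup>2) = (\<Sum>a\<le>n. (cmod (w a))\<^sup>2)"
    by (subst sum.atLeastAtMost_rev[of _ 0 n, folded atMost_atLeast0]) simp
  also have "((\<Sum>a\<le>n. (cmod (w a))\<^sup>2) + (\<Sum>a\<le>n. (cmod (w a))\<^sup>2)) / 2 = (\<Sum>a\<le>n. (cmod (w a))\<^sup>2)"
    by simp
  also have "\<dots> \<le> l2_sq w"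
    unfolding l2_sq_def using assms by (intro sum_le_suminf) (auto simp: in_l2_def)
  finally show ?thesis .
qed

lemma coef_mult_conv: "coef (x * y) = conv (coef x) (coef y)"
  by (simp add: fun_eq_iff coef_mult conv_def)

lemma coef_cubic: "coef (cubic x) k = cubic_coef (coef x) k"
  by (simp add: cubic_def coef_corr crr_def coef_mult_conv)

lemma in_l2_add: "in_l2 p \<Longrightarrow> in_l2 q \<Longrightarrow> in_l2 (\<lambda>n. p n + q n)"
  unfolding in_l2_def
  by (rule summable_comparison_test[of _ "\<lambda>k. 2 * (cmod (p k))\<^sup>2 + 2 * (cmod (q k))\<^sup>2"])
     (auto intro: cmod_add_sq_le summable_add summable_mult)

lemma l2_ip_add:
  assumes "in_l2 p" "in_l2 q" "in_l2 r"
  shows "l2_ip (\<lambda>n. p n + q n) r = l2_ip p r + l2_ip q r"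
    and "l2_ip r (\<lambda>n. p n + q n) = l2_ip r p + l2_ip r q"
  unfolding l2_ip_def using summable_l2_ip(2) assms
  by (simp_all add: suminf_add algebra_simps)

lemma l2_ip_cnj: "in_l2 p \<Longrightarrow> in_l2 q \<Longrightarrow> cnj (l2_ip p q) = l2_ip q p"
  unfolding l2_ip_def
  by (subst bounded_linear.suminf[OF bounded_linear_cnj summable_l2_ip(2)]) (auto simp: mult.commute)

text \<open>With \<open>u = v + w\<close>, the terms \<open>\<langle>w\<^sup>2, w\<^sup>2\<rangle>\<close> and \<open>\<langle>v w, v w\<rangle>\<close> are real, and
  \<open>2 \<langle>v w, w\<^sup>2\<rangle> + \<langle>w\<^sup>2, v w\<rangle>\<close> has the same imaginary part as \<open>\<langle>v w, w\<^sup>2\<rangle>\<close>.\<close>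

lemma energy_flux_bound:
  assumes v: "in_h12 (coef V)" and w: "in_h12 w" and V: "norm V \<le> M"
  defines "u \<equiv> (\<lambda>k. coef V k + w k)"
  shows "\<bar>Im (l2_ip (conv u u) (conv u w) - l2_ip (conv (coef V) (coef V)) (conv (coef V) w))\<bar>
       \<le> (M\<^sup>2 + 2 * M * sqrt (h12_sq w)) * l2_sq w"
proof -
  define v where "v = coef V"
  note v = v[folded v_def]
  define a where "a = conv v v"
  define b where "b = conv v w"
  define c where "c = conv w w"
  have l2: "in_l2 a" "in_l2 b" "in_l2 c"
    by (simp_all add: a_def b_def c_def in_l2_conv v w)
  have uu: "conv u u = (\<lambda>n. a n + (b n + (b n + c n)))"
  proof
    fix n
    have "conv u u n = conv v v n + conv v w n + conv w v n + conv w w n"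
      by (simp add: u_def v_def conv_def sum.distrib algebra_simps)
    then show "conv u u n = a n + (b n + (b n + c n))"
      by (simp add: a_def b_def c_def conv_commute[of w v])
  qed
  have uw: "conv u w = (\<lambda>n. b n + c n)"
    by (simp add: fun_eq_iff u_def v_def b_def c_def conv_def sum.distrib algebra_simps)
  have "l2_ip (conv u u) (conv u w) - l2_ip a b
      = l2_ip a c + l2_ip b b + l2_ip b b + (l2_ip b c + l2_ip b c + l2_ip c b) + l2_ip c c"
    unfolding uu uw by (simp only: l2_ip_add l2 in_l2_add) simp
  moreover have "Im (l2_ip b b) = 0" "Im (l2_ip c c) = 0"
    using l2_ip_cnj[OF l2(2) l2(2)] l2_ip_cnj[OF l2(3) l2(3)] by (metis Im_complex_of_real Reals_cnj_iff Reals_cases)+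
  moreover have "Im (l2_ip b c) = - Im (l2_ip c b)"
    unfolding l2_ip_cnj[OF l2(3) l2(2), symmetric] by simp
  ultimately have "Im (l2_ip (conv u u) (conv u w) - l2_ip a b) = Im (l2_ip a c) - Im (l2_ip c b)"
    by simp
  then have "\<bar>Im (l2_ip (conv u u) (conv u w) - l2_ip a b)\<bar> \<le> cmod (l2_ip a c) + cmod (l2_ip c b)"
    using abs_Im_le_cmod[of "l2_ip a c"] abs_Im_le_cmod[of "l2_ip c b"] by linarith
  also have "cmod (l2_ip a c) \<le> M\<^sup>2 * l2_sq w"
  proof -
    have E0: "0 \<le> l2_sq w"
      using w in_h12_imp_in_l2(1) l2_sq_nonneg by auto
    have "cmod (l2_ip a c) \<le> (\<Sum>n. cmod (coef (V * V) n) * l2_sq w)"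
      unfolding l2_ip_def
    proof (rule norm_suminf_le)
      show "cmod (a n * cnj (c n)) \<le> cmod (coef (V * V) n) * l2_sq w" for n
        unfolding coef_mult_conv a_def v_def c_def norm_mult complex_mod_cnj
        by (intro mult_left_mono order_trans[OF cmod_conv_le] conv_abs_self_le in_h12_imp_in_l2 w) auto
    qed (intro summable_mult2 summable_coef)
    also have "\<dots> = norm (V * V) * l2_sq w"
      by (simp add: suminf_mult2[symmetric] norm_ell1_def)
    also have "\<dots> \<le> M\<^sup>2 * l2_sq w"
    proof (rule mult_right_mono[OF _ E0])
      have "norm (V * V) \<le> norm V * norm V"
        by (rule norm_mult_ineq)
      also have "\<dots> \<le> M * M"
        using V order_trans[OF norm_ge_zero V] by (intro mult_mono) auto
      finally show "norm (V * V) \<le> M\<^sup>2"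
        by (simp add: power2_eq_square)
    qed
    finally show ?thesis .
  qed
  also have "cmod (l2_ip c b) \<le> M * (2 * sqrt (h12_sq w) * l2_sq w)"
  proof -
    \<comment> \<open>One factor \<open>w\<close> is moved across the pairing. What remains is the
      projection of \<open>|w|\<^sup>2 w\<close>, whose coefficients are uniformly bounded, against
      the summable coefficients of \<open>V\<close>.\<close>
    have "l2_ip c b = (\<Sum>k. crr c w k * cnj (v k))"
    proof -
      have "conv w v = b"
        by (simp add: b_def fun_eq_iff conv_commute[of w v])
      then show ?thesis
        using crr_sums_l2_ip(1)[OF l2(3) w v] by (simp add: sums_iff)
    qed
    also have "cmod \<dots> \<le> (\<Sum>k. (2 * sqrt (h12_sq w) * l2_sq w) * cmod (coef V k))"
    proof (rule norm_suminf_le)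
      show "cmod (crr c w k * cnj (v k)) \<le> (2 * sqrt (h12_sq w) * l2_sq w) * cmod (coef V k)" for k
        unfolding norm_mult complex_mod_cnj v_def c_def by (intro mult_right_mono cubic_coef_bound w) auto
    qed (intro summable_mult summable_coef)
    also have "\<dots> = norm V * (2 * sqrt (h12_sq w) * l2_sq w)"
      unfolding norm_ell1_def by (subst suminf_mult[OF summable_coef]) (rule mult.commute)
    also have "\<dots> \<le> M * (2 * sqrt (h12_sq w) * l2_sq w)"
      using V w by (intro mult_right_mono mult_nonneg_nonneg) (auto intro: h12_sq_nonneg l2_sq_nonneg in_h12_imp_in_l2)
    finally show ?thesis .
  qed
  finally show ?thesis
    by (simp add: a_def b_def v_def algebra_simps)
qed


text \<open>\<open>E\<close> is only known as the integral of an integrable \<open>e\<close> and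
  need not be differentiable. The argument is therefore run for its antiderivative
  \<open>I\<close>.\<close>

lemma integral_gronwall_zero:
  fixes E e :: "real \<Rightarrow> real"
  assumes e: "e integrable_on {0..T}" and E: "\<And>t. t \<in> {0..T} \<Longrightarrow> E t = integral {0..t} e"
    and le: "\<And>t. t \<in> {0..T} \<Longrightarrow> \<bar>e t\<bar> \<le> K * E t" and K: "0 < K"
    and t: "t \<in> {0..T}"
  shows "E t \<le> 0"
proof -
  have Ec: "continuous_on {0..T} E"
    by (rule continuous_on_eq[OF indefinite_integral_continuous_1[OF e]]) (simp add: E)
  define I where "I s = integral {0..s} E" for s
  have E_le: "E s \<le> K * I s" if s: "s \<in> {0..T}" for s
  proof -
    have sub: "{0..s} \<subseteq> {0..T}"
      using s by auto
    have "E s = integral {0..s} e"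
      by (rule E[OF s])
    also have "\<dots> \<le> integral {0..s} (\<lambda>r. K * E r)"
    proof (rule integral_le)
      show "e integrable_on {0..s}"
        using e sub by (rule integrable_on_subinterval)
      show "(\<lambda>r. K * E r) integrable_on {0..s}"
        by (intro integrable_continuous_real continuous_intros continuous_on_subset[OF Ec sub])
      show "e r \<le> K * E r" if "r \<in> {0..s}" for r
        using le[of r] that sub by auto
    qed
    finally show ?thesis by (simp add: I_def)
  qed
  have "exp (- K * t) * I t \<le> exp (- K * 0) * I 0"
  proof (rule DERIV_nonpos_imp_decreasing_open[of 0 t "\<lambda>s. exp (- K * s) * I s"])
    show "0 \<le> t" using t by simp
    have sub: "{0..t} \<subseteq> {0..T}"
      using t by auto
    show "continuous_on {0..t} (\<lambda>s. exp (- K * s) * I s)"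
      unfolding I_def
      by (intro continuous_intros indefinite_integral_continuous_1 integrable_continuous_real continuous_on_subset[OF Ec sub])
    fix s assume s: "0 < s" "s < t"
    have "(I has_real_derivative E s) (at s within {0..T})"
      unfolding I_def using t s by (intro integral_has_real_derivative Ec) auto
    then have "(I has_real_derivative E s) (at s)"
      using s t by (subst (asm) at_within_Icc_at) auto
    then have "((\<lambda>s. exp (- K * s) * I s) has_real_derivative exp (- K * s) * (E s - K * I s)) (at s)"
      by (auto intro!: derivative_eq_intros simp: algebra_simps)
    moreover have "exp (- K * s) * (E s - K * I s) \<le> 0"
      using E_le[of s] s t by (intro mult_nonneg_nonpos) auto
    ultimately show "\<exists>y. ((\<lambda>s. exp (- K * s) * I s) has_real_derivative y) (at s) \<and> y \<le> 0"
      by blast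
  qed
  then have "I t \<le> 0"
    by (simp add: I_def mult_le_0_iff)
  then show ?thesis
    using E_le[OF t] K by (smt (verit) mult_nonneg_nonpos)
qed

text \<open>Weak-strong uniqueness: \<open>u\<close> solves the equation mode by mode in H^1/2,
  \<open>v\<close> in the norm of \<open>ell1\<close>, and only \<open>v\<close> is bounded in the
  Wiener norm.\<close>

theorem szego_unique:
  fixes u :: "real \<Rightarrow> nat \<Rightarrow> complex" and v :: "real \<Rightarrow> ell1"
  assumes u: "\<And>t. t \<in> {0..T} \<Longrightarrow> in_h12 (u t)" and uB: "\<And>t. t \<in> {0..T} \<Longrightarrow> h12_sq (u t) \<le> B"
    and u': "\<And>t k. t \<in> {0..T} \<Longrightarrow>
      ((\<lambda>s. u s k) has_vector_derivative - \<i> * cubic_coef (u t) k) (at t within {0..T})"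
    and v: "\<And>t. t \<in> {0..T} \<Longrightarrow> in_h12 (coef (v t))" and vB: "\<And>t. t \<in> {0..T} \<Longrightarrow> h12_sq (coef (v t)) \<le> B"
    and v': "\<And>t. t \<in> {0..T} \<Longrightarrow> szego_ode v T t"
    and M: "\<And>t. t \<in> {0..T} \<Longrightarrow> norm (v t) \<le> M"
    and init: "u 0 = coef (v 0)" and t: "t \<in> {0..T}"
  shows "u t = coef (v t)"
proof -
  define w where "w t = (\<lambda>k. u t k - coef (v t) k)" for t
  have w: "in_h12 (w t)" "h12_sq (w t) \<le> 4 * B" if "t \<in> {0..T}" for t
    using in_h12_diff[OF u[OF that] v[OF that]] uB[OF that] vB[OF that] by (auto simp: w_def)
  have uvw: "u t = (\<lambda>k. coef (v t) k + w t k)" for t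
    by (simp add: w_def)
  have B0: "0 \<le> B" and M0: "0 \<le> M"
    using h12_sq_nonneg[OF u[OF t]] uB[OF t] order_trans[OF norm_ge_zero M[OF t]] by auto
  define E where "E t = l2_sq (w t)" for t
  define F where "F t k = (cubic_coef (u t) k - coef (cubic (v t)) k) * cnj (w t k)" for t k
  define e where "e t = 2 * Im (l2_ip (conv (u t) (u t)) (conv (u t) (w t))
      - l2_ip (conv (coef (v t)) (coef (v t))) (conv (coef (v t)) (w t)))" for t
  \<comment> \<open>Energy of finitely many modes, differentiable by the modewise equation. Its
    integrated balance passes to the limit by dominated convergence.\<close>
  define EN where "EN N t = (\<Sum>k<N. (cmod (w t k))\<^sup>2)" for N t
  define eN where "eN N t = (\<Sum>k<N. 2 * Im (F t k))" for N t
  have w': "((\<lambda>s. w s k) has_vector_derivative - \<i> * (cubic_coef (u t) k - coef (cubic (v t)) k)) (at t within {0..T})"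
    if "t \<in> {0..T}" for t k
    unfolding w_def
    by (rule has_vector_derivative_eq_rhs[OF has_vector_derivative_diff[OF u'[OF that]
          bounded_linear.has_vector_derivative[OF bounded_linear_coef v'[OF that]]]])
       (simp add: algebra_simps)
  have EN': "(EN N has_vector_derivative eN N t) (at t within {0..T})" if "t \<in> {0..T}" for t N
  proof -
    have "((\<lambda>s. (cmod (w s k))\<^sup>2) has_vector_derivative 2 * Im (F t k)) (at t within {0..T})" for k
    proof -
      have eq: "(\<lambda>s. (cmod (w s k))\<^sup>2) = (\<lambda>s. w s k \<bullet> w s k)"
        by (simp add: power2_norm_eq_inner)
      show ?thesis
        unfolding eq
        by (rule has_vector_derivative_eq_rhs[OF bounded_bilinear.has_vector_derivative[OF bounded_bilinear_inner w'[OF that] w'[OF that]]])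
           (simp add: F_def inner_complex_def algebra_simps)
    qed
    then show ?thesis
      unfolding EN_def eN_def by (rule has_vector_derivative_sum)
  qed
  have eN_lim: "(\<lambda>N. eN N t) \<longlonglongrightarrow> e t" if "t \<in> {0..T}" for t
  proof -
    have "(\<lambda>k. F t k) sums (l2_ip (conv (u t) (u t)) (conv (u t) (w t))
      - l2_ip (conv (coef (v t)) (coef (v t))) (conv (coef (v t)) (w t)))"
      unfolding F_def left_diff_distrib coef_cubic
      by (intro sums_diff crr_sums_l2_ip(1) in_l2_conv u v w that)
    from sums_mult[OF sums_Im[OF this], of 2] show ?thesis
      unfolding eN_def e_def sums_def .
  qed
  \<comment> \<open>By \<open>h12_sq (w t) \<le> 4 * B\<close>, each of the two cubic terms
    contributes at most \<open>(B\<^sup>2 + 4 B\<^sup>2) / 2\<close>; the factor 2 in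
    \<open>eN\<close> turns their sum into \<open>10 * B\<^sup>2\<close>.\<close>
  have eN_bound: "\<bar>eN N t\<bar> \<le> 10 * B\<^sup>2" if "t \<in> {0..T}" for N t
  proof -
    have flux: "(\<Sum>k<N. cmod (cubic_coef x k) * cmod (w t k)) \<le> (B * B + B * (4 * B)) / 2"
      if x: "in_h12 x" "h12_sq x \<le> B" for x
      by (rule order_trans[OF crr_sums_l2_ip(2)[OF in_l2_conv(1)[OF x(1) x(1)] x(1) w(1)[OF \<open>t \<in> _\<close>]]],
          intro divide_right_mono add_mono mult_mono order_trans[OF in_l2_conv(2)[OF x(1) x(1)]])
         (use x w[OF \<open>t \<in> _\<close>] B0 h12_sq_nonneg in auto)
    have "\<bar>eN N t\<bar> \<le> (\<Sum>k<N. 2 * (cmod (cubic_coef (u t) k) * cmod (w t k)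
        + cmod (cubic_coef (coef (v t)) k) * cmod (w t k)))"
      unfolding eN_def
    proof (rule order_trans[OF sum_abs], rule sum_mono)
      fix k
      have "\<bar>2 * Im (F t k)\<bar> \<le> 2 * cmod (F t k)"
        using abs_Im_le_cmod[of "F t k"] by simp
      also have "cmod (F t k) \<le> (cmod (cubic_coef (u t) k)
          + cmod (cubic_coef (coef (v t)) k)) * cmod (w t k)"
        unfolding F_def norm_mult complex_mod_cnj coef_cubic by (intro mult_right_mono norm_triangle_ineq4) auto
      finally show "\<bar>2 * Im (F t k)\<bar> \<le> 2 * (cmod (cubic_coef (u t) k) * cmod (w t k)
        + cmod (cubic_coef (coef (v t)) k) * cmod (w t k))"
        by (simp add: algebra_simps)
    qed
    also have "\<dots> \<le> 2 * ((B * B + B * (4 * B)) / 2 + (B * B + B * (4 * B)) / 2)"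
      unfolding sum_distrib_left[symmetric] sum.distrib
      by (intro mult_left_mono add_mono flux u uB v vB that) auto
    finally show ?thesis
      by (simp add: power2_eq_square)
  qed
  have key: "e integrable_on {0..s} \<and> E s = integral {0..s} e" if s: "s \<in> {0..T}" for s
  proof -
    have sub: "{0..s} \<subseteq> {0..T}"
      using s by auto
    have int: "(eN N has_integral (EN N s - EN N 0)) {0..s}" for N
      by (rule fundamental_theorem_of_calculus)
         (use s in \<open>auto intro!: has_vector_derivative_within_subset[OF EN' sub]\<close>)
    have EN0: "EN N 0 = 0" for N
      using init by (simp add: EN_def w_def)
    have dom: "e integrable_on {0..s} \<and> (\<lambda>N. integral {0..s} (eN N)) \<longlonglongrightarrow> integral {0..s} e"
    proof -
      have "eN N integrable_on {0..s}" "(\<lambda>_. 10 * B\<^sup>2) integrable_on {0..s}" for N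
        using int by blast+
      moreover have "norm (eN N r) \<le> 10 * B\<^sup>2" if "r \<in> {0..s}" for N r
        using eN_bound[of r N] that sub by auto
      moreover have "(\<lambda>N. eN N r) \<longlonglongrightarrow> e r" if "r \<in> {0..s}" for r
        using eN_lim[of r] that sub by auto
      ultimately show ?thesis
        using dominated_convergence[of eN "{0..s}" "\<lambda>_. 10 * B\<^sup>2" e] by blast
    qed
    have "(\<lambda>N. EN N s) \<longlonglongrightarrow> E s"
      unfolding EN_def E_def l2_sq_def
      using in_h12_imp_in_l2(1)[OF w(1)[OF s]] by (intro summable_LIMSEQ) (simp add: in_l2_def)
    moreover have "integral {0..s} (eN N) = EN N s" for N
      using integral_unique[OF int[of N]] by (simp add: EN0)
    ultimately show ?thesis
      using dom LIMSEQ_unique by fastforce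
  qed
  define K where "K = 2 * (M\<^sup>2 + 2 * M * sqrt (4 * B)) + 1"
  have E0: "0 \<le> E s" if "s \<in> {0..T}" for s
    unfolding E_def using w[OF that] in_h12_imp_in_l2(1) l2_sq_nonneg by blast
  have "E t \<le> 0"
  proof (rule integral_gronwall_zero[of e T E K t])
    show "e integrable_on {0..T}"
      using key[of T] t by simp
    show "E s = integral {0..s} e" if "s \<in> {0..T}" for s
      using key[OF that] by simp
    show "\<bar>e s\<bar> \<le> K * E s" if s: "s \<in> {0..T}" for s
    proof -
      have "\<bar>e s\<bar> \<le> 2 * ((M\<^sup>2 + 2 * M * sqrt (h12_sq (w s))) * l2_sq (w s))"
        unfolding e_def uvw[of s] abs_mult
        using energy_flux_bound[OF v[OF s] w(1)[OF s] M[OF s]] by simp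
      also have "\<dots> \<le> 2 * ((M\<^sup>2 + 2 * M * sqrt (4 * B)) * E s)"
        unfolding E_def[symmetric] using w(2)[OF s] M0 E0[OF s]
        by (intro mult_left_mono mult_right_mono add_left_mono real_sqrt_le_mono) auto
      also have "\<dots> \<le> K * E s"
        using E0[OF s] by (simp add: K_def algebra_simps)
      finally show ?thesis .
    qed
    show "0 < K"
      unfolding K_def using M0 B0 by (intro add_nonneg_pos mult_nonneg_nonneg add_nonneg_nonneg) auto
  qed (rule t)
  then have "E t = 0"
    using E0[OF t] by simp
  then have "\<forall>k. (cmod (w t k))\<^sup>2 = 0"
    unfolding E_def l2_sq_def
    by (subst (asm) suminf_eq_zero_iff) (use in_h12_imp_in_l2(1)[OF w(1)[OF t]] in \<open>auto simp: in_l2_def\<close>)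
  then show ?thesis
    by (simp add: fun_eq_iff w_def)
qed

section \<open>Fourier series of square integrable functions\<close>

definition circle_measure :: "real measure" where
  "circle_measure = restrict_space lborel {0..2*pi}"

lemma space_circle_measure [simp]: "space circle_measure = {0..2*pi}"
  by (simp add: circle_measure_def space_restrict_space)

lemma finite_measure_circle: "finite_measure circle_measure"
  by (rule finite_measureI) (simp add: circle_measure_def emeasure_restrict_space)

interpretation circle: finite_measure circle_measure
  by (rule finite_measure_circle)

lemma circle_integrable_iff: "integrable circle_measure f \<longleftrightarrow> set_integrable lborel {0..2*pi} f"
  for f :: "real \<Rightarrow> 'a :: {banach, second_countable_topology}"
  unfolding circle_measure_def set_integrable_def by (rule integrable_restrict_space) simp

lemma circle_integral_eq: "integral\<^sup>L circle_measure f = (LINT \<theta>:{0..2*pi}|lborel. f \<theta>)"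
  for f :: "real \<Rightarrow> 'a :: {banach, second_countable_topology}"
  unfolding circle_measure_def set_lebesgue_integral_def by (rule integral_restrict_space) simp

lemma circle_measurable: "f \<in> borel_measurable borel \<Longrightarrow> f \<in> borel_measurable circle_measure"
  unfolding circle_measure_def by (rule measurable_restrict_space1) simp

lemma circle_measurable_continuous:
  "continuous_on UNIV f \<Longrightarrow> f \<in> borel_measurable circle_measure"
  by (intro circle_measurable borel_measurable_continuous_onI)

abbreviation circle_integral :: "(real \<Rightarrow> 'a :: {banach, second_countable_topology}) \<Rightarrow> 'a" where
  "circle_integral \<equiv> integral\<^sup>L circle_measure"

lemma fourier_coeff_eq:
  "fourier_coeff f k = circle_integral (\<lambda>\<theta>. f \<theta> * cis (- (real_of_int k * \<theta>))) / complex_of_real (2 * pi)"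
  unfolding fourier_coeff_def circle_integral_eq ..

definition sq_int :: "(real \<Rightarrow> complex) \<Rightarrow> bool" where
  "sq_int f \<longleftrightarrow> f \<in> borel_measurable circle_measure \<and> integrable circle_measure (\<lambda>\<theta>. (cmod (f \<theta>))\<^sup>2)"

definition sq_norm :: "(real \<Rightarrow> complex) \<Rightarrow> real" where
  "sq_norm f = circle_integral (\<lambda>\<theta>. (cmod (f \<theta>))\<^sup>2)"

lemma sq_norm_nonneg: "0 \<le> sq_norm f"
  unfolding sq_norm_def by (rule integral_nonneg_AE) simp

lemma sq_int_measurable: "sq_int f \<Longrightarrow> f \<in> borel_measurable circle_measure"
  by (simp add: sq_int_def)

lemma sq_int_bounded:
  assumes f: "f \<in> borel_measurable circle_measure" and "\<And>\<theta>. \<theta> \<in> {0..2*pi} \<Longrightarrow> cmod (f \<theta>) \<le> B"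
  shows "sq_int f"
  unfolding sq_int_def
proof
  have [measurable]: "f \<in> borel_measurable circle_measure" by (rule f)
  show "integrable circle_measure (\<lambda>\<theta>. (cmod (f \<theta>))\<^sup>2)"
    by (rule circle.integrable_const_bound[of _ "B\<^sup>2"]) (use assms(2) in \<open>auto intro!: AE_I2 power_mono\<close>)
qed (rule f)

lemma sq_int_mult_integrable:
  assumes "sq_int f" "sq_int g"
  shows "integrable circle_measure (\<lambda>\<theta>. f \<theta> * g \<theta>)"
proof (rule Bochner_Integration.integrable_bound)
  show "integrable circle_measure (\<lambda>\<theta>. (cmod (f \<theta>))\<^sup>2 + (cmod (g \<theta>))\<^sup>2)"
    using assms by (auto simp: sq_int_def)
  show "(\<lambda>\<theta>. f \<theta> * g \<theta>) \<in> borel_measurable circle_measure"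
    using assms by (auto simp: sq_int_def)
  show "AE \<theta> in circle_measure. norm (f \<theta> * g \<theta>) \<le> norm ((cmod (f \<theta>))\<^sup>2 + (cmod (g \<theta>))\<^sup>2)"
  proof (rule AE_I2)
    fix \<theta>
    show "norm (f \<theta> * g \<theta>) \<le> norm ((cmod (f \<theta>))\<^sup>2 + (cmod (g \<theta>))\<^sup>2)"
    proof -
      have "0 \<le> cmod (f \<theta>) * cmod (g \<theta>)" by simp
      then have "cmod (f \<theta>) * cmod (g \<theta>) \<le> (cmod (f \<theta>))\<^sup>2 + (cmod (g \<theta>))\<^sup>2"
        using sum_squares_bound[of "cmod (f \<theta>)" "cmod (g \<theta>)"] by linarith
      then show ?thesis by (simp add: norm_mult)
    qed
  qed
qed

lemma sq_int_add:
  assumes "sq_int f" "sq_int g"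
  shows "sq_int (\<lambda>\<theta>. f \<theta> + g \<theta>)" "sq_norm (\<lambda>\<theta>. f \<theta> + g \<theta>) \<le> 2 * sq_norm f + 2 * sq_norm g"
proof -
  have [measurable]: "f \<in> borel_measurable circle_measure" "g \<in> borel_measurable circle_measure"
    using assms by (auto simp: sq_int_def)
  have i: "integrable circle_measure (\<lambda>\<theta>. 2 * (cmod (f \<theta>))\<^sup>2 + 2 * (cmod (g \<theta>))\<^sup>2)"
    using assms by (auto simp: sq_int_def)
  have "integrable circle_measure (\<lambda>\<theta>. (cmod (f \<theta> + g \<theta>))\<^sup>2)"
    by (rule Bochner_Integration.integrable_bound[OF i])
       (auto intro!: AE_I2 order_trans[OF cmod_add_sq_le])
  then show 1: "sq_int (\<lambda>\<theta>. f \<theta> + g \<theta>)"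
    by (simp add: sq_int_def)
  have "sq_norm (\<lambda>\<theta>. f \<theta> + g \<theta>) \<le> circle_integral (\<lambda>\<theta>. 2 * (cmod (f \<theta>))\<^sup>2 + 2 * (cmod (g \<theta>))\<^sup>2)"
    unfolding sq_norm_def using 1 by (intro integral_mono i cmod_add_sq_le) (simp add: sq_int_def)
  also have "\<dots> = 2 * sq_norm f + 2 * sq_norm g"
    unfolding sq_norm_def using assms by (subst Bochner_Integration.integral_add) (auto simp: sq_int_def)
  finally show "sq_norm (\<lambda>\<theta>. f \<theta> + g \<theta>) \<le> 2 * sq_norm f + 2 * sq_norm g" .
qed

lemma sq_int_mult_bounded:
  assumes "sq_int f" "g \<in> borel_measurable circle_measure" "\<And>\<theta>. cmod (g \<theta>) \<le> B"
  shows "sq_int (\<lambda>\<theta>. g \<theta> * f \<theta>)"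
  unfolding sq_int_def
proof
  have [measurable]: "f \<in> borel_measurable circle_measure" "g \<in> borel_measurable circle_measure"
    using assms by (auto simp: sq_int_def)
  show "(\<lambda>\<theta>. g \<theta> * f \<theta>) \<in> borel_measurable circle_measure"
    by measurable
  show "integrable circle_measure (\<lambda>\<theta>. (cmod (g \<theta> * f \<theta>))\<^sup>2)"
  proof (rule Bochner_Integration.integrable_bound)
    show "integrable circle_measure (\<lambda>\<theta>. B\<^sup>2 * (cmod (f \<theta>))\<^sup>2)"
      using assms by (simp add: sq_int_def)
    show "AE \<theta> in circle_measure. norm ((cmod (g \<theta> * f \<theta>))\<^sup>2) \<le> norm (B\<^sup>2 * (cmod (f \<theta>))\<^sup>2)"
      using assms(3) by (intro AE_I2) (auto simp: norm_mult power_mult_distrib intro!: mult_right_mono power_mono)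
  qed measurable
qed

lemma sq_int_cmult: "sq_int f \<Longrightarrow> sq_int (\<lambda>\<theta>. c * f \<theta>)"
  by (rule sq_int_mult_bounded) auto

lemma sq_int_diff:
  assumes "sq_int f" "sq_int g"
  shows "sq_int (\<lambda>\<theta>. f \<theta> - g \<theta>)" "sq_norm (\<lambda>\<theta>. f \<theta> - g \<theta>) \<le> 2 * sq_norm f + 2 * sq_norm g"
  using sq_int_add[OF assms(1) sq_int_cmult[OF assms(2), of "-1"]] by (simp_all add: sq_norm_def)

lemma sq_int_cnj: "sq_int f \<Longrightarrow> sq_int (\<lambda>\<theta>. cnj (f \<theta>))"
  by (auto simp: sq_int_def intro: borel_measurable_continuous_on[of cnj] continuous_intros)

lemma sq_int_sum: "finite A \<Longrightarrow> (\<And>i. i \<in> A \<Longrightarrow> sq_int (f i)) \<Longrightarrow> sq_int (\<lambda>\<theta>. \<Sum>i\<in>A. f i \<theta>)"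
  by (induction A rule: finite_induct) (auto intro: sq_int_add sq_int_bounded[of _ 0])

lemma sq_int_cis: "sq_int (\<lambda>\<theta>. cis (a * \<theta>))"
  by (rule sq_int_bounded[of _ 1]) (auto intro!: circle_measurable_continuous continuous_intros simp: cis_conv_exp)

lemma sq_int_integrable: "sq_int f \<Longrightarrow> integrable circle_measure f"
  using sq_int_mult_integrable[OF sq_int_cis[of 0]] by simp

lemma sq_int_mult_cis:
  "sq_int f \<Longrightarrow> sq_int (\<lambda>\<theta>. f \<theta> * cis (a * \<theta>))"
  by (subst mult.commute, rule sq_int_mult_bounded[of _ _ 1]) (auto intro: sq_int_measurable sq_int_cis)

text \<open>A weighted mean inequality in place of Cauchy-Schwarz; the free parameter makes the
  fixed factor small, while the other tends to 0.\<close>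

lemma cmod_integral_mult_le:
  assumes "sq_int f" "sq_int g" "0 < \<eta>"
  shows "cmod (circle_integral (\<lambda>\<theta>. f \<theta> * g \<theta>)) \<le> \<eta> * sq_norm f + sq_norm g / \<eta>"
proof -
  have "cmod (circle_integral (\<lambda>\<theta>. f \<theta> * g \<theta>))
      \<le> circle_integral (\<lambda>\<theta>. cmod (f \<theta> * g \<theta>))"
    by (rule integral_norm_bound)
  also have "\<dots> \<le> circle_integral (\<lambda>\<theta>. \<eta> * (cmod (f \<theta>))\<^sup>2 + (cmod (g \<theta>))\<^sup>2 / \<eta>)"
  proof (rule integral_mono)
    show "integrable circle_measure (\<lambda>\<theta>. cmod (f \<theta> * g \<theta>))"
      using sq_int_mult_integrable[OF assms(1,2)] by simp
    show "integrable circle_measure (\<lambda>\<theta>. \<eta> * (cmod (f \<theta>))\<^sup>2 + (cmod (g \<theta>))\<^sup>2 / \<eta>)"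
      using assms by (auto simp: sq_int_def)
    fix \<theta>
    have "2 * (cmod (f \<theta>) * cmod (g \<theta>)) = 2 * (sqrt \<eta> * cmod (f \<theta>)) * (cmod (g \<theta>) / sqrt \<eta>)"
      using assms(3) by simp
    also have "\<dots> \<le> (sqrt \<eta> * cmod (f \<theta>))\<^sup>2 + (cmod (g \<theta>) / sqrt \<eta>)\<^sup>2"
      by (rule sum_squares_bound)
    also have "\<dots> = \<eta> * (cmod (f \<theta>))\<^sup>2 + (cmod (g \<theta>))\<^sup>2 / \<eta>"
      using assms(3) by (simp add: power_mult_distrib power_divide)
    finally have *: "2 * (cmod (f \<theta>) * cmod (g \<theta>)) \<le> \<eta> * (cmod (f \<theta>))\<^sup>2 + (cmod (g \<theta>))\<^sup>2 / \<eta>" .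
    show "cmod (f \<theta> * g \<theta>) \<le> \<eta> * (cmod (f \<theta>))\<^sup>2 + (cmod (g \<theta>))\<^sup>2 / \<eta>"
    proof -
      have "0 \<le> cmod (f \<theta>) * cmod (g \<theta>)" by simp
      with * show ?thesis unfolding norm_mult by linarith
    qed
  qed
  also have "\<dots> = \<eta> * sq_norm f + sq_norm g / \<eta>"
    unfolding sq_norm_def using assms by (subst Bochner_Integration.integral_add) (auto simp: sq_int_def)
  finally show ?thesis .
qed

lemma integral_mult_tendsto:
  assumes f: "sq_int f" and g: "sq_int g" "\<And>n. sq_int (p n)"
    and lim: "(\<lambda>n. sq_norm (\<lambda>\<theta>. g \<theta> - p n \<theta>)) \<longlonglongrightarrow> 0"
  shows "(\<lambda>n. circle_integral (\<lambda>\<theta>. f \<theta> * p n \<theta>)) \<longlonglongrightarrow> circle_integral (\<lambda>\<theta>. f \<theta> * g \<theta>)"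
proof (rule LIMSEQ_I)
  fix r :: real assume r: "0 < r"
  define \<eta> where "\<eta> = r / (2 * (sq_norm f + 1))"
  have \<eta>: "0 < \<eta>"
    using r sq_norm_nonneg[of f] by (simp add: \<eta>_def)
  have "\<eta> * sq_norm f \<le> \<eta> * (sq_norm f + 1)"
    using \<eta> by simp
  also have "\<dots> = r / 2"
    using sq_norm_nonneg[of f] by (simp add: \<eta>_def field_simps)
  finally have \<eta>': "\<eta> * sq_norm f \<le> r / 2" .
  have "\<forall>\<^sub>F n in sequentially. sq_norm (\<lambda>\<theta>. g \<theta> - p n \<theta>) < \<eta> * (r / 2)"
    using lim \<eta> r by (intro order_tendstoD(2)) auto
  then obtain N where N: "\<And>n. n \<ge> N \<Longrightarrow> sq_norm (\<lambda>\<theta>. g \<theta> - p n \<theta>) < \<eta> * (r / 2)"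
    by (auto simp: eventually_sequentially)
  have "norm (circle_integral (\<lambda>\<theta>. f \<theta> * p n \<theta>) - circle_integral (\<lambda>\<theta>. f \<theta> * g \<theta>)) < r"
    if "n \<ge> N" for n
  proof -
    have "norm (circle_integral (\<lambda>\<theta>. f \<theta> * p n \<theta>) - circle_integral (\<lambda>\<theta>. f \<theta> * g \<theta>))
        = cmod (circle_integral (\<lambda>\<theta>. f \<theta> * (g \<theta> - p n \<theta>)))"
      unfolding right_diff_distrib
      by (subst Bochner_Integration.integral_diff) (simp_all add: sq_int_mult_integrable f g norm_minus_commute)
    also have "\<dots> \<le> \<eta> * sq_norm f + sq_norm (\<lambda>\<theta>. g \<theta> - p n \<theta>) / \<eta>"
      by (intro cmod_integral_mult_le f sq_int_diff g \<eta>)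
    also have "sq_norm (\<lambda>\<theta>. g \<theta> - p n \<theta>) / \<eta> < r / 2"
      using N[OF that] \<eta> by (simp add: field_simps)
    finally show ?thesis
      using \<eta>' by simp
  qed
  then show "\<exists>no. \<forall>n\<ge>no. norm (circle_integral (\<lambda>\<theta>. f \<theta> * p n \<theta>) - circle_integral (\<lambda>\<theta>. f \<theta> * g \<theta>)) < r"
    by blast
qed

lemma integral_cis: "circle_integral (\<lambda>\<theta>. cis (real_of_int k * \<theta>)) = (if k = 0 then 2 * pi else 0)"
proof (cases "k = 0")
  case True
  then show ?thesis
    by (simp add: circle_measure_def measure_restrict_space scaleR_conv_of_real)
next
  case False
  have "(LINT x|lborel. indicator {0..2*pi} x *\<^sub>R cis (real_of_int k * x))
      = cis (real_of_int k * (2 * pi)) / (\<i> * k) - cis (real_of_int k * 0) / (\<i> * k)"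
  proof (rule integral_FTC_Icc)
    fix x :: real
    have "((\<lambda>z. exp (\<i> * (of_int k * z)) / (\<i> * k)) has_field_derivative exp (\<i> * (of_int k * of_real x))) (at (of_real x))"
      using False by (auto intro!: derivative_eq_intros simp: mult_ac)
    from has_vector_derivative_real_field[OF this]
    show "((\<lambda>x. cis (real_of_int k * x) / (\<i> * k)) has_vector_derivative cis (real_of_int k * x)) (at x within {0..2*pi})"
      by (simp add: cis_conv_exp)
  qed (auto intro!: continuous_intros simp: cis_conv_exp)
  also have "cis (real_of_int k * (2 * pi)) = 1"
    using cis_multiple_2pi[of "real_of_int k"] by (simp add: mult_ac)
  finally show ?thesis
    using False by (simp add: circle_integral_eq set_lebesgue_integral_def)
qed

lemma fourier_coeff_cis: "fourier_coeff (\<lambda>\<theta>. cis (real_of_int l * \<theta>)) k = (if k = l then 1 else 0)"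
proof -
  have "(\<lambda>\<theta>. cis (real_of_int l * \<theta>) * cis (- (real_of_int k * \<theta>))) = (\<lambda>\<theta>. cis (real_of_int (l - k) * \<theta>))"
    by (simp add: cis_mult fun_eq_iff algebra_simps)
  then show ?thesis
    unfolding fourier_coeff_eq using integral_cis[of "l - k"] by auto
qed

lemma fourier_coeff_linear:
  assumes "sq_int f" "sq_int g"
  shows "fourier_coeff (\<lambda>\<theta>. f \<theta> + g \<theta>) k = fourier_coeff f k + fourier_coeff g k"
    and "fourier_coeff (\<lambda>\<theta>. f \<theta> - g \<theta>) k = fourier_coeff f k - fourier_coeff g k"
    and "fourier_coeff (\<lambda>\<theta>. c * f \<theta>) k = c * fourier_coeff f k"
  using assms sq_int_integrable[OF sq_int_mult_cis[of _ "- real_of_int k"]]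
  by (simp_all add: fourier_coeff_eq distrib_right left_diff_distrib add_divide_distrib diff_divide_distrib mult.assoc)

lemma fourier_coeff_sum:
  "finite A \<Longrightarrow> (\<And>i. i \<in> A \<Longrightarrow> sq_int (f i)) \<Longrightarrow>
    fourier_coeff (\<lambda>\<theta>. \<Sum>i\<in>A. f i \<theta>) k = (\<Sum>i\<in>A. fourier_coeff (f i) k)"
proof (induction A rule: finite_induct)
  case (insert a A)
  then show ?case
    using fourier_coeff_linear(1)[of "f a" "\<lambda>\<theta>. \<Sum>i\<in>A. f i \<theta>" k] sq_int_sum[of A f] by simp
qed (simp add: fourier_coeff_eq)


section \<open>Density of trigonometric polynomials in L2\<close>

inductive trig_poly :: "(real \<Rightarrow> complex) \<Rightarrow> bool" where
  cis: "trig_poly (\<lambda>\<theta>. cis (real_of_int k * \<theta>))"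
| add: "trig_poly p \<Longrightarrow> trig_poly q \<Longrightarrow> trig_poly (\<lambda>\<theta>. p \<theta> + q \<theta>)"
| cmult: "trig_poly p \<Longrightarrow> trig_poly (\<lambda>\<theta>. c * p \<theta>)"

lemma trig_poly_sq_int: "trig_poly p \<Longrightarrow> sq_int p"
  by (induction rule: trig_poly.induct) (auto intro: sq_int_cis sq_int_add sq_int_cmult)

lemma trig_poly_const: "trig_poly (\<lambda>_. c)"
  using trig_poly.cmult[OF trig_poly.cis[of 0], of c] by simp

lemma trig_poly_mult_cis: "trig_poly p \<Longrightarrow> trig_poly (\<lambda>\<theta>. cis (real_of_int k * \<theta>) * p \<theta>)"
proof (induction rule: trig_poly.induct)
  case (cis l)
  have "(\<lambda>\<theta>. cis (real_of_int k * \<theta>) * cis (real_of_int l * \<theta>)) = (\<lambda>\<theta>. cis (real_of_int (k + l) * \<theta>))"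
    by (simp add: cis_mult distrib_right)
  then show ?case
    by (simp only: trig_poly.cis)
next
  case (cmult p c)
  then show ?case
    using trig_poly.cmult[of "\<lambda>\<theta>. cis (real_of_int k * \<theta>) * p \<theta>" c] by (simp add: mult.left_commute)
qed (simp add: distrib_left trig_poly.add)

lemma trig_poly_mult: "trig_poly p \<Longrightarrow> trig_poly q \<Longrightarrow> trig_poly (\<lambda>\<theta>. p \<theta> * q \<theta>)"
  by (induction rule: trig_poly.induct)
     (auto simp: distrib_right mult.assoc intro: trig_poly_mult_cis trig_poly.intros)

text \<open>Makes the Stone-Weierstrass theorem for polynomials in the real and imaginary part
  applicable: a real linear functional of \<open>cis \<theta>\<close> combines the frequencies 1 and
  -1.\<close>

lemma trig_poly_real_polynomial_function:
  "real_polynomial_function r \<Longrightarrow> trig_poly (\<lambda>\<theta>. complex_of_real (r (cis \<theta>)))"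
proof (induction r rule: real_polynomial_function.induct)
  case (linear r)
  interpret bounded_linear r by (rule linear)
  have "complex_of_real (r (cis \<theta>)) = (r 1 / 2 - \<i> * r \<i> / 2) * cis (real_of_int 1 * \<theta>)
      + (r 1 / 2 + \<i> * r \<i> / 2) * cis (real_of_int (- 1) * \<theta>)" for \<theta>
  proof -
    have "cis \<theta> = cos \<theta> *\<^sub>R 1 + sin \<theta> *\<^sub>R \<i>"
      by (simp add: complex_eq_iff)
    then have "r (cis \<theta>) = cos \<theta> * r 1 + sin \<theta> * r \<i>"
      by (simp only: add scaleR real_scaleR_def)
    then show ?thesis
      by (simp add: complex_eq_iff)
  qed
  then show ?case
    by (simp only: trig_poly.intros)
qed (simp_all add: trig_poly_const trig_poly.add trig_poly_mult)

text \<open>The function \<open>h\<close> need not be periodic. The cutoff vanishes near the point 1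
  of the circle and so hides both the jump of \<open>Arg2pi\<close> and the mismatch of
  \<open>h\<close> at 0 and 2 pi.\<close>

lemma trig_poly_dense_continuous:
  fixes h :: "real \<Rightarrow> complex" and \<phi> :: "real \<Rightarrow> real"
  assumes h: "continuous_on UNIV h" and \<phi>: "continuous_on UNIV \<phi>" "\<And>x. 1 - \<delta> < x \<Longrightarrow> \<phi> x = 0" and "0 < \<delta>" "0 < e"
  obtains p where "trig_poly p" "\<And>\<theta>. \<theta> \<in> {0..2*pi} \<Longrightarrow> cmod (complex_of_real (\<phi> (cos \<theta>)) * h \<theta> - p \<theta>) < e"
proof -
  define q where "q z = complex_of_real (\<phi> (Re z)) * h (Arg2pi z)" for z
  have "isCont q z" if z: "z \<in> sphere 0 1" for z
  proof (cases "z = 1")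
    case True
    have "open {z. 1 - \<delta> < Re z}"
      by (intro open_Collect_less continuous_intros)
    then have "eventually (\<lambda>z. z \<in> {z. 1 - \<delta> < Re z}) (nhds z)"
      by (rule eventually_nhds_in_open) (use True \<open>0 < \<delta>\<close> in simp)
    then have "eventually (\<lambda>z. q z = 0) (nhds z)"
      by eventually_elim (simp add: q_def \<phi>(2))
    then show ?thesis
      by (subst isCont_cong[where g = "\<lambda>_. 0"]) auto
  next
    case False
    then have "z \<notin> \<real>\<^sub>\<ge>\<^sub>0"
      using z by (auto elim!: nonneg_Reals_cases)
    then have "isCont Arg2pi z"
      by (rule continuous_at_Arg2pi)
    moreover have "isCont h (Arg2pi z)" "isCont \<phi> (Re z)"
      using h \<phi>(1) by (auto simp: continuous_on_eq_continuous_at)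
    ultimately have "isCont (\<lambda>z. h (Arg2pi z)) z" "isCont (\<lambda>z. \<phi> (Re z)) z"
      by (auto intro: isCont_o2 linear_continuous_at bounded_linear_Re)
    then show ?thesis
      unfolding q_def by (intro continuous_intros)
  qed
  then have "continuous_on (sphere 0 1) q"
    by (simp add: continuous_at_imp_continuous_on)
  then obtain P where P: "polynomial_function P" "\<And>z. z \<in> sphere 0 1 \<Longrightarrow> cmod (q z - P z) < e"
    using Stone_Weierstrass_polynomial_function[OF compact_sphere[of 0 1], of q e] \<open>0 < e\<close> by blast
  show ?thesis
  proof
    have "real_polynomial_function (\<lambda>z. Re (P z))" "real_polynomial_function (\<lambda>z. Im (P z))"
      using P(1) bounded_linear_Re bounded_linear_Im by (auto simp: polynomial_function_def o_def)
    then have "trig_poly (\<lambda>\<theta>. complex_of_real (Re (P (cis \<theta>))) + \<i> * complex_of_real (Im (P (cis \<theta>))))"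
      by (intro trig_poly.add trig_poly.cmult trig_poly_real_polynomial_function)
    then show "trig_poly (\<lambda>\<theta>. P (cis \<theta>))"
      by (simp flip: complex_eq)
    fix \<theta> :: real assume \<theta>: "\<theta> \<in> {0..2*pi}"
    have "q (cis \<theta>) = complex_of_real (\<phi> (cos \<theta>)) * h \<theta>"
    proof (cases "\<theta> = 2 * pi")
      case True
      then show ?thesis
        using \<phi>(2)[of 1] \<open>0 < \<delta>\<close> by (simp add: q_def)
    next
      case False
      then have "Arg2pi (cis \<theta>) = \<theta>"
        using \<theta> by (intro Arg2pi_unique[of 1]) (auto simp: cis_conv_exp)
      then show ?thesis
        by (simp add: q_def)
    qed
    then show "cmod (complex_of_real (\<phi> (cos \<theta>)) * h \<theta> - P (cis \<theta>)) < e"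
      using P(2)[of "cis \<theta>"] by simp
  qed
qed

lemma trig_poly_dense:
  assumes f: "sq_int f" and e: "0 < e"
  obtains p where "trig_poly p" "sq_norm (\<lambda>\<theta>. f \<theta> - p \<theta>) < e"
proof -
  have [measurable]: "f \<in> borel_measurable circle_measure"
    using f by (rule sq_int_measurable)
  \<comment> \<open>Approximation in three stages: \<open>f\<close> by bounded \<open>g n\<close>,
    this by continuous \<open>k m\<close> vanishing near the endpoints, and this by
    \<open>p\<close>. The squared errors e/8, e/16, e/32 add up to at most 5e/8.\<close>
  define g where "g n \<theta> = (if cmod (f \<theta>) \<le> real n then f \<theta> else 0)" for n \<theta>
  have [measurable]: "g n \<in> borel_measurable circle_measure" for n
    unfolding g_def by measurable
  have "(\<lambda>n. sq_norm (\<lambda>\<theta>. f \<theta> - g n \<theta>)) \<longlonglongrightarrow> circle_integral (\<lambda>\<theta>. 0)"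
    unfolding sq_norm_def
  proof (rule integral_dominated_convergence[where w = "\<lambda>\<theta>. (cmod (f \<theta>))\<^sup>2"])
    show "integrable circle_measure (\<lambda>\<theta>. (cmod (f \<theta>))\<^sup>2)"
      using f by (simp add: sq_int_def)
    show "AE \<theta> in circle_measure. (\<lambda>n. (cmod (f \<theta> - g n \<theta>))\<^sup>2) \<longlonglongrightarrow> 0"
    proof (rule AE_I2)
      fix \<theta>
      obtain N where N: "cmod (f \<theta>) \<le> real N"
        using real_arch_simple by blast
      have "\<forall>\<^sub>F n in sequentially. (cmod (f \<theta> - g n \<theta>))\<^sup>2 = 0"
        using eventually_ge_at_top[of N] by eventually_elim (use N in \<open>auto simp: g_def\<close>)
      then show "(\<lambda>n. (cmod (f \<theta> - g n \<theta>))\<^sup>2) \<longlonglongrightarrow> 0"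
        by (rule tendsto_eventually)
    qed
  qed (auto intro!: AE_I2 simp: g_def)
  then have "\<forall>\<^sub>F n in sequentially. sq_norm (\<lambda>\<theta>. f \<theta> - g n \<theta>) < e / 8"
    using e by (intro order_tendstoD(2)) auto
  then obtain n where n: "sq_norm (\<lambda>\<theta>. f \<theta> - g n \<theta>) < e / 8"
    by (auto simp: eventually_sequentially)
  have g_sq: "sq_int (g n)"
    by (rule sq_int_bounded[of _ "real n"]) (auto simp: g_def)
  define G where "G \<theta> = (if \<theta> \<in> {0..2*pi} then g n \<theta> else 0)" for \<theta>
  have G_eq: "G = (\<lambda>x. indicator {0..2*pi} x *\<^sub>R g n x)"
    by (auto simp: G_def indicator_def)
  have "G \<in> borel_measurable lborel"
    unfolding G_eq using \<open>g n \<in> borel_measurable circle_measure\<close>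
    by (subst (asm) circle_measure_def, subst (asm) borel_measurable_restrict_space_iff) auto
  then have "G \<in> borel_measurable (lebesgue_on UNIV)"
    by (intro measurable_restrict_space1 measurable_completion)
  then have "G measurable_on UNIV"
    by (subst measurable_on_iff_borel_measurable) auto
  then obtain N0 H where N0: "negligible N0" and H: "\<And>m. continuous_on UNIV (H m)"
    "\<And>x. x \<notin> N0 \<Longrightarrow> (\<lambda>m. H m x) \<longlonglongrightarrow> G x"
    by (auto simp: measurable_on_def)
  define B where "B = real n + 1"
  have B: "0 < B" by (simp add: B_def)
  \<comment> \<open>Radial truncation keeps the continuous approximants bounded by \<open>B\<close>,
    as dominated convergence requires, without changing their limit.\<close>
  define h where "h m x = complex_of_real (B / max B (cmod (H m x))) * H m x" for m x
  have hc: "continuous_on UNIV (h m)" for m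
    unfolding h_def using B by (intro continuous_intros H) (auto simp: max_def)
  have hB: "cmod (h m x) \<le> B" for m x
  proof -
    have "cmod (h m x) = B * (cmod (H m x) / max B (cmod (H m x)))"
      using B by (simp add: h_def norm_mult norm_divide abs_of_pos less_max_iff_disj)
    also have "\<dots> \<le> B * 1"
      using B by (intro mult_left_mono) (auto simp: divide_le_eq)
    finally show ?thesis by simp
  qed
  have h_lim: "(\<lambda>m. h m x) \<longlonglongrightarrow> G x" if "x \<notin> N0" for x
  proof -
    have "cmod (G x) \<le> B"
      by (simp add: G_def g_def B_def)
    then have "complex_of_real (B / max B (cmod (G x))) * G x = G x"
      using B by simp
    moreover have "(\<lambda>m. h m x) \<longlonglongrightarrow> complex_of_real (B / max B (cmod (G x))) * G x"
      unfolding h_def using B by (intro tendsto_intros H(2) that) (auto simp: max_def)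
    ultimately show ?thesis by simp
  qed
  \<comment> \<open>Vanishes for \<open>m (1 - x) \<le> 1\<close> and equals 1 for
    \<open>m (1 - x) \<ge> 2\<close>; the later threshold uses \<open>m + 1\<close> so that it also
    makes sense for \<open>m = 0\<close>.\<close>
  define \<phi> where "\<phi> m x = max 0 (min 1 (real m * (1 - x) - 1))" for m :: nat and x :: real
  have \<phi>c: "continuous_on UNIV (\<phi> m)" for m
    unfolding \<phi>_def by (intro continuous_intros)
  have \<phi>01: "0 \<le> \<phi> m x" "\<phi> m x \<le> 1" for m x
    by (auto simp: \<phi>_def)
  have \<phi>0: "\<phi> m x = 0" if "1 - 1 / (real m + 1) < x" for m x
  proof -
    have "(1 - x) * (real m + 1) < 1"
      using that by (simp add: field_simps)
    then have "real m * (1 - x) - 1 < - (1 - x)"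
      by (simp add: algebra_simps)
    moreover have "real m * (1 - x) - 1 \<le> 0"
    proof (cases "x \<le> 1")
      case False
      then show ?thesis
        by (smt (verit) mult_nonneg_nonpos of_nat_0_le_iff)
    qed (use calculation in linarith)
    ultimately show ?thesis by (simp add: \<phi>_def)
  qed
  have \<phi>_lim: "(\<lambda>m. \<phi> m x) \<longlonglongrightarrow> 1" if "x < 1" for x
  proof -
    obtain m0 where m0: "2 / (1 - x) \<le> real m0"
      using real_arch_simple by blast
    have "\<forall>\<^sub>F m in sequentially. \<phi> m x = 1"
      using eventually_ge_at_top[of m0]
    proof eventually_elim
      case (elim m)
      then have "2 / (1 - x) \<le> real m"
        using m0 by linarith
      then have "2 \<le> real m * (1 - x)"
        using that by (simp add: field_simps)
      then show ?case by (simp add: \<phi>_def)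
    qed
    then show ?thesis by (rule tendsto_eventually)
  qed
  define k where "k m \<theta> = complex_of_real (\<phi> m (cos \<theta>)) * h m \<theta>" for m \<theta>
  have kB: "cmod (k m \<theta>) \<le> B" for m \<theta>
    using mult_mono[OF \<phi>01(2)[of m "cos \<theta>"] hB[of m \<theta>]] \<phi>01(1)[of m "cos \<theta>"] by (simp add: k_def norm_mult)
  have [measurable]: "k m \<in> borel_measurable circle_measure" for m
    unfolding k_def
    by (intro circle_measurable_continuous continuous_intros hc continuous_on_compose2[OF \<phi>c]) auto
  have k_sq: "sq_int (k m)" for m
    by (rule sq_int_bounded[of _ B]) (auto simp: kB)
  have N0': "N0 \<union> {0, 2 * pi} \<in> null_sets lebesgue"
    using N0 by (simp add: negligible_iff_null_sets[symmetric])
  then have "AE \<theta> in lebesgue. \<theta> \<notin> N0 \<union> {0, 2 * pi}"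
    by (rule AE_not_in)
  then have "AE \<theta> in lborel. \<theta> \<notin> N0 \<union> {0, 2 * pi}"
    by (subst (asm) AE_completion_iff)
  then have ae: "AE \<theta> in circle_measure. \<theta> \<notin> N0 \<union> {0, 2 * pi}"
    unfolding circle_measure_def by (subst AE_restrict_space_iff) (auto elim: eventually_mono)
  have "(\<lambda>m. sq_norm (\<lambda>\<theta>. g n \<theta> - k m \<theta>)) \<longlonglongrightarrow> circle_integral (\<lambda>\<theta>. 0)"
    unfolding sq_norm_def
  proof (rule integral_dominated_convergence[where w = "\<lambda>\<theta>. (2 * B)\<^sup>2"])
    have "(\<lambda>m. (cmod (g n \<theta> - k m \<theta>))\<^sup>2) \<longlonglongrightarrow> 0"
      if \<theta>: "\<theta> \<in> {0..2*pi}" "\<theta> \<notin> N0 \<union> {0, 2 * pi}" for \<theta>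
    proof -
      have "cos \<theta> < 1"
      proof -
        have "cos \<theta> \<noteq> 1"
        proof
          assume "cos \<theta> = 1"
          then obtain j :: int where j: "\<theta> = real_of_int j * (2 * pi)"
            using cos_one_2pi_int[of \<theta>] by (auto simp: mult.assoc)
          have "0 < \<theta>" "\<theta> < 1 * (2 * pi)"
            using \<theta> by auto
          then have "0 < j" "j < 1"
            unfolding j by (simp_all add: zero_less_mult_iff)
          then show False by simp
        qed
        then show ?thesis
          using cos_le_one[of \<theta>] by linarith
      qed
      have "(\<lambda>m. k m \<theta>) \<longlonglongrightarrow> complex_of_real 1 * G \<theta>"
        unfolding k_def using \<theta> \<open>cos \<theta> < 1\<close> by (intro tendsto_intros \<phi>_lim h_lim) auto
      then have "(\<lambda>m. (cmod (g n \<theta> - k m \<theta>))\<^sup>2) \<longlonglongrightarrow> (cmod (g n \<theta> - complex_of_real 1 * G \<theta>))\<^sup>2"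
        by (intro tendsto_intros)
      then show ?thesis
        using \<theta> by (simp add: G_def)
    qed
    note lim = this
    show "AE \<theta> in circle_measure. (\<lambda>m. (cmod (g n \<theta> - k m \<theta>))\<^sup>2) \<longlonglongrightarrow> 0"
      by (rule AE_mp[OF ae], rule AE_I2, rule impI, rule lim) auto
    show "AE \<theta> in circle_measure. norm ((cmod (g n \<theta> - k m \<theta>))\<^sup>2) \<le> (2 * B)\<^sup>2" for m
    proof (rule AE_I2)
      fix \<theta>
      have "cmod (g n \<theta>) \<le> B"
        by (simp add: g_def B_def)
      then have "cmod (g n \<theta> - k m \<theta>) \<le> 2 * B"
        using kB[of m \<theta>] norm_triangle_ineq4[of "g n \<theta>" "k m \<theta>"] by linarith
      then show "norm ((cmod (g n \<theta> - k m \<theta>))\<^sup>2) \<le> (2 * B)\<^sup>2"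
        using power_mono[of "cmod (g n \<theta> - k m \<theta>)" "2 * B" 2] by simp
    qed
  qed auto
  then have "\<forall>\<^sub>F m in sequentially. sq_norm (\<lambda>\<theta>. g n \<theta> - k m \<theta>) < e / 16"
    using e by (intro order_tendstoD(2)) auto
  then obtain m where m: "sq_norm (\<lambda>\<theta>. g n \<theta> - k m \<theta>) < e / 16"
    by (auto simp: eventually_sequentially)
  define d where "d = sqrt (e / (64 * pi))"
  have d: "0 < d" "d\<^sup>2 = e / (64 * pi)"
    using e by (auto simp: d_def)
  obtain p where p: "trig_poly p" "\<And>\<theta>. \<theta> \<in> {0..2*pi} \<Longrightarrow> cmod (k m \<theta> - p \<theta>) < d"
  proof (rule trig_poly_dense_continuous[OF hc[of m] \<phi>c[of m], of "1 / (real m + 1)" d])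
    show "\<And>x. 1 - 1 / (real m + 1) < x \<Longrightarrow> \<phi> m x = 0"
      by (rule \<phi>0)
    show "0 < 1 / (real m + 1)" by simp
    fix p assume "trig_poly p" "\<And>\<theta>. \<theta> \<in> {0..2*pi} \<Longrightarrow> cmod (complex_of_real (\<phi> m (cos \<theta>)) * h m \<theta> - p \<theta>) < d"
    then show thesis
      by (intro that) (simp_all add: k_def)
  qed (rule d(1))
  have kp: "sq_int (\<lambda>\<theta>. k m \<theta> - p \<theta>)"
    by (intro sq_int_diff k_sq trig_poly_sq_int p)
  have "sq_norm (\<lambda>\<theta>. k m \<theta> - p \<theta>) \<le> circle_integral (\<lambda>\<theta>. d\<^sup>2)"
    unfolding sq_norm_def using kp p(2) d(1)
    by (intro integral_mono) (auto simp: sq_int_def less_imp_le intro!: power_mono)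
  also have "\<dots> = e / 32"
    using d(2) by (simp add: circle_measure_def measure_restrict_space)
  finally have kp': "sq_norm (\<lambda>\<theta>. k m \<theta> - p \<theta>) \<le> e / 32" .
  have "sq_norm (\<lambda>\<theta>. g n \<theta> - p \<theta>) \<le> 2 * (e / 16) + 2 * (e / 32)"
    using sq_int_add(2)[OF sq_int_diff(1)[OF g_sq k_sq[of m]] kp] m kp' by simp
  moreover have "sq_norm (\<lambda>\<theta>. f \<theta> - p \<theta>) \<le> 2 * sq_norm (\<lambda>\<theta>. f \<theta> - g n \<theta>) + 2 * sq_norm (\<lambda>\<theta>. g n \<theta> - p \<theta>)"
    using sq_int_add(2)[OF sq_int_diff(1)[OF f g_sq] sq_int_diff(1)[OF g_sq trig_poly_sq_int[OF p(1)]]] by simp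
  ultimately have "sq_norm (\<lambda>\<theta>. f \<theta> - p \<theta>) < e"
    using n e by linarith
  with p(1) show ?thesis
    using that by blast
qed


text \<open>The number \<open>n\<close> serves as a strict bound for the frequencies of
  \<open>p\<close>, obtained by induction.\<close>

lemma trig_poly_orthogonal:
  "trig_poly p \<Longrightarrow> \<exists>n. \<forall>F. sq_int F \<longrightarrow> (\<forall>k. \<bar>k\<bar> < n \<longrightarrow> fourier_coeff F k = 0) \<longrightarrow>
     circle_integral (\<lambda>\<theta>. F \<theta> * cnj (p \<theta>)) = 0"
proof (induction rule: trig_poly.induct)
  case (cis k)
  then show ?case
    by (intro exI[of _ "\<bar>k\<bar> + 1"]) (auto simp: fourier_coeff_eq cis_cnj)
next
  case (add p q)
  from add.IH obtain n m where
    "\<And>F. sq_int F \<Longrightarrow> \<forall>k. \<bar>k\<bar> < n \<longrightarrow> fourier_coeff F k = 0 \<Longrightarrow> circle_integral (\<lambda>\<theta>. F \<theta> * cnj (p \<theta>)) = 0"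
    "\<And>F. sq_int F \<Longrightarrow> \<forall>k. \<bar>k\<bar> < m \<longrightarrow> fourier_coeff F k = 0 \<Longrightarrow> circle_integral (\<lambda>\<theta>. F \<theta> * cnj (q \<theta>)) = 0"
    by blast
  then show ?case
    using add.hyps
    by (intro exI[of _ "max n m"])
       (simp add: distrib_left sq_int_mult_integrable sq_int_cnj trig_poly_sq_int)
next
  case (cmult p c)
  then obtain n where
    n: "\<And>F. sq_int F \<Longrightarrow> \<forall>k. \<bar>k\<bar> < n \<longrightarrow> fourier_coeff F k = 0 \<Longrightarrow> circle_integral (\<lambda>\<theta>. F \<theta> * cnj (p \<theta>)) = 0"
    by blast
  then show ?case
    by (intro exI[of _ n]) (simp add: mult.left_commute[of _ "cnj c"])
qed

section \<open>Partial sums of Fourier series of Hardy functions, and products\<close>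

definition partial_sum :: "(nat \<Rightarrow> complex) \<Rightarrow> nat \<Rightarrow> real \<Rightarrow> complex" where
  "partial_sum c N \<theta> = (\<Sum>k<N. c k * cis (real k * \<theta>))"

lemma cis_nat: "cis (real k * \<theta>) = cis (real_of_int (int k) * \<theta>)"
  by simp

lemma trig_poly_sum: "finite A \<Longrightarrow> (\<And>i. i \<in> A \<Longrightarrow> trig_poly (f i)) \<Longrightarrow> trig_poly (\<lambda>\<theta>. \<Sum>i\<in>A. f i \<theta>)"
  by (induction A rule: finite_induct) (auto intro: trig_poly.add trig_poly_const)

lemma trig_poly_partial_sum: "trig_poly (partial_sum c N)"
  unfolding partial_sum_def cis_nat by (intro trig_poly_sum trig_poly.intros) auto

lemmas sq_int_partial_sum = trig_poly_sq_int[OF trig_poly_partial_sum]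

lemma fourier_coeff_cis_nat: "fourier_coeff (\<lambda>\<theta>. cis (real l * \<theta>)) k = (if k = int l then 1 else 0)"
  using fourier_coeff_cis[of "int l" k] by simp

lemma fourier_coeff_partial_sum:
  "fourier_coeff (partial_sum c N) k = (if 0 \<le> k \<and> k < int N then c (nat k) else 0)"
proof -
  have "fourier_coeff (partial_sum c N) k = (\<Sum>j<N. c j * (if k = int j then 1 else 0))"
    unfolding partial_sum_def cis_nat
    by (subst fourier_coeff_sum) (auto simp: fourier_coeff_linear(3)[OF sq_int_cis sq_int_cis] fourier_coeff_cis_nat intro: sq_int_cmult sq_int_cis)
  also have "\<dots> = (\<Sum>j<N. if j = nat k then (if 0 \<le> k then c j else 0) else 0)"
    by (intro sum.cong) auto
  finally show ?thesis by auto
qed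

definition hardy_coeff :: "(real \<Rightarrow> complex) \<Rightarrow> nat \<Rightarrow> complex" where
  "hardy_coeff f k = fourier_coeff f (int k)"

lemma in_L2_T_sq_int: "in_L2_T f \<Longrightarrow> sq_int f"
  by (auto simp: in_L2_T_def sq_int_def circle_integrable_iff circle_measurable)

text \<open>The remainder \<open>F\<close> is orthogonal to the partial sum and, once
  \<open>N\<close> exceeds the degree of \<open>p\<close>, to \<open>p\<close>. So the squared norm
  of \<open>F\<close> is the pairing with \<open>f - p\<close>, and at most half itself plus half
  the squared norm of \<open>f - p\<close>.\<close>

theorem hardy_partial_sums_L2:
  assumes f: "sq_int f" and neg: "\<And>k. k < 0 \<Longrightarrow> fourier_coeff f k = 0"
  shows "(\<lambda>N. sq_norm (\<lambda>\<theta>. f \<theta> - partial_sum (hardy_coeff f) N \<theta>)) \<longlonglongrightarrow> 0"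
proof (rule LIMSEQ_I)
  fix r :: real assume "0 < r"
  then obtain p where p: "trig_poly p" "sq_norm (\<lambda>\<theta>. f \<theta> - p \<theta>) < r"
    using trig_poly_dense[OF f] by blast
  obtain n where n: "\<And>F. sq_int F \<Longrightarrow> \<forall>k. \<bar>k\<bar> < n \<longrightarrow> fourier_coeff F k = 0 \<Longrightarrow> circle_integral (\<lambda>\<theta>. F \<theta> * cnj (p \<theta>)) = 0"
    using trig_poly_orthogonal[OF p(1)] by blast
  have "sq_norm (\<lambda>\<theta>. f \<theta> - partial_sum (hardy_coeff f) N \<theta>) < r" if N: "nat n \<le> N" for N
  proof -
    define S where "S = partial_sum (hardy_coeff f) N"
    define F where "F \<theta> = f \<theta> - S \<theta>" for \<theta>
    have F: "sq_int F" and S: "sq_int S"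
      unfolding F_def S_def by (intro sq_int_diff f sq_int_partial_sum)+
    have F0: "fourier_coeff F k = 0" if "k < int N" for k
      using that neg[of k] fourier_coeff_linear(2)[OF f S, of k]
      by (cases "k < 0") (auto simp: F_def[abs_def] S_def fourier_coeff_partial_sum hardy_coeff_def)
    have Fp: "circle_integral (\<lambda>\<theta>. F \<theta> * cnj (p \<theta>)) = 0"
      by (rule n[OF F]) (use N F0 in auto)
    have FS: "circle_integral (\<lambda>\<theta>. F \<theta> * cnj (S \<theta>)) = 0"
    proof -
      have "circle_integral (\<lambda>\<theta>. F \<theta> * cis (- (real k * \<theta>))) = 0" if "k < N" for k
        using F0[of "int k"] that by (simp add: fourier_coeff_eq)
      moreover have "F \<theta> * cnj (S \<theta>) = (\<Sum>k<N. cnj (hardy_coeff f k) * (F \<theta> * cis (- (real k * \<theta>))))" for \<theta>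
        by (simp add: S_def partial_sum_def sum_distrib_left cis_cnj mult_ac)
      moreover have "integrable circle_measure (\<lambda>\<theta>. F \<theta> * cis (- (real k * \<theta>)))" for k
        using sq_int_integrable[OF sq_int_mult_cis[OF F, of "- real k"]] by simp
      ultimately show ?thesis
        by (simp add: Bochner_Integration.integral_sum)
    qed
    have fp: "sq_int (\<lambda>\<theta>. f \<theta> - p \<theta>)"
      by (intro sq_int_diff f trig_poly_sq_int p)
    have "complex_of_real (sq_norm F) = circle_integral (\<lambda>\<theta>. F \<theta> * cnj (F \<theta>))"
      unfolding sq_norm_def by (simp only: complex_norm_square[symmetric] integral_complex_of_real)
    also have "(\<lambda>\<theta>. F \<theta> * cnj (F \<theta>)) = (\<lambda>\<theta>. F \<theta> * cnj (f \<theta> - p \<theta>) + F \<theta> * cnj (p \<theta>) - F \<theta> * cnj (S \<theta>))"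
      by (simp add: F_def fun_eq_iff algebra_simps)
    also have "circle_integral \<dots> = circle_integral (\<lambda>\<theta>. F \<theta> * cnj (f \<theta> - p \<theta>))"
      using sq_int_mult_integrable[OF F sq_int_cnj[OF fp]] sq_int_mult_integrable[OF F sq_int_cnj[OF S]]
        sq_int_mult_integrable[OF F sq_int_cnj[OF trig_poly_sq_int[OF p(1)]]]
      by (simp del: complex_cnj_diff add: Fp FS)
    finally have eq: "sq_norm F = cmod (circle_integral (\<lambda>\<theta>. F \<theta> * cnj (f \<theta> - p \<theta>)))"
      using sq_norm_nonneg[of F] by (metis abs_of_nonneg norm_of_real)
    have "cmod (circle_integral (\<lambda>\<theta>. F \<theta> * cnj (f \<theta> - p \<theta>)))
        \<le> circle_integral (\<lambda>\<theta>. ((cmod (F \<theta>))\<^sup>2 + (cmod (f \<theta> - p \<theta>))\<^sup>2) / 2)"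
    proof (rule order_trans[OF integral_norm_bound], rule integral_mono)
      show "norm (F \<theta> * cnj (f \<theta> - p \<theta>)) \<le> ((cmod (F \<theta>))\<^sup>2 + (cmod (f \<theta> - p \<theta>))\<^sup>2) / 2" for \<theta>
        unfolding norm_mult complex_mod_cnj using sum_squares_bound[of "cmod (F \<theta>)" "cmod (f \<theta> - p \<theta>)"] by simp
      show "integrable circle_measure (\<lambda>\<theta>. norm (F \<theta> * cnj (f \<theta> - p \<theta>)))"
        using sq_int_mult_integrable[OF F sq_int_cnj[OF fp]] by (rule integrable_norm)
      show "integrable circle_measure (\<lambda>\<theta>. ((cmod (F \<theta>))\<^sup>2 + (cmod (f \<theta> - p \<theta>))\<^sup>2) / 2)"
        using F fp by (simp add: sq_int_def)
    qed
    also have "\<dots> = (sq_norm F + sq_norm (\<lambda>\<theta>. f \<theta> - p \<theta>)) / 2"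
      unfolding sq_norm_def using F fp by (simp add: sq_int_def)
    finally show ?thesis
      using eq p(2) by (simp add: F_def[abs_def] S_def)
  qed
  then show "\<exists>no. \<forall>N\<ge>no. norm (sq_norm (\<lambda>\<theta>. f \<theta> - partial_sum (hardy_coeff f) N \<theta>) - 0) < r"
    using sq_norm_nonneg by (intro exI[of _ "nat n"]) simp
qed

lemma partial_sum_sq:
  "partial_sum c N \<theta> * partial_sum c N \<theta>
    = partial_sum (conv (\<lambda>k. if k < N then c k else 0) (\<lambda>k. if k < N then c k else 0)) (2 * N) \<theta>"
proof -
  define d where "d = (\<lambda>k. if k < N then c k else 0)"
  have "partial_sum c N \<theta> * partial_sum c N \<theta> = (\<Sum>a<N. \<Sum>b<N. d a * d b * cis (real (a + b) * \<theta>))"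
    by (simp add: partial_sum_def sum_product d_def cis_mult ring_distribs mult_ac)
  also have "\<dots> = (\<Sum>(a, b)\<in>{..<N} \<times> {..<N}. d a * d b * cis (real (a + b) * \<theta>))"
    by (simp add: sum.cartesian_product)
  also have "\<dots> = (\<Sum>(n, a)\<in>Sigma {..<2 * N} (\<lambda>n. {..n}). d a * d (n - a) * cis (real n * \<theta>))"
  \<comment> \<open>The exceptional set consists of the antidiagonal entries outside the square,
    where the cut-off sequence \<open>d\<close> vanishes.\<close>
  proof (rule sum.reindex_bij_witness_not_neutral[where S' = "{}"
      and T' = "{(n, a) \<in> Sigma {..<2 * N} (\<lambda>n. {..n}). \<not> (a < N \<and> n - a < N)}"
      and i = "\<lambda>(n, a). (a, n - a)" and j = "\<lambda>(a, b). (a + b, a)"])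
    show "finite {(n, a) \<in> Sigma {..<2 * N} (\<lambda>n. {..n}). \<not> (a < N \<and> n - a < N)}"
      by (rule finite_subset[of _ "Sigma {..<2 * N} (\<lambda>n. {..n})"]) auto
  qed (auto simp: d_def)
  also have "\<dots> = partial_sum (conv d d) (2 * N) \<theta>"
    by (simp add: partial_sum_def conv_def sum.Sigma[symmetric] sum_distrib_right)
  finally show ?thesis
    by (simp add: d_def)
qed

lemma sq_norm_partial_sum: "sq_norm (partial_sum c N) = 2 * pi * (\<Sum>k<N. (cmod (c k))\<^sup>2)"
proof -
  have "complex_of_real (sq_norm (partial_sum c N))
      = circle_integral (\<lambda>\<theta>. partial_sum c N \<theta> * cnj (partial_sum c N \<theta>))"
    unfolding sq_norm_def by (simp only: complex_norm_square[symmetric] integral_complex_of_real)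
  also have "\<dots> = circle_integral (\<lambda>\<theta>. \<Sum>k<N. cnj (c k) * (partial_sum c N \<theta> * cis (- (real_of_int (int k) * \<theta>))))"
    by (subst (2) partial_sum_def) (simp add: sum_distrib_left cis_cnj mult_ac)
  also have "\<dots> = (\<Sum>k<N. cnj (c k) * (fourier_coeff (partial_sum c N) (int k) * (2 * pi)))"
    using sq_int_integrable[OF sq_int_mult_cis[OF sq_int_partial_sum[of c N], of "- real _"]]
    by (subst Bochner_Integration.integral_sum) (auto simp: fourier_coeff_eq)
  also have "\<dots> = complex_of_real (2 * pi * (\<Sum>k<N. (cmod (c k))\<^sup>2))"
    by (simp add: fourier_coeff_partial_sum sum_distrib_left mult_ac complex_norm_square del: of_real_power)
  finally show ?thesis
    by (simp only: of_real_eq_iff)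
qed

text \<open>By Fatou's lemma along an almost everywhere convergent subsequence of the partial sums, whose
  \<open>L\<^sup>4\<close> norms are bounded by the Sobolev embedding.\<close>

lemma hardy_square_sq_int:
  assumes f: "sq_int f" and neg: "\<And>k. k < 0 \<Longrightarrow> fourier_coeff f k = 0" and h: "in_h12 (hardy_coeff f)"
  shows "sq_int (\<lambda>\<theta>. f \<theta> * f \<theta>)"
proof -
  define c where "c = hardy_coeff f"
  define S where "S = partial_sum c"
  have S: "sq_int (S N)" for N
    unfolding S_def by (rule sq_int_partial_sum)
  have [measurable]: "f \<in> borel_measurable circle_measure" "S N \<in> borel_measurable circle_measure" for N
    using f S by (auto intro: sq_int_measurable)
  have S4: "(\<integral>\<^sup>+\<theta>. ennreal ((cmod (S N \<theta> * S N \<theta>))\<^sup>2) \<partial>circle_measure) \<le> ennreal (2 * pi * (h12_sq c)\<^sup>2)" for N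
  proof -
    define d where "d = (\<lambda>k. if k < N then c k else 0)"
    have d: "in_h12 d" "h12_sq d \<le> h12_sq c"
    proof -
      have le: "(1 + real k) * (cmod (d k))\<^sup>2 \<le> (1 + real k) * (cmod (c k))\<^sup>2" for k
        by (auto simp: d_def)
      show "in_h12 d"
        unfolding in_h12_def by (rule summable_comparison_test[OF _ h[unfolded in_h12_def c_def[symmetric]]]) (use le in auto)
      then show "h12_sq d \<le> h12_sq c"
        unfolding h12_sq_def using h by (intro suminf_le le) (auto simp: in_h12_def c_def)
    qed
    have SS: "(\<lambda>\<theta>. S N \<theta> * S N \<theta>) = partial_sum (conv d d) (2 * N)"
      by (simp add: fun_eq_iff S_def d_def partial_sum_sq)
    have "(\<integral>\<^sup>+\<theta>. ennreal ((cmod (S N \<theta> * S N \<theta>))\<^sup>2) \<partial>circle_measure) = ennreal (sq_norm (\<lambda>\<theta>. S N \<theta> * S N \<theta>))"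
      unfolding sq_norm_def using sq_int_partial_sum[of "conv d d" "2 * N"]
      by (intro nn_integral_eq_integral) (auto simp: SS[symmetric] sq_int_def)
    also have "sq_norm (\<lambda>\<theta>. S N \<theta> * S N \<theta>) \<le> 2 * pi * l2_sq (conv d d)"
      unfolding SS sq_norm_partial_sum l2_sq_def
      using in_l2_conv(1)[OF d(1) d(1)] by (intro mult_left_mono sum_le_suminf) (auto simp: in_l2_def)
    also have "\<dots> \<le> 2 * pi * (h12_sq c * h12_sq c)"
      using d h12_sq_nonneg[OF d(1)]
      by (intro mult_left_mono order_trans[OF in_l2_conv(2)[OF d(1) d(1)]] mult_mono) auto
    finally show ?thesis
      by (simp add: power2_eq_square ennreal_leI)
  qed
  have "(\<lambda>N. sq_norm (\<lambda>\<theta>. f \<theta> - S N \<theta>)) \<longlonglongrightarrow> 0"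
    unfolding S_def c_def by (rule hardy_partial_sums_L2[OF f neg])
  then obtain r :: "nat \<Rightarrow> nat" where
    ae: "AE \<theta> in circle_measure. (\<lambda>n. (cmod (f \<theta> - S (r n) \<theta>))\<^sup>2) \<longlonglongrightarrow> 0"
    using tendsto_L1_AE_subseq[of circle_measure "\<lambda>N \<theta>. (cmod (f \<theta> - S N \<theta>))\<^sup>2"] sq_int_diff(1)[OF f S]
    by (auto simp: sq_norm_def sq_int_def)
  have "AE \<theta> in circle_measure. ennreal ((cmod (f \<theta> * f \<theta>))\<^sup>2) = liminf (\<lambda>n. ennreal ((cmod (S (r n) \<theta> * S (r n) \<theta>))\<^sup>2))"
    using ae
  proof eventually_elim
    case (elim \<theta>)
    have "(\<lambda>n. sqrt ((cmod (f \<theta> - S (r n) \<theta>))\<^sup>2)) \<longlonglongrightarrow> sqrt 0"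
      by (intro tendsto_intros elim)
    then have "(\<lambda>n. f \<theta> - (f \<theta> - S (r n) \<theta>)) \<longlonglongrightarrow> f \<theta> - 0"
      by (intro tendsto_diff tendsto_const) (simp add: tendsto_norm_zero_iff)
    then have "(\<lambda>n. S (r n) \<theta>) \<longlonglongrightarrow> f \<theta>" by simp
    then have "(\<lambda>n. ennreal ((cmod (S (r n) \<theta> * S (r n) \<theta>))\<^sup>2)) \<longlonglongrightarrow> ennreal ((cmod (f \<theta> * f \<theta>))\<^sup>2)"
      by (intro tendsto_ennrealI tendsto_intros)
    then show ?case
      by (rule lim_imp_Liminf[OF sequentially_bot, symmetric])
  qed
  then have "(\<integral>\<^sup>+\<theta>. ennreal ((cmod (f \<theta> * f \<theta>))\<^sup>2) \<partial>circle_measure)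
      = (\<integral>\<^sup>+\<theta>. liminf (\<lambda>n. ennreal ((cmod (S (r n) \<theta> * S (r n) \<theta>))\<^sup>2)) \<partial>circle_measure)"
    by (rule nn_integral_cong_AE)
  also have "\<dots> \<le> liminf (\<lambda>n. \<integral>\<^sup>+\<theta>. ennreal ((cmod (S (r n) \<theta> * S (r n) \<theta>))\<^sup>2) \<partial>circle_measure)"
    by (rule nn_integral_liminf) measurable
  also have "\<dots> \<le> ennreal (2 * pi * (h12_sq c)\<^sup>2)"
    by (intro Liminf_le eventuallyI S4) simp
  also have "\<dots> < \<infinity>" by simp
  finally have "integrable circle_measure (\<lambda>\<theta>. (cmod (f \<theta> * f \<theta>))\<^sup>2)"
    by (intro integrableI_bounded) auto
  then show ?thesis
    by (simp add: sq_int_def)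
qed

text \<open>The partial sums of \<open>f\<close> converge in L2 and are tested against the L2
  function \<open>F\<close> times a character, so the product itself need only be
  integrable.\<close>

lemma fourier_coeff_mult_lim:
  assumes F: "sq_int F" and f: "sq_int f" and neg: "\<And>k. k < 0 \<Longrightarrow> fourier_coeff f k = 0"
  shows "(\<lambda>N. \<Sum>j<N. hardy_coeff f j * fourier_coeff F (k - int j)) \<longlonglongrightarrow> fourier_coeff (\<lambda>\<theta>. F \<theta> * f \<theta>) k"
    and "(\<lambda>j. fourier_coeff F (k + int j) * cnj (hardy_coeff f j)) sums fourier_coeff (\<lambda>\<theta>. F \<theta> * cnj (f \<theta>)) k"
proof -
  define c where "c = hardy_coeff f"
  define G where "G \<theta> = F \<theta> * cis (- real_of_int k * \<theta>)" for \<theta>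
  have G: "sq_int G"
    unfolding G_def by (rule sq_int_mult_cis[OF F])
  have Fi: "integrable circle_measure (\<lambda>\<theta>. F \<theta> * cis (- (real_of_int l * \<theta>)))" for l
    using sq_int_integrable[OF sq_int_mult_cis[OF F, of "- real_of_int l"]] by simp
  have lim: "(\<lambda>N. sq_norm (\<lambda>\<theta>. f \<theta> - partial_sum c N \<theta>)) \<longlonglongrightarrow> 0"
    unfolding c_def by (rule hardy_partial_sums_L2[OF f neg])
  have "(\<lambda>N. circle_integral (\<lambda>\<theta>. G \<theta> * partial_sum c N \<theta>) / complex_of_real (2 * pi))
      \<longlonglongrightarrow> circle_integral (\<lambda>\<theta>. G \<theta> * f \<theta>) / complex_of_real (2 * pi)"
    by (intro tendsto_divide tendsto_const integral_mult_tendsto[OF G f sq_int_partial_sum lim]) auto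
  moreover have "circle_integral (\<lambda>\<theta>. G \<theta> * partial_sum c N \<theta>) / complex_of_real (2 * pi)
      = (\<Sum>j<N. c j * fourier_coeff F (k - int j))" for N
  proof -
    have "G \<theta> * partial_sum c N \<theta> = (\<Sum>j<N. c j * (F \<theta> * cis (- (real_of_int (k - int j) * \<theta>))))" for \<theta>
      by (simp add: G_def partial_sum_def sum_distrib_left mult_ac cis_mult algebra_simps)
    moreover have "integrable circle_measure (\<lambda>\<theta>. F \<theta> * cis (- ((real_of_int k - real j) * \<theta>)))" for j
      using Fi[of "k - int j"] by simp
    ultimately show ?thesis
      by (simp add: Bochner_Integration.integral_sum fourier_coeff_eq sum_divide_distrib)
  qed
  ultimately show "(\<lambda>N. \<Sum>j<N. hardy_coeff f j * fourier_coeff F (k - int j)) \<longlonglongrightarrow> fourier_coeff (\<lambda>\<theta>. F \<theta> * f \<theta>) k"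
    by (simp add: fourier_coeff_eq G_def c_def mult_ac)
  have lim': "(\<lambda>N. sq_norm (\<lambda>\<theta>. cnj (f \<theta>) - cnj (partial_sum c N \<theta>))) \<longlonglongrightarrow> 0"
    using lim by (simp add: sq_norm_def flip: complex_cnj_diff)
  have "(\<lambda>N. circle_integral (\<lambda>\<theta>. G \<theta> * cnj (partial_sum c N \<theta>)) / complex_of_real (2 * pi))
      \<longlonglongrightarrow> circle_integral (\<lambda>\<theta>. G \<theta> * cnj (f \<theta>)) / complex_of_real (2 * pi)"
    by (intro tendsto_divide tendsto_const
        integral_mult_tendsto[OF G sq_int_cnj[OF f] sq_int_cnj[OF sq_int_partial_sum] lim']) auto
  moreover have "circle_integral (\<lambda>\<theta>. G \<theta> * cnj (partial_sum c N \<theta>)) / complex_of_real (2 * pi)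
      = (\<Sum>j<N. fourier_coeff F (k + int j) * cnj (c j))" for N
  proof -
    have "G \<theta> * cnj (partial_sum c N \<theta>) = (\<Sum>j<N. cnj (c j) * (F \<theta> * cis (- (real_of_int (k + int j) * \<theta>))))" for \<theta>
      by (simp add: G_def partial_sum_def sum_distrib_left mult_ac cis_mult cis_cnj algebra_simps)
    moreover have "integrable circle_measure (\<lambda>\<theta>. F \<theta> * cis (- ((real_of_int k + real j) * \<theta>)))" for j
      using Fi[of "k + int j"] by simp
    ultimately show ?thesis
      by (simp add: Bochner_Integration.integral_sum fourier_coeff_eq sum_divide_distrib mult.commute)
  qed
  ultimately show "(\<lambda>j. fourier_coeff F (k + int j) * cnj (hardy_coeff f j)) sums fourier_coeff (\<lambda>\<theta>. F \<theta> * cnj (f \<theta>)) k"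
    by (simp add: sums_def fourier_coeff_eq G_def c_def mult_ac)
qed

text \<open>Write the nonlinearity as \<open>(f f) cnj f\<close>: the first product is in L2 by the
  Sobolev embedding, so the product rule applies twice. The inner sum is finite because negative
  coefficients vanish.\<close>

theorem fourier_coeff_cubic:
  assumes f: "sq_int f" and neg: "\<And>k. k < 0 \<Longrightarrow> fourier_coeff f k = 0" and h: "in_h12 (hardy_coeff f)"
  shows "fourier_coeff (\<lambda>\<theta>. complex_of_real ((cmod (f \<theta>))\<^sup>2) * f \<theta>) (int k)
    = cubic_coef (hardy_coeff f) k"
proof -
  define c where "c = hardy_coeff f"
  have sq: "fourier_coeff (\<lambda>\<theta>. f \<theta> * f \<theta>) (int n) = conv c c n" for n
  proof -
    have "(\<Sum>j<N. c j * fourier_coeff f (int n - int j)) = conv c c n" if N: "Suc n \<le> N" for N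
    proof -
      have "(\<Sum>j<N. c j * fourier_coeff f (int n - int j)) = (\<Sum>j\<le>n. c j * fourier_coeff f (int n - int j))"
        using N by (intro sum.mono_neutral_right) (auto simp: neg)
      also have "\<dots> = conv c c n"
        unfolding conv_def by (intro sum.cong) (auto simp: c_def hardy_coeff_def of_nat_diff)
      finally show ?thesis .
    qed
    then have "(\<lambda>N. \<Sum>j<N. c j * fourier_coeff f (int n - int j)) \<longlonglongrightarrow> conv c c n"
      by (intro tendsto_eventually) (auto simp: eventually_sequentially)
    then show ?thesis
      using fourier_coeff_mult_lim(1)[OF f f neg, of "int n"] unfolding c_def by (rule LIMSEQ_unique[rotated])
  qed
  have "(\<lambda>j. fourier_coeff (\<lambda>\<theta>. f \<theta> * f \<theta>) (int k + int j) * cnj (c j)) sums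
      fourier_coeff (\<lambda>\<theta>. (f \<theta> * f \<theta>) * cnj (f \<theta>)) (int k)"
    unfolding c_def by (rule fourier_coeff_mult_lim(2)[OF hardy_square_sq_int[OF f neg h] f neg])
  moreover have "fourier_coeff (\<lambda>\<theta>. f \<theta> * f \<theta>) (int k + int j) = conv c c (k + j)" for j
    using sq[of "k + j"] by simp
  moreover have "(\<lambda>\<theta>. (f \<theta> * f \<theta>) * cnj (f \<theta>)) = (\<lambda>\<theta>. complex_of_real ((cmod (f \<theta>))\<^sup>2) * f \<theta>)"
    unfolding complex_norm_square by (simp add: fun_eq_iff mult_ac)
  ultimately show ?thesis
    by (simp add: crr_def sums_iff flip: c_def)
qed

section \<open>Solutions of the cubic Szego equation\<close>

text \<open>The exponential weight dominates the linear one, at the price of a constant that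
  degenerates as the radius tends to 0.\<close>

lemma one_plus_le_exp:
  fixes \<tau> :: real
  assumes "0 < \<tau>"
  shows "1 + real k \<le> (1 + 1 / \<tau>) * exp (\<tau> * real k)"
proof -
  have "1 + \<tau> * real k \<le> exp (\<tau> * real k)"
    by (rule exp_ge_add_one_self)
  moreover have "0 \<le> \<tau> * real k"
    using assms by simp
  ultimately have "1 \<le> exp (\<tau> * real k)" "\<tau> * real k \<le> exp (\<tau> * real k)"
    by linarith+
  moreover from this have "real k \<le> exp (\<tau> * real k) / \<tau>"
    using assms by (simp add: pos_le_divide_eq mult.commute)
  ultimately have "1 + real k \<le> exp (\<tau> * real k) + exp (\<tau> * real k) / \<tau>"
    by linarith
  then show ?thesis
    by (simp add: algebra_simps)
qed

lemma in_h12_of_gevrey: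
  assumes \<tau>: "0 < \<tau>" and s: "summable (\<lambda>k. exp (\<tau> * real k) * cmod (x k))"
    and C: "(\<Sum>k. exp (\<tau> * real k) * cmod (x k)) \<le> C"
  shows "in_h12 x" "h12_sq x \<le> (1 + 1 / \<tau>) * C\<^sup>2"
proof -
  have xC: "cmod (x k) \<le> C" for k
  proof -
    have "1 * cmod (x k) \<le> exp (\<tau> * real k) * cmod (x k)"
      using \<tau> by (intro mult_right_mono) auto
    also have "\<dots> \<le> (\<Sum>k. exp (\<tau> * real k) * cmod (x k))"
      using sum_le_suminf[OF s, of "{k}"] by simp
    finally show ?thesis
      using C by simp
  qed
  then have C0: "0 \<le> C"
    using norm_ge_zero order_trans by blast
  have le: "(1 + real k) * (cmod (x k))\<^sup>2 \<le> (1 + 1 / \<tau>) * C * (exp (\<tau> * real k) * cmod (x k))" for k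
  proof -
    have "(1 + real k) * (cmod (x k) * cmod (x k)) \<le> ((1 + 1 / \<tau>) * exp (\<tau> * real k)) * (C * cmod (x k))"
      using \<tau> C0 by (intro mult_mono one_plus_le_exp xC order_refl) auto
    then show ?thesis
      by (simp add: power2_eq_square mult_ac)
  qed
  have s': "summable (\<lambda>k. (1 + 1 / \<tau>) * C * (exp (\<tau> * real k) * cmod (x k)))"
    by (intro summable_mult s)
  show "in_h12 x"
    unfolding in_h12_def by (rule summable_comparison_test[OF _ s']) (use le in auto)
  then have "h12_sq x \<le> (\<Sum>k. (1 + 1 / \<tau>) * C * (exp (\<tau> * real k) * cmod (x k)))"
    unfolding h12_sq_def by (intro suminf_le le s') (simp add: in_h12_def)
  also have "\<dots> = (1 + 1 / \<tau>) * C * (\<Sum>k. exp (\<tau> * real k) * cmod (x k))"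
    by (rule suminf_mult[OF s])
  also have "\<dots> \<le> (1 + 1 / \<tau>) * C * C"
    using \<tau> C0 C by (intro mult_left_mono) auto
  finally show "h12_sq x \<le> (1 + 1 / \<tau>) * C\<^sup>2"
    by (simp add: power2_eq_square mult.assoc)
qed

text \<open>\<open>B\<close> and the radius at \<open>T\<close> may depend on \<open>T\<close>, but
  they enter only the uniqueness argument; \<open>C\<close> and \<open>lam\<close> are fixed by the
  datum.\<close>

theorem szego_coefficients_gevrey_bound:
  fixes u :: "real \<Rightarrow> nat \<Rightarrow> complex" and \<sigma> M Y C lam B T :: real
  assumes \<sigma>: "0 < \<sigma>"
    and u: "\<And>t. t \<in> {0..T} \<Longrightarrow> in_h12 (u t)" "\<And>t. t \<in> {0..T} \<Longrightarrow> h12_sq (u t) \<le> B"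
    and u': "\<And>t k. t \<in> {0..T} \<Longrightarrow>
      ((\<lambda>s. u s k) has_vector_derivative - \<i> * cubic_coef (u t) k) (at t within {0..T})"
    and s: "summable (\<lambda>k. exp (\<sigma> * real k) * cmod (u 0 k))"
    and Y: "(\<Sum>k. exp (\<sigma> * real k) * cmod (u 0 k)) \<le> Y"
    and M: "2 * (\<Sum>k. cmod (u 0 k) * (k + 1)) \<le> M"
    and C: "max M Y + 1 \<le> C" and lam: "M * C\<^sup>2 < lam"
    and t: "t \<in> {0..T}"
  shows "summable (\<lambda>k. exp (\<sigma> * exp (- lam * t) * real k) * cmod (u t k))"
    and "(\<Sum>k. exp (\<sigma> * exp (- lam * t) * real k) * cmod (u t k)) \<le> C"
proof -
  define u0 where "u0 = Ell1 (u 0)"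
  have s1: "summable (\<lambda>k. cmod (u 0 k) * real (k + 1))"
  proof (rule summable_comparison_test)
    show "\<exists>N. \<forall>n\<ge>N. norm (cmod (u 0 n) * real (n + 1)) \<le> (1 + 1 / \<sigma>) * (exp (\<sigma> * real n) * cmod (u 0 n))"
      using mult_right_mono[OF one_plus_le_exp[OF \<sigma>] norm_ge_zero[of "u 0 _"]]
      by (intro exI allI impI) (simp add: abs_mult mult_ac add.commute)
  qed (intro summable_mult s)
  have s0: "summable (\<lambda>k. cmod (u 0 k))"
    by (rule summable_comparison_test[OF _ s1]) (auto simp: algebra_simps)
  then have coef_u0: "coef u0 = u 0"
    unfolding u0_def by (intro Ell1_inverse) simp
  have "0 \<le> T"
    using t by auto
  have "\<exists>v. v 0 = u0
      \<and> (\<forall>t\<in>{0..T}. szego_ode v T t)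
      \<and> (\<forall>t\<in>{0..T}. norm (v t) \<le> 2 * (\<Sum>k. cmod (u 0 k) * (k + 1)))"
  proof (rule szego_solution_ell1[OF \<open>0 \<le> T\<close>])
    show "summable (\<lambda>k. cmod (coef u0 k) * (k + 1))"
      using s1 by (simp only: coef_u0)
  next
    fix v assume "v 0 = u0"
      "\<And>t. t \<in> {0..T} \<Longrightarrow> szego_ode v T t"
      "\<And>t. t \<in> {0..T} \<Longrightarrow> norm (v t) \<le> 2 * (\<Sum>k. cmod (coef u0 k) * (k + 1))"
    then show ?thesis
      unfolding coef_u0 by (intro exI[of _ v] conjI ballI)
  qed
  then obtain v where v0: "v 0 = u0"
    and v: "\<And>t. t \<in> {0..T} \<Longrightarrow> szego_ode v T t"
    and v_le: "\<And>t. t \<in> {0..T} \<Longrightarrow> norm (v t) \<le> 2 * (\<Sum>k. cmod (u 0 k) * (k + 1))"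
    by (elim exE conjE) (rule that; blast)
  have vM: "norm (v t) \<le> M" if "t \<in> {0..T}" for t
    using v_le[OF that] M by linarith
  have gev: "summable (\<lambda>k. exp (\<sigma> * exp (- lam * t) * real k) * cmod (coef (v t) k))"
    "(\<Sum>k. exp (\<sigma> * exp (- lam * t) * real k) * cmod (coef (v t) k)) \<le> C" if "t \<in> {0..T}" for t
    using gevrey_bound_ell1[of \<sigma> T v M Y C lam t] \<sigma> v vM s Y C lam that by (simp_all add: v0 coef_u0)
  \<comment> \<open>The smallest radius on \<open>{0..T}\<close>; it gives an H^1/2 bound for
    \<open>v\<close> uniform in time.\<close>
  define \<tau> where "\<tau> = \<sigma> * exp (- lam * T)"
  have M0: "0 \<le> M"
    using vM[OF t] norm_ge_zero order_trans by blast
  have lam0: "0 < lam"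
    using lam M0 by (smt (verit) mult_nonneg_nonneg zero_le_power2)
  have vh: "in_h12 (coef (v t))" "h12_sq (coef (v t)) \<le> (1 + 1 / \<tau>) * C\<^sup>2" if t: "t \<in> {0..T}" for t
  proof -
    define \<tau>t where "\<tau>t = \<sigma> * exp (- lam * t)"
    have "0 < \<tau>t" "0 < \<tau>" "\<tau> \<le> \<tau>t"
      using \<sigma> lam0 t by (auto simp: \<tau>_def \<tau>t_def)
    note h = in_h12_of_gevrey[OF \<open>0 < \<tau>t\<close> gev[OF t, folded \<tau>t_def]]
    show "in_h12 (coef (v t))"
      by (rule h)
    have "(1 + 1 / \<tau>t) * C\<^sup>2 \<le> (1 + 1 / \<tau>) * C\<^sup>2"
      using \<open>0 < \<tau>\<close> \<open>\<tau> \<le> \<tau>t\<close> by (intro mult_right_mono add_left_mono divide_left_mono) auto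
    then show "h12_sq (coef (v t)) \<le> (1 + 1 / \<tau>) * C\<^sup>2"
      using h(2) by linarith
  qed
  have "u t = coef (v t)"
    by (rule szego_unique[of T u "max B ((1 + 1 / \<tau>) * C\<^sup>2)" v M])
       (use u u' v vM vh t in \<open>auto simp: v0 coef_u0 le_max_iff_disj\<close>)
  then show "summable (\<lambda>k. exp (\<sigma> * exp (- lam * t) * real k) * cmod (u t k))"
    and "(\<Sum>k. exp (\<sigma> * exp (- lam * t) * real k) * cmod (u t k)) \<le> C"
    using gev[OF t] by simp_all
qed

text \<open>Conjugated coefficients belong to \<open>cnj (u (- \<theta>))\<close>; this commutation
  underlies the symmetry for negative times.\<close>

lemma cubic_coef_cnj:
  assumes "in_h12 x"
  shows "cubic_coef (\<lambda>k. cnj (x k)) n = cnj (cubic_coef x n)"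
proof -
  have "in_l2 (\<lambda>b. conv x x (n + b))"
    using in_l2_conv(1)[OF assms assms] summable_iff_shift[of "\<lambda>k. (cmod (conv x x k))\<^sup>2" n]
    by (simp add: in_l2_def add.commute)
  then have "summable (\<lambda>b. conv x x (n + b) * cnj (x b))"
    by (rule summable_l2_ip(2)) (rule in_h12_imp_in_l2(1)[OF assms])
  from bounded_linear.suminf[OF bounded_linear_cnj this]
  show ?thesis
    by (simp add: crr_def conv_def)
qed

lemma has_sum_int_nonneg_iff:
  fixes g :: "int \<Rightarrow> 'a :: {comm_monoid_add, topological_space}"
  assumes "\<And>k. k < 0 \<Longrightarrow> g k = 0"
  shows "(g has_sum S) UNIV \<longleftrightarrow> ((\<lambda>n. g (int n)) has_sum S) UNIV"
proof -
  have "(g has_sum S) UNIV \<longleftrightarrow> (g has_sum S) (range int)"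
  proof (rule has_sum_cong_neutral)
    show "g x = 0" if "x \<in> UNIV - range int" for x
      using that assms[of x] by (metis DiffD2 nonneg_int_cases not_le rangeI)
  qed auto
  also have "\<dots> \<longleftrightarrow> (g \<circ> int has_sum S) UNIV"
    by (rule has_sum_reindex) (auto simp: inj_on_def)
  finally show ?thesis
    by (simp add: o_def)
qed

lemma summable_on_int_nonneg:
  fixes g :: "int \<Rightarrow> real"
  assumes "\<And>k. k < 0 \<Longrightarrow> g k = 0" "\<And>k. 0 \<le> g k"
  shows "g summable_on UNIV \<longleftrightarrow> summable (\<lambda>n. g (int n))"
    and "summable (\<lambda>n. g (int n)) \<Longrightarrow> infsum g UNIV = (\<Sum>n. g (int n))"
proof -
  show *: "g summable_on UNIV \<longleftrightarrow> summable (\<lambda>n. g (int n))"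
    unfolding summable_on_UNIV_nonneg_real_iff[OF assms(2), symmetric]
    by (simp add: summable_on_def has_sum_int_nonneg_iff[of g, OF assms(1)])
  assume "summable (\<lambda>n. g (int n))"
  then have "(g has_sum infsum g UNIV) UNIV"
    using * by (simp add: has_sum_infsum)
  then have "((\<lambda>n. g (int n)) has_sum infsum g UNIV) UNIV"
    using has_sum_int_nonneg_iff[of g, OF assms(1)] by simp
  then show "infsum g UNIV = (\<Sum>n. g (int n))"
    by (rule has_sum_imp_sums[THEN sums_unique])
qed

lemma sobolev_weight_bounds: "1 + real k \<le> 2 * (1 + (real k)\<^sup>2) powr (1/2)" "(1 + (real k)\<^sup>2) powr (1/2) \<le> 1 + real k"
proof -
  have eq: "(1 + (real k)\<^sup>2) powr (1/2) = sqrt (1 + (real k)\<^sup>2)"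
    by (simp add: powr_half_sqrt add_nonneg_nonneg)
  have "1 + real k \<le> sqrt ((2::real)\<^sup>2 * (1 + (real k)\<^sup>2))"
  proof (rule real_le_rsqrt)
    have "2 * real k \<le> 1 + (real k)\<^sup>2"
      using sum_squares_bound[of 1 "real k"] by simp
    then have "1 + 2 * real k + (real k)\<^sup>2 \<le> 4 + 4 * (real k)\<^sup>2"
      using zero_le_power2[of "real k"] by linarith
    then show "(1 + real k)\<^sup>2 \<le> (2::real)\<^sup>2 * (1 + (real k)\<^sup>2)"
      by (simp add: power2_sum)
  qed
  then show "1 + real k \<le> 2 * (1 + (real k)\<^sup>2) powr (1/2)"
    unfolding eq real_sqrt_mult by simp
  show "(1 + (real k)\<^sup>2) powr (1/2) \<le> 1 + real k"
    unfolding eq by (rule real_le_lsqrt) (auto simp: power2_sum)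
qed

lemma hardy_H12:
  assumes neg: "\<And>k. k < 0 \<Longrightarrow> fourier_coeff f k = 0"
  shows "(\<lambda>k::int. (1 + (real_of_int k)\<^sup>2) powr (1/2) * (cmod (fourier_coeff f k))\<^sup>2) summable_on UNIV \<longleftrightarrow> in_h12 (hardy_coeff f)"
    and "in_h12 (hardy_coeff f) \<Longrightarrow> h12_sq (hardy_coeff f) \<le> 2 * (H_norm (1/2) f)\<^sup>2"
proof -
  define g where "g k = (1 + (real_of_int k)\<^sup>2) powr (1/2) * (cmod (fourier_coeff f k))\<^sup>2" for k
  have g: "g k = 0" if "k < 0" for k
    using neg[OF that] by (simp add: g_def)
  have g0: "0 \<le> g k" for k
    by (simp add: g_def)
  have gn: "g (int n) = (1 + (real n)\<^sup>2) powr (1/2) * (cmod (hardy_coeff f n))\<^sup>2" for n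
    by (simp add: g_def hardy_coeff_def)
  have le1: "(1 + real n) * (cmod (hardy_coeff f n))\<^sup>2 \<le> 2 * g (int n)" for n
    using mult_right_mono[OF sobolev_weight_bounds(1)[of n], of "(cmod (hardy_coeff f n))\<^sup>2"] by (simp add: gn mult.assoc)
  have le2: "g (int n) \<le> (1 + real n) * (cmod (hardy_coeff f n))\<^sup>2" for n
    unfolding gn by (intro mult_right_mono sobolev_weight_bounds) simp
  have iff: "summable (\<lambda>n. g (int n)) \<longleftrightarrow> in_h12 (hardy_coeff f)"
  proof
    assume "summable (\<lambda>n. g (int n))"
    then have "summable (\<lambda>n. 2 * g (int n))"
      by (rule summable_mult)
    then show "in_h12 (hardy_coeff f)"
      unfolding in_h12_def by (rule summable_comparison_test[rotated]) (use le1 in auto)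
  next
    assume "in_h12 (hardy_coeff f)"
    then show "summable (\<lambda>n. g (int n))"
      unfolding in_h12_def by (rule summable_comparison_test[rotated]) (use le2 g0 in auto)
  qed
  then show "(\<lambda>k::int. (1 + (real_of_int k)\<^sup>2) powr (1/2) * (cmod (fourier_coeff f k))\<^sup>2) summable_on UNIV \<longleftrightarrow> in_h12 (hardy_coeff f)"
    using summable_on_int_nonneg(1)[of g, OF g g0] unfolding g_def by simp
  assume h: "in_h12 (hardy_coeff f)"
  then have s: "summable (\<lambda>n. g (int n))"
    by (simp add: iff)
  have H: "H_norm (1/2) f = sqrt (\<Sum>n. g (int n))"
  proof -
    have "H_norm (1/2) f = sqrt (infsum g UNIV)"
      by (simp add: H_norm_def g_def[abs_def])
    also have "infsum g UNIV = (\<Sum>n. g (int n))"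
      by (rule summable_on_int_nonneg(2)[of g, OF g g0 s])
    finally show ?thesis .
  qed
  have "h12_sq (hardy_coeff f) \<le> (\<Sum>n. 2 * g (int n))"
    unfolding h12_sq_def using h by (intro suminf_le le1 summable_mult s) (simp add: in_h12_def)
  also have "\<dots> = 2 * (\<Sum>n. g (int n))"
    by (rule suminf_mult[OF s])
  also have "\<dots> = 2 * (H_norm (1/2) f)\<^sup>2"
    unfolding H using suminf_nonneg[OF s] g0 by simp
  finally show "h12_sq (hardy_coeff f) \<le> 2 * (H_norm (1/2) f)\<^sup>2" .
qed

text \<open>Continuity in H^1/2 is given through norms of differences only, which yields local
  bounds; compactness makes them uniform.\<close>

lemma locally_bounded_imp_bounded_Icc:
  fixes f :: "real \<Rightarrow> real"
  assumes "\<And>x. \<exists>d>0. \<exists>B. \<forall>y. \<bar>y - x\<bar> < d \<longrightarrow> f y \<le> B"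
  shows "\<exists>B. \<forall>x\<in>{a..b}. f x \<le> B"
proof -
  obtain d B where d: "\<And>x. 0 < d x" and B: "\<And>x y. \<bar>y - x\<bar> < d x \<Longrightarrow> f y \<le> B x"
    using assms by metis
  obtain X where X: "X \<subseteq> {a..b}" "finite X" "{a..b} \<subseteq> (\<Union>x\<in>X. ball x (d x))"
    by (rule compactE_image[of "{a..b}" "{a..b}" "\<lambda>x. ball x (d x)"]) (use d in auto)
  have "f y \<le> Max (insert 0 (B ` X))" if y: "y \<in> {a..b}" for y
  proof -
    obtain x where "x \<in> X" "y \<in> ball x (d x)"
      using X(3) y by blast
    then have "f y \<le> B x" "B x \<le> Max (insert 0 (B ` X))"
      using B[of y x] X(2) by (auto simp: dist_real_def abs_minus_commute)
    then show ?thesis by linarith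
  qed
  then show ?thesis by blast
qed

lemma szego_solution_coefficients:
  assumes "szego_solution u u0"
  defines "c \<equiv> \<lambda>t. hardy_coeff (u t)"
  shows "sq_int (u t)" "k < 0 \<Longrightarrow> fourier_coeff (u t) k = 0" "in_h12 (c t)"
    and "((\<lambda>s. c s n) has_vector_derivative - \<i> * cubic_coef (c t) n) (at t)"
    and "\<exists>B. \<forall>t\<in>{a..b}. h12_sq (c t) \<le> B"
proof -
  have sol: "in_H_plus (1/2) (u t)" "((\<lambda>t. H_norm (1/2) (\<lambda>\<theta>. u t \<theta> - u t0 \<theta>)) \<longlongrightarrow> 0) (at t0)"
    "0 \<le> j \<Longrightarrow> ((\<lambda>s. fourier_coeff (u s) j) has_vector_derivative
           (- \<i> * fourier_coeff (\<lambda>\<theta>. complex_of_real ((cmod (u t \<theta>))\<^sup>2) * u t \<theta>) j)) (at t)" for t t0 j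
    using assms(1) unfolding szego_solution_def by blast+
  show sq: "sq_int (u t)" for t
    using sol(1)[of t] by (auto simp: in_H_plus_def in_H_def intro: in_L2_T_sq_int)
  show neg: "fourier_coeff (u t) k = 0" if "k < 0" for t k
    using sol(1)[of t] that by (auto simp: in_H_plus_def in_L2_plus_def)
  show h: "in_h12 (c t)" for t
    unfolding c_def using sol(1)[of t] hardy_H12(1)[of "u t", OF neg] by (simp add: in_H_plus_def in_H_def)
  show "((\<lambda>s. c s n) has_vector_derivative - \<i> * cubic_coef (c t) n) (at t)"
    using sol(3)[of "int n" t] fourier_coeff_cubic[OF sq neg h[unfolded c_def], of t n]
    by (simp add: c_def hardy_coeff_def)
  show "\<exists>B. \<forall>t\<in>{a..b}. h12_sq (c t) \<le> B"
  proof (rule locally_bounded_imp_bounded_Icc)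
    fix t0
    have "\<forall>\<^sub>F t in at t0. H_norm (1/2) (\<lambda>\<theta>. u t \<theta> - u t0 \<theta>) < 1"
      by (rule order_tendstoD(2)[OF sol(2)]) simp
    then obtain d where d: "0 < d" "\<And>t. t \<noteq> t0 \<Longrightarrow> dist t t0 < d \<Longrightarrow> H_norm (1/2) (\<lambda>\<theta>. u t \<theta> - u t0 \<theta>) < 1"
      by (auto simp: eventually_at)
    \<comment> \<open>The difference has squared norm at most 2, by the factor 2 between the
      weights, and adding \<open>c t0\<close> doubles both contributions.\<close>
    have "h12_sq (c t) \<le> 4 + 2 * h12_sq (c t0)" if "\<bar>t - t0\<bar> < d" for t
    proof (cases "t = t0")
      case True
      then show ?thesis
        using h12_sq_nonneg[OF h[of t0]] by simp
    next
      case False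
      define w where "w = (\<lambda>k. c t k - c t0 k)"
      have coeff: "fourier_coeff (\<lambda>\<theta>. u t \<theta> - u t0 \<theta>) j = fourier_coeff (u t) j - fourier_coeff (u t0) j" for j
        by (rule fourier_coeff_linear(2)[OF sq sq])
      have w: "hardy_coeff (\<lambda>\<theta>. u t \<theta> - u t0 \<theta>) = w"
        by (simp add: fun_eq_iff hardy_coeff_def coeff w_def c_def)
      have hw: "in_h12 w"
        unfolding w_def by (rule in_h12_diff(1)[OF h h])
      have "h12_sq w \<le> 2 * (H_norm (1/2) (\<lambda>\<theta>. u t \<theta> - u t0 \<theta>))\<^sup>2"
        using hardy_H12(2)[of "\<lambda>\<theta>. u t \<theta> - u t0 \<theta>"] hw neg by (simp add: w coeff)
      also have "\<dots> \<le> 2 * 1\<^sup>2"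
      proof -
        have "0 \<le> H_norm (1/2) (\<lambda>\<theta>. u t \<theta> - u t0 \<theta>)"
          unfolding H_norm_def by (intro real_sqrt_ge_zero infsum_nonneg) simp
        then show ?thesis
          using d(2)[OF False] that by (intro mult_left_mono power_mono) (auto simp: dist_real_def)
      qed
      finally have "h12_sq w \<le> 2" by simp
      moreover have "(\<lambda>k. w k + c t0 k) = c t"
        by (simp add: w_def fun_eq_iff)
      ultimately show ?thesis
        using in_h12_add(2)[OF hw h[of t0]] by simp
    qed
    with d(1) show "\<exists>d>0. \<exists>B. \<forall>t. \<bar>t - t0\<bar> < d \<longrightarrow> h12_sq (c t) \<le> B"
      by blast
  qed
qed

theorem theorem1p2:
  fixes \<sigma> :: real and u0 :: "real \<Rightarrow> complex" and u :: "real \<Rightarrow> real \<Rightarrow> complex"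
  assumes "\<sigma> > 0"
    and "in_L2_plus u0"
    and "in_gevrey \<sigma> u0"
    and "szego_solution u u0"
  shows "\<exists>lam>0. \<exists>C0>0. \<forall>t::real.
           in_gevrey (\<sigma> * exp (- lam * \<bar>t\<bar>)) (u t) \<and>
           gevrey_norm (\<sigma> * exp (- lam * \<bar>t\<bar>)) (u t) \<le> C0"
proof -
  define c where "c t = hardy_coeff (u t)" for t
  note sol = szego_solution_coefficients[OF assms(4), folded c_def]
  have u0: "u 0 = u0"
    using assms(4) by (simp add: szego_solution_def)
  have gevrey: "(\<lambda>k::int. exp (\<tau> * \<bar>real_of_int k\<bar>) * cmod (fourier_coeff (u t) k)) summable_on UNIV
      \<longleftrightarrow> summable (\<lambda>n. exp (\<tau> * real n) * cmod (c t n))"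
    "summable (\<lambda>n. exp (\<tau> * real n) * cmod (c t n)) \<Longrightarrow>
      gevrey_norm \<tau> (u t) = (\<Sum>n. exp (\<tau> * real n) * cmod (c t n))" for \<tau> t
    using summable_on_int_nonneg[of "\<lambda>k. exp (\<tau> * \<bar>real_of_int k\<bar>) * cmod (fourier_coeff (u t) k)"] sol(2)[of _ t]
    by (simp_all add: c_def hardy_coeff_def gevrey_norm_def)
  have s: "summable (\<lambda>k. exp (\<sigma> * real k) * cmod (c 0 k))"
    using assms(3) gevrey(1)[of \<sigma> 0] by (simp add: in_gevrey_def u0)
  define Y where "Y = (\<Sum>k. exp (\<sigma> * real k) * cmod (c 0 k))"
  \<comment> \<open>The maximum with 0 makes \<open>C\<close> and \<open>lam\<close> positive
    irrespective of the sum. All constants involve only the moduli of \<open>c 0\<close> and thus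
    also serve the reflected solution.\<close>
  define M where "M = max 0 (2 * (\<Sum>k. cmod (c 0 k) * (k + 1)))"
  define C where "C = max M Y + 1"
  define lam where "lam = M * C\<^sup>2 + 1"
  have pos: "0 < C" "0 < lam"
    by (auto simp: C_def lam_def M_def intro!: add_nonneg_pos mult_nonneg_nonneg)
  have le: "(\<Sum>k. exp (\<sigma> * real k) * cmod (c 0 k)) \<le> Y" "2 * (\<Sum>k. cmod (c 0 k) * (k + 1)) \<le> M"
    "max M Y + 1 \<le> C" "M * C\<^sup>2 < lam"
    by (simp_all add: Y_def M_def C_def lam_def)
  have bound: "summable (\<lambda>k. exp (\<sigma> * exp (- lam * \<bar>t\<bar>) * real k) * cmod (c t k)) \<and>
      (\<Sum>k. exp (\<sigma> * exp (- lam * \<bar>t\<bar>) * real k) * cmod (c t k)) \<le> C" for t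
  proof (cases "0 \<le> t")
    case True
    obtain B where B: "\<And>s. s \<in> {0..t} \<Longrightarrow> h12_sq (c s) \<le> B"
      using sol(5) by blast
    have "t \<in> {0..t}"
      using True by simp
    note szego_coefficients_gevrey_bound[of \<sigma> t c B Y M C lam t,
        OF assms(1) sol(3) B has_vector_derivative_at_within[OF sol(4)] s le this]
    with True show ?thesis
      by simp
  next
    case False
    text \<open>The equation is invariant under \<open>u(t, \<theta>) \<mapsto> cnj (u(-t, -\<theta>))\<close>.\<close>
    define w where "w s = (\<lambda>k. cnj (c (- s) k))" for s
    obtain B where B: "\<And>s. s \<in> {t..0} \<Longrightarrow> h12_sq (c s) \<le> B"
      using sol(5) by blast
    have w: "in_h12 (w s)" "h12_sq (w s) = h12_sq (c (- s))" for s
      using sol(3)[of "- s"] by (simp_all add: w_def in_h12_def h12_sq_def)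
    have w': "((\<lambda>s. w s k) has_vector_derivative - \<i> * cubic_coef (w s) k) (at s within {0..- t})" for s k
    proof -
      have "(uminus has_vector_derivative -1) (at s within {0..- t})"
        by (auto intro!: derivative_eq_intros)
      moreover have "((\<lambda>s. c s k) has_vector_derivative - \<i> * cubic_coef (c (- s)) k)
          (at (- s) within uminus ` {0..- t})"
        by (rule has_vector_derivative_at_within[OF sol(4)])
      ultimately have "((\<lambda>s. c s k) \<circ> uminus has_vector_derivative
          -1 *\<^sub>R (- \<i> * cubic_coef (c (- s)) k)) (at s within {0..- t})"
        by (rule vector_diff_chain_within)
      from bounded_linear.has_vector_derivative[OF bounded_linear_cnj this]
      show ?thesis
        by (simp add: w_def o_def cubic_coef_cnj[OF sol(3)])
    qed
    have w0: "cmod (w 0 k) = cmod (c 0 k)" "cmod (w (- t) k) = cmod (c t k)" for k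
      by (simp_all add: w_def)
    have wB: "h12_sq (w r) \<le> B" if "r \<in> {0..- t}" for r
      using B[of "- r"] that by (simp add: w)
    have "- t \<in> {0..- t}"
      using False by simp
    note szego_coefficients_gevrey_bound[of \<sigma> "- t" w B Y M C lam "- t", unfolded w0,
        OF assms(1) w(1) wB w' s le this]
    with False show ?thesis
      by simp
  qed
  have L1: "in_L1_T (u t)" for t
    using assms(4) sq_int_integrable[OF sol(1)[of t]]
    by (auto simp: szego_solution_def in_H_plus_def in_H_def in_L2_T_def in_L1_T_def circle_integrable_iff)
  have "in_gevrey (\<sigma> * exp (- lam * \<bar>t\<bar>)) (u t) \<and> gevrey_norm (\<sigma> * exp (- lam * \<bar>t\<bar>)) (u t) \<le> C" for t
    using bound[of t] L1[of t] gevrey[of "\<sigma> * exp (- lam * \<bar>t\<bar>)" t] by (simp add: in_gevrey_def)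
  with pos show ?thesis
    by blast
qed



end
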